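(* Let $m$ be fixed and let the $X_{i,j}$ ($1\leq j\leq m$, $1\leq i\leq n_j$) be i.i.d. with a common distribution satisfying condition $\mathcal{C}_2(\gamma,\rho,A)$ (stated in the context). Suppose that there is $\ell\in\{1,\ldots,m-1\}$ such that: - for any $j\in\{1,\ldots,\ell\}$, as $n\to\infty$, $k_j\to\infty$ with $k_j/n_j\to0$, $n_1/n_j\to b_j\in(0,\infty)$, $k_1/k_j\to c_j\in(0,\infty)$ (so $b_1=c_1=1$) and $\sqrt{k_j}A(n_j/k_j)\to\lambda_j\in\mathbb{R}$; - for any $j\in\{\ell+1,\ldots,m\}$, $k_j=k_j(n)$ is a nondecreasing sequence with $k_j/n_j\to0$, $k_1/k_j\to\infty$ as $n\to\infty$ and $\sqrt{k_j}A(n_j/k_j)=\operatorname{O}(1)$. Let $k=\sum_{j=1}^mk_j$, $\widetilde{\boldsymbol{\omega}}_n^{(\mathrm{Var})}=(k_1/k,\ldots,k_m/k)^\top$, $\lambda=\lim_{n\to\infty}\sqrt{k}A(\sum_{i=1}^\ell n_i/\sum_{i=1}^\ell k_i)\in\mathbb{R}$ and, for $1\leq j\leq\ell$, $d_j=(c_j/b_j)\times(\sum_{i=1}^\ell c_i^{-1})/(\sum_{i=1}^\ell b_i^{-1})$. Then $$\sqrt{k}(\widehat{\gamma}_n(\widetilde{\boldsymbol{\omega}}_n^{(\mathrm{Var})})-\gamma)\stackrel{d}{\longrightarrow}\mathcal{N}\left(\frac{\lambda}{1-\rho}\left(\sum_{j=1}^\ell\frac1{c_j}\right)^{-1}\left(\sum_{j=1}^\ell\frac{d_j^\rho}{c_j}\right),\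 \gamma^2\right).$$ If moreover $\rho<0$ and $p=p(n)\to0$ is such that $k/(np)\to\infty$, $\sqrt{k}/\log(k/(np))\to\infty$, $$\max_{1\leq j\leq m}\frac{\sqrt{k_j}}{\sqrt{k}}\left|\frac{\log(k_j/(n_jp))}{\log(k/(np))}-1\right|\to0\quad\text{and}\quad\max_{\ell+1\leq j\leq m}\frac{\sqrt{k_j}}{\sqrt{k}}\times\sqrt{k_j}|A(1/p)|=\operatorname{O}(1)$$ as $n\to\infty$, then $$\frac{\sqrt{k}}{\log(k/(np))}\left(\frac{\widehat{q}_n^\star(1-p|\widetilde{\boldsymbol{\omega}}_n^{(\mathrm{Var})})}{q(1-p)}-1\right)\stackrel{d}{\longrightarrow}\mathcal{N}\left(\frac{\lambda}{1-\rho}\left(\sum_{j=1}^\ell\frac1{c_j}\right)^{-1}\left(\sum_{j=1}^\ell\frac{d_j^\rho}{c_j}\right),\ \gamma^2\right).$$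
   Context: Here $n_j=n_j(n)\to\infty$, $n=\sum_{j=1}^mn_j$ is the total sample size, and $k_j=k_j(n)\geq1$ are integers. The common distribution function $F$ is continuous, with quantile function $q$ and tail quantile function $U(t)=\inf\{x\in\mathbb{R}:1/(1-F(x))\geq t\}$, so $q(1-p)=U(1/p)$. Condition $\mathcal{C}_2(\gamma,\rho,A)$: $\gamma>0$, $\rho\leq0$, $A$ has constant sign and converges to $0$ at infinity, and for all $x>0$, $\lim_{t\to\infty}\frac{1}{A(t)}\left[\frac{U(tx)}{U(t)}-x^\gamma\right]=x^\gamma\frac{x^\rho-1}{\rho}$ (read as $x^\gamma\log x$ if $\rho=0$). With $X_{1:n_j,j}\leq\cdots\leq X_{n_j:n_j,j}$ the order statistics of the $j$th subsample, $\widehat{\gamma}_j(k_j)=k_j^{-1}\sum_{i=1}^{k_j}\log(X_{n_j-i+1:n_j,j}/X_{n_j-k_j:n_j,j})$, $\widehat{\gamma}_n(\boldsymbol{\omega})=\sum_{j=1}^m\omega_j\widehat{\gamma}_j(k_j)$ and $\widehat{q}_n^\star(1-p|\boldsymbol{\omega})=\prod_{j=1}^m\left[\left(\frac{k_j}{n_jp}\right)^{\widehat{\gamma}_j(k_j)}X_{n_j-k_j:n_j,j}\right]^{\omega_j}$. *)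

theory Defs
  imports "HOL-Probability.Probability"
begin

definition quantile :: "(real \<Rightarrow> real) \<Rightarrow> real \<Rightarrow> real" where
  "quantile F u = Inf {x. u \<le> F x}"

text \<open>The quotient is taken in the extended reals, so that it is infinite where \<open>F x = 1\<close>.
  For \<open>t \<le> 1\<close> the set is the whole real line and the value is a junk real number.\<close>

definition tail_quantile :: "(real \<Rightarrow> real) \<Rightarrow> real \<Rightarrow> real" where
  "tail_quantile F t = Inf {x. ereal t \<le> 1 / ereal (1 - F x)}"

text \<open>Only the behaviour of \<open>A\<close> at infinity matters, so its constant sign is required for all
  large arguments only; in particular the division by \<open>A t\<close> is then meaningful.\<close>

definition second_order_condition ::
    "(real \<Rightarrow> real) \<Rightarrow> real \<Rightarrow> real \<Rightarrow> (real \<Rightarrow> real) \<Rightarrow> bool" where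
  "second_order_condition F \<gamma> \<rho> A \<longleftrightarrow>
     0 < \<gamma> \<and> \<rho> \<le> 0 \<and>
     ((\<forall>\<^sub>F t in at_top. 0 < A t) \<or> (\<forall>\<^sub>F t in at_top. A t < 0)) \<and>
     (A \<longlongrightarrow> 0) at_top \<and>
     (\<forall>x>0. ((\<lambda>t. 1 / A t * (tail_quantile F (t * x) / tail_quantile F t - x powr \<gamma>)) \<longlongrightarrow>
        x powr \<gamma> * (if \<rho> = 0 then ln x else (x powr \<rho> - 1) / \<rho>)) at_top)"

text \<open>The \<open>i\<close>-th smallest of the sample \<open>x 1, \<dots>, x n\<close>, for \<open>1 \<le> i \<le> n\<close>.\<close>

definition order_stat :: "nat \<Rightarrow> nat \<Rightarrow> (nat \<Rightarrow> real) \<Rightarrow> real" where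
  "order_stat i n x = sort (map x [1..<Suc n]) ! (i - 1)"

definition hill :: "nat \<Rightarrow> nat \<Rightarrow> (nat \<Rightarrow> real) \<Rightarrow> real" where
  "hill k n x = (\<Sum>i=1..k. ln (order_stat (n - i + 1) n x / order_stat (n - k) n x)) / real k"

text \<open>In the pooled estimators, \<open>k j\<close> and \<open>n j\<close> are the effective and actual sizes of the
  \<open>j\<close>-th subsample, and \<open>x i j\<close> is the \<open>i\<close>-th observation in it.\<close>

definition pooled_hill ::
    "nat \<Rightarrow> (nat \<Rightarrow> real) \<Rightarrow> (nat \<Rightarrow> nat) \<Rightarrow> (nat \<Rightarrow> nat) \<Rightarrow> (nat \<Rightarrow> nat \<Rightarrow> real) \<Rightarrow> real" where
  "pooled_hill m \<omega> k n x = (\<Sum>j=1..m. \<omega> j * hill (k j) (n j) (\<lambda>i. x i j))"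

text \<open>Geometrically pooled Weissman estimator of the quantile at level \<open>1 - p\<close>.\<close>

definition pooled_weissman ::
    "nat \<Rightarrow> (nat \<Rightarrow> real) \<Rightarrow> (nat \<Rightarrow> nat) \<Rightarrow> (nat \<Rightarrow> nat) \<Rightarrow> real \<Rightarrow> (nat \<Rightarrow> nat \<Rightarrow> real) \<Rightarrow> real" where
  "pooled_weissman m \<omega> k n p x =
     (\<Prod>j=1..m. ((real (k j) / (real (n j) * p)) powr hill (k j) (n j) (\<lambda>i. x i j)
                 * order_stat (n j - k j) (n j) (\<lambda>i. x i j)) powr \<omega> j)"

end

theory Submission
  imports Defs "HOL-Real_Asymp.Real_Asymp"
begin

text \<open>If \<open>E\<close> denotes \<open>- ln (1 - F X)\<close>, then the \<open>E\<close>'s are i.i.d. standard exponential and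
  \<open>ln X = \<gamma> E + \<psi> E\<close> almost surely, where \<open>\<psi> s = ln (U (exp s)) - \<gamma> s\<close>. By the second-order
  condition, \<open>(\<psi> (s + y) - \<psi> s) / a s\<close> tends to \<open>(exp (\<rho> y) - 1) / \<rho>\<close> with \<open>a s\<close> asymptotic to
  \<open>A (exp s)\<close>; a uniform convergence theorem and Potter-type bounds follow from a Lebesgue measure
  argument. By memorylessness, symmetric sums over the \<open>k\<close> largest excesses of an exponential
  sample over its \<open>(k + 1)\<close>-th largest value have the law of the same sums over \<open>k\<close> i.i.d. exponentials.
  Hence the weights \<open>k\<^sub>j / k\<close> make the leading term of the pooled Hill estimator exactly a mean of \<open>k\<close>
  i.i.d. exponentials, to which the central limit theorem applies, while everything else
  converges in probability. The Weissman estimator is treated by a linearisation of its logarithm.\<close>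

section \<open>Extended regular variation\<close>

text \<open>Two obstacles shape the proof. Subsamples beyond \<open>l\<close> may keep a bounded
  \<open>K j\<close>, so no separate limit law is available for them; hence a single central limit
  theorem for the pooled excess sum, valid for every split of \<open>k\<close>, and mere boundedness
  in probability for their other terms, whose factor \<open>sqrt (share j n)\<close> tends to 0.
  Moreover \<open>\<psi>\<close> is expanded at a random threshold and over random excesses, so
  pointwise limits do not suffice: locally uniform limits serve the threshold, and an error of size
  \<open>exp (y / 3)\<close> serves the average. The exponents 1/4 < 1/3 < 1/2 recur:
  \<open>exp (y / 4)\<close> bounds the growth of \<open>\<psi>\<close>, the gap up to 1/3 makes the
  error small, and below 1/2 the error is square integrable for the exponential law, so that
  Chebyshev's inequality applies. Characteristic functions of symmetric sums replace joint laws of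
  order statistics. The limit \<open>lam\<close> is built from the first subsample, and it then
  determines every \<open>\<Lambda> j\<close>. For the quantile, \<open>\<rho> < 0\<close> lets
  \<open>\<psi>\<close> vary beyond \<open>s\<close> by at most a multiple of \<open>a s\<close>, so
  the distance of extrapolation does no harm.\<close>

definition box_cox :: "real \<Rightarrow> real \<Rightarrow> real" where
  "box_cox \<rho> y = (if \<rho> = 0 then y else (exp (\<rho> * y) - 1) / \<rho>)"

lemma box_cox_measurable [measurable]: "box_cox \<rho> \<in> borel_measurable borel"
  unfolding box_cox_def by measurable

text \<open>\<open>box_cox \<rho> y\<close> is the integral of \<open>exp (\<rho> * u)\<close> for
  \<open>u\<close> from 0 to \<open>y\<close>; the identity splits the interval at \<open>x\<close>.
  It is the functional equation that consecutive increments of \<open>\<psi>\<close> satisfy in the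
  limit.\<close>

lemma box_cox_add: "box_cox \<rho> (x + y) = box_cox \<rho> x + exp (\<rho> * x) * box_cox \<rho> y"
  by (auto simp: box_cox_def field_simps exp_add)

lemma box_cox_nonneg:
  assumes "\<rho> \<le> 0" "0 \<le> y" shows "0 \<le> box_cox \<rho> y"
  using assms by (auto simp: box_cox_def divide_simps mult_nonpos_nonneg)

lemma box_cox_le:
  assumes "\<rho> \<le> 0" "0 \<le> y" shows "box_cox \<rho> y \<le> y"
proof (cases "\<rho> = 0")
  case False
  have "1 + \<rho> * y \<le> exp (\<rho> * y)" by (rule exp_ge_add_one_self)
  hence "\<rho> * y \<le> exp (\<rho> * y) - 1" by linarith
  with False assms show ?thesis by (auto simp: box_cox_def divide_simps mult.commute)
qed (auto simp: box_cox_def)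

lemma box_cox_1_pos: "0 < box_cox \<rho> 1"
  by (cases "\<rho> > 0") (auto simp: box_cox_def divide_simps)

lemma norm_exp_mult_le:
  assumes "\<bar>y\<bar> \<le> Y" shows "norm (exp (r * y :: real)) \<le> exp (\<bar>r\<bar> * Y)"
proof -
  have "r * y \<le> \<bar>r\<bar> * \<bar>y\<bar>" by (simp add: abs_mult[symmetric])
  also have "\<dots> \<le> \<bar>r\<bar> * Y" using assms by (intro mult_left_mono) auto
  finally show ?thesis by simp
qed

text \<open>The measure-theoretic core of the uniform convergence theorem: a limit that is only known
  pointwise can be used along moving points \<open>y n\<close>, at the price of a bounded shift \<open>w n\<close> that works
  for two sequences of functions at once.\<close>

lemma small_shift_point:
  fixes u v :: "nat \<Rightarrow> real \<Rightarrow> real" and y :: "nat \<Rightarrow> real"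
  assumes mu [measurable]: "\<And>n. u n \<in> borel_measurable borel"
    and mv [measurable]: "\<And>n. v n \<in> borel_measurable borel"
    and u: "\<And>x. (\<lambda>n. u n x) \<longlonglongrightarrow> 0" and v: "\<And>x. (\<lambda>n. v n x) \<longlonglongrightarrow> 0"
    and y: "\<And>n. \<bar>y n\<bar> \<le> Y"
  obtains w where "\<And>n. 0 \<le> w n" "\<And>n. w n \<le> 1"
    "(\<lambda>n. u n (y n + w n)) \<longlonglongrightarrow> 0" "(\<lambda>n. v n (w n)) \<longlonglongrightarrow> 0"
proof -
  \<comment> \<open>Truncation at 1 provides an integrable majorant for dominated convergence, while
    \<open>B (g n)\<close> tending to 0 still forces \<open>g n\<close> to tend to 0.\<close>
  define B where "B r = min \<bar>r\<bar> 1" for r :: real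
  have B_meas [measurable]: "B \<in> borel_measurable borel" unfolding B_def by measurable
  have B01: "0 \<le> B r" "B r \<le> 1" for r by (auto simp: B_def)
  define I1 where "I1 n = (\<integral>x. indicator {-Y..Y+1} x * B (u n x) \<partial>lborel)" for n
  define I2 where "I2 n = (\<integral>x. indicator {0..1} x * B (v n x) \<partial>lborel)" for n
  have Bto: "(\<lambda>n. B (g n)) \<longlonglongrightarrow> 0" if "g \<longlonglongrightarrow> 0" for g :: "nat \<Rightarrow> real"
  proof -
    have "(\<lambda>n. min \<bar>g n\<bar> 1) \<longlonglongrightarrow> min \<bar>0\<bar> 1"
      by (intro tendsto_intros that)
    thus ?thesis by (simp add: B_def)
  qed
  have I1: "I1 \<longlonglongrightarrow> 0"
  proof -
    have "I1 \<longlonglongrightarrow> (\<integral>x. 0 \<partial>(lborel :: real measure))" unfolding I1_def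
    proof (rule integral_dominated_convergence[where w = "indicator {-Y..Y+1}"])
      show "AE x in lborel. (\<lambda>n. indicator {-Y..Y+1} x * B (u n x)) \<longlonglongrightarrow> 0"
        by (intro AE_I2 tendsto_mult_right_zero Bto u)
      show "integrable lborel (indicator {-Y..Y+1} :: real \<Rightarrow> real)"
        by (rule integrable_real_indicator) (auto simp: emeasure_lborel_Icc_eq)
    qed (use B01 in \<open>auto simp: indicator_def\<close>)
    thus ?thesis by simp
  qed
  have I2: "I2 \<longlonglongrightarrow> 0"
  proof -
    have "I2 \<longlonglongrightarrow> (\<integral>x. 0 \<partial>(lborel :: real measure))" unfolding I2_def
    proof (rule integral_dominated_convergence[where w = "indicator {0..1}"])
      show "AE x in lborel. (\<lambda>n. indicator {0..1} x * B (v n x)) \<longlonglongrightarrow> 0"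
        by (intro AE_I2 tendsto_mult_right_zero Bto v)
      show "integrable lborel (indicator {0..1} :: real \<Rightarrow> real)"
        by (rule integrable_real_indicator) (auto simp: emeasure_lborel_Icc_eq)
    qed (use B01 in \<open>auto simp: indicator_def\<close>)
    thus ?thesis by simp
  qed
  have int_B: "integrable lborel (\<lambda>x. indicator {a..b} x * B (g x))"
    if [measurable]: "g \<in> borel_measurable borel" for g :: "real \<Rightarrow> real" and a b :: real
    by (rule Bochner_Integration.integrable_bound[of _ "indicator {a..b} :: real \<Rightarrow> real"])
       (use B01 in \<open>auto simp: indicator_def intro!: integrable_real_indicator simp: emeasure_lborel_Icc_eq\<close>)
  \<comment> \<open>Averaging over \<open>w\<close> in \<open>{0..1}\<close>: if both truncated
    errors together exceeded the bound at every \<open>w\<close>, so would their integral. The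
    translate of the first integral runs over \<open>{y n..y n + 1}\<close>, inside
    \<open>{-Y..Y+1}\<close>, and is therefore at most \<open>I1 n\<close>. The term
    \<open>1 / Suc n\<close> makes the contradiction strict.\<close>
  have "\<exists>w. 0 \<le> w \<and> w \<le> 1 \<and> B (u n (y n + w)) + B (v n w) \<le> I1 n + I2 n + 1 / Suc n" for n
  proof (rule ccontr)
    assume neg: "\<not> ?thesis"
    have "I1 n + I2 n + 1 / Suc n = (\<integral>w. (I1 n + I2 n + 1 / Suc n) * indicator {0..1} w \<partial>(lborel :: real measure))"
      by simp
    also have "\<dots> \<le> (\<integral>w. indicator {0..1} w * B (u n (y n + w)) + indicator {0..1} w * B (v n w) \<partial>lborel)"
    proof (rule integral_mono)
      show "integrable lborel (\<lambda>w. indicator {0..1} w * B (u n (y n + w)) + indicator {0..1} w * B (v n w))"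
        by (intro Bochner_Integration.integrable_add int_B) auto
      show "(I1 n + I2 n + 1 / Suc n) * indicator {0..1} w
          \<le> indicator {0..1} w * B (u n (y n + w)) + indicator {0..1} w * B (v n w)" for w
        using neg by (cases "w \<in> {0..1}") (auto simp: not_le dest!: spec[of _ w])
    qed simp
    also have "\<dots> = (\<integral>w. indicator {0..1} w * B (u n (y n + w)) \<partial>lborel) + I2 n"
      unfolding I2_def by (intro Bochner_Integration.integral_add int_B) auto
    also have "(\<integral>w. indicator {0..1} w * B (u n (y n + w)) \<partial>lborel)
        = (\<integral>x. indicator {y n..y n + 1} x * B (u n x) \<partial>lborel)"
      by (subst lborel_integral_real_affine[where c = 1 and t = "y n"])
         (auto intro!: Bochner_Integration.integral_cong simp: indicator_def)
    also have "\<dots> \<le> I1 n" unfolding I1_def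
    proof (intro integral_mono int_B mult_right_mono)
      fix x show "indicator {y n..y n + 1} x \<le> (indicator {-Y..Y+1} x :: real)"
        using y[of n] by (auto simp: indicator_def)
    qed (use B01 in auto)
    finally show False by (simp add: field_simps)
  qed
  then obtain w where w: "\<And>n. 0 \<le> w n \<and> w n \<le> 1"
    "\<And>n. B (u n (y n + w n)) + B (v n (w n)) \<le> I1 n + I2 n + 1 / Suc n"
    by metis
  have "(\<lambda>n. I1 n + I2 n + 1 / Suc n) \<longlonglongrightarrow> 0 + 0 + 0"
    by (intro tendsto_add I1 I2) (use LIMSEQ_inverse_real_of_nat in \<open>simp add: inverse_eq_divide\<close>)
  hence lim: "(\<lambda>n. I1 n + I2 n + 1 / Suc n) \<longlonglongrightarrow> 0" by simp
  \<comment> \<open>Once the bound is below 1 the truncation is inactive, and it bounds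
    \<open>\<bar>g n\<bar>\<close> itself.\<close>
  have B_inv: "g \<longlonglongrightarrow> 0" if le: "\<And>n. B (g n) \<le> I1 n + I2 n + 1 / Suc n" for g
  proof (rule Lim_null_comparison[OF _ lim])
    have "eventually (\<lambda>n. I1 n + I2 n + 1 / Suc n < 1) sequentially"
      using lim by (rule order_tendstoD) simp
    thus "\<forall>\<^sub>F n in sequentially. norm (g n) \<le> I1 n + I2 n + 1 / Suc n"
      by eventually_elim (use le in \<open>smt (verit, best) B_def real_norm_def\<close>)
  qed
  show thesis
  proof
    show "0 \<le> w n" "w n \<le> 1" for n using w(1) by auto
    show "(\<lambda>n. u n (y n + w n)) \<longlonglongrightarrow> 0" "(\<lambda>n. v n (w n)) \<longlonglongrightarrow> 0"
      by (rule B_inv; smt (verit) w(2) B01)+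
  qed
qed

text \<open>If uniformity failed, a bad pair \<open>s n\<close>, \<open>y n\<close> with
  \<open>s n \<ge> n\<close> could be chosen for every \<open>n\<close>, against convergence along
  moving points.\<close>

lemma eventually_uniform_at_top:
  fixes g :: "real \<Rightarrow> real \<Rightarrow> real"
  assumes seq: "\<And>s y. filterlim s at_top sequentially \<Longrightarrow> (\<And>n. \<bar>y n\<bar> \<le> Y) \<Longrightarrow> (\<lambda>n. g (s n) (y n)) \<longlonglongrightarrow> 0"
    and \<epsilon>: "0 < \<epsilon>"
  shows "eventually (\<lambda>s. \<forall>y. \<bar>y\<bar> \<le> Y \<longrightarrow> \<bar>g s y\<bar> < \<epsilon>) at_top"
proof (rule ccontr)
  assume "\<not> ?thesis"
  hence "\<forall>n. \<exists>s\<ge>real n. \<exists>y. \<bar>y\<bar> \<le> Y \<and> \<not> \<bar>g s y\<bar> < \<epsilon>"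
    unfolding eventually_at_top_linorder by blast
  then obtain s y where sy: "\<And>n. s n \<ge> real n" "\<And>n. \<bar>y n\<bar> \<le> Y" "\<And>n. \<not> \<bar>g (s n) (y n)\<bar> < \<epsilon>"
    by metis
  have "filterlim s at_top sequentially"
    by (rule filterlim_at_top_mono[OF filterlim_real_sequentially]) (use sy in auto)
  hence "(\<lambda>n. g (s n) (y n)) \<longlonglongrightarrow> 0" using sy(2) by (rule seq)
  from tendstoD[OF this \<epsilon>] sy(3) show False
    by (auto simp: dist_norm)
qed

text \<open>This is de Haan's class in additive notation: arguments are logarithms, so
  multiplication by \<open>exp y\<close> has become a shift by \<open>y\<close>. Measurability of
  \<open>\<psi>\<close> and \<open>a\<close> is what the Lebesgue argument for uniformity rests
  on.\<close>

locale extended_regular_variation =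
  fixes \<psi> a :: "real \<Rightarrow> real" and \<rho> :: real
  assumes \<psi>_measurable [measurable]: "\<psi> \<in> borel_measurable borel"
    and a_measurable [measurable]: "a \<in> borel_measurable borel"
    and \<rho>_nonpos: "\<rho> \<le> 0"
    and a_nonzero: "eventually (\<lambda>s. a s \<noteq> 0) at_top"
    and increment: "\<And>y. ((\<lambda>s. (\<psi> (s + y) - \<psi> s) / a s) \<longlongrightarrow> box_cox \<rho> y) at_top"
begin

lemma a_nonzero': "filterlim f at_top G \<Longrightarrow> eventually (\<lambda>x. a (f x) \<noteq> 0) G"
  using a_nonzero by (rule eventually_compose_filterlim)

lemma filterlim_shift: "filterlim f at_top G \<Longrightarrow> filterlim (\<lambda>x. f x + y) at_top G" for y :: real
  by (subst add.commute) (rule filterlim_tendsto_add_at_top[OF tendsto_const])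

text \<open>The increment of \<open>\<psi>\<close> from \<open>s + y\<close> to
  \<open>s + y + 1\<close> is normalised once by \<open>a s\<close> and once by
  \<open>a (s + y)\<close>; the quotient of the two is the ratio sought. The limits are
  \<open>box_cox \<rho> (y + 1) - box_cox \<rho> y\<close> and \<open>box_cox \<rho> 1\<close>,
  whose quotient is \<open>exp (\<rho> * y)\<close> by the additivity formula.\<close>

lemma a_ratio: "((\<lambda>s. a (s + y) / a s) \<longlongrightarrow> exp (\<rho> * y)) at_top"
proof -
  have sh: "filterlim (\<lambda>s. s + y) at_top at_top"
    by (rule filterlim_shift) (rule filterlim_ident)
  have 1: "((\<lambda>s. (\<psi> (s + y + 1) - \<psi> (s + y)) / a (s + y)) \<longlongrightarrow> box_cox \<rho> 1) at_top"
    using filterlim_compose[OF increment[of 1] sh] .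
  have "((\<lambda>s. ((\<psi> (s + (y + 1)) - \<psi> s) / a s - (\<psi> (s + y) - \<psi> s) / a s) /
      ((\<psi> (s + y + 1) - \<psi> (s + y)) / a (s + y))) \<longlongrightarrow> (box_cox \<rho> (y + 1) - box_cox \<rho> y) / box_cox \<rho> 1) at_top"
    by (intro tendsto_divide tendsto_diff increment 1) (use box_cox_1_pos[of \<rho>] in auto)
  also have "(box_cox \<rho> (y + 1) - box_cox \<rho> y) / box_cox \<rho> 1 = exp (\<rho> * y)"
    using box_cox_1_pos[of \<rho>] by (simp add: box_cox_add)
  finally show ?thesis
  proof (rule Lim_transform_eventually)
    have "eventually (\<lambda>s. 0 < (\<psi> (s + y + 1) - \<psi> (s + y)) / a (s + y)) at_top"
      using 1 box_cox_1_pos by (rule order_tendstoD)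
    with a_nonzero show "\<forall>\<^sub>F s in at_top. ((\<psi> (s + (y + 1)) - \<psi> s) / a s - (\<psi> (s + y) - \<psi> s) / a s) /
        ((\<psi> (s + y + 1) - \<psi> (s + y)) / a (s + y)) = a (s + y) / a s"
    proof eventually_elim
      case (elim s)
      have "\<psi> (s + (y + 1)) = \<psi> (s + y + 1)" by (simp add: add.assoc)
      with elim show ?case
        by (cases "\<psi> (s + y + 1) = \<psi> (s + y)") (auto simp: field_simps)
    qed
  qed
qed

text \<open>The value of \<open>a\<close> at \<open>s n + y n + w n\<close> is compared both with
  \<open>a (s n)\<close> and with \<open>a (s n + y n)\<close>. Dividing the two ratios eliminates
  the auxiliary point, and \<open>w n\<close> is chosen so that both comparisons are accurate at
  once.\<close>

lemma a_ratio_seq: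
  assumes s: "filterlim s at_top sequentially" and y: "\<And>n. \<bar>y n\<bar> \<le> Y"
  shows "(\<lambda>n. a (s n + y n) / a (s n) - exp (\<rho> * y n)) \<longlonglongrightarrow> 0"
proof -
  define u where "u n x = a (s n + x) / a (s n) - exp (\<rho> * x)" for n x
  define v where "v n x = a (s n + y n + x) / a (s n + y n) - exp (\<rho> * x)" for n x
  have sy: "filterlim (\<lambda>n. s n + y n) at_top sequentially"
  proof (rule filterlim_at_top_mono[OF filterlim_shift[OF s, of "-Y"]])
    show "\<forall>\<^sub>F n in sequentially. s n + - Y \<le> s n + y n"
      using y by (intro always_eventually allI) (smt (verit))
  qed
  have "(\<lambda>n. u n x) \<longlonglongrightarrow> 0" for x
    unfolding u_def using filterlim_compose[OF a_ratio[of x] s] by (rule LIM_zero)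
  moreover have "(\<lambda>n. v n x) \<longlonglongrightarrow> 0" for x
    unfolding v_def using filterlim_compose[OF a_ratio[of x] sy] by (rule LIM_zero)
  moreover have "u n \<in> borel_measurable borel" "v n \<in> borel_measurable borel" for n
    unfolding u_def v_def by measurable
  ultimately obtain w where w: "\<And>n. 0 \<le> w n" "\<And>n. w n \<le> 1"
    "(\<lambda>n. u n (y n + w n)) \<longlonglongrightarrow> 0" "(\<lambda>n. v n (w n)) \<longlonglongrightarrow> 0"
    using small_shift_point[of u v y Y] y by blast
  have bnd: "\<forall>\<^sub>F n in sequentially. norm (exp (\<rho> * y n)) \<le> exp (\<bar>\<rho>\<bar> * Y)"
    by (intro always_eventually allI norm_exp_mult_le y)
  have num: "(\<lambda>n. u n (y n + w n) - v n (w n) * exp (\<rho> * y n)) \<longlonglongrightarrow> 0"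
    using tendsto_diff[OF w(3) lim_null_mult_right_bounded[OF w(4) bnd]] by simp
  \<comment> \<open>Since \<open>w n\<close> lies in \<open>{0..1}\<close> and
    \<open>\<rho> \<le> 0\<close>, \<open>exp (\<rho> * w n)\<close> is at least
    \<open>exp \<rho> = 2 * c\<close>; an error below \<open>c\<close> keeps the denominator above
    \<open>c\<close>.\<close>
  define c where "c = exp \<rho> / 2"
  have c: "c > 0" by (simp add: c_def)
  have ew: "exp \<rho> \<le> exp (\<rho> * w n)" for n
    using mult_left_mono_neg[OF w(2)[of n] \<rho>_nonpos] by simp
  have ev: "\<forall>\<^sub>F n in sequentially. \<bar>v n (w n)\<bar> < c"
    using tendstoD[OF w(4) c] by (simp add: dist_norm)
  show ?thesis
  proof (rule Lim_null_comparison)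
    show "\<forall>\<^sub>F n in sequentially. norm (a (s n + y n) / a (s n) - exp (\<rho> * y n))
        \<le> \<bar>u n (y n + w n) - v n (w n) * exp (\<rho> * y n)\<bar> / c"
      using ev a_nonzero'[OF s] a_nonzero'[OF sy]
    proof eventually_elim
      case (elim n)
      define q where "q = a (s n + y n + w n)"
      have den: "exp (\<rho> * w n) + v n (w n) \<ge> c"
        using elim(1) ew[of n] unfolding c_def by linarith
      have qv: "exp (\<rho> * w n) + v n (w n) = q / a (s n + y n)" by (simp add: v_def q_def)
      have qu: "exp (\<rho> * (y n + w n)) + u n (y n + w n) = q / a (s n)"
        by (simp add: u_def q_def add.assoc)
      have "q \<noteq> 0" using den qv c by auto
      hence "a (s n + y n) / a (s n) = (exp (\<rho> * (y n + w n)) + u n (y n + w n)) / (exp (\<rho> * w n) + v n (w n))"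
        unfolding qu qv using elim by (simp add: field_simps)
      also have "\<dots> - exp (\<rho> * y n) = (u n (y n + w n) - v n (w n) * exp (\<rho> * y n)) / (exp (\<rho> * w n) + v n (w n))"
        using den c by (simp add: field_simps exp_add[symmetric] distrib_left)
      also have "norm \<dots> \<le> \<bar>u n (y n + w n) - v n (w n) * exp (\<rho> * y n)\<bar> / c"
        using den c by (simp add: abs_divide frac_le)
      finally show ?case by simp
    qed
    show "(\<lambda>n. \<bar>u n (y n + w n) - v n (w n) * exp (\<rho> * y n)\<bar> / c) \<longlonglongrightarrow> 0"
      using tendsto_divide_zero[OF tendsto_rabs_zero[OF num]] .
  qed
qed

text \<open>The increment over \<open>y n\<close> is the increment over \<open>y n + w n\<close>
  minus the one over the last stretch \<open>w n\<close>. The latter is known relative to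
  \<open>a (s n + y n)\<close>, and \<open>R n\<close> converts it to the scale
  \<open>a (s n)\<close>.\<close>

lemma \<psi>_increment_seq:
  assumes s: "filterlim s at_top sequentially" and y: "\<And>n. \<bar>y n\<bar> \<le> Y"
  shows "(\<lambda>n. (\<psi> (s n + y n) - \<psi> (s n)) / a (s n) - box_cox \<rho> (y n)) \<longlonglongrightarrow> 0"
proof -
  define u where "u n x = (\<psi> (s n + x) - \<psi> (s n)) / a (s n) - box_cox \<rho> x" for n x
  define v where "v n x = (\<psi> (s n + y n + x) - \<psi> (s n + y n)) / a (s n + y n) - box_cox \<rho> x" for n x
  have sy: "filterlim (\<lambda>n. s n + y n) at_top sequentially"
  proof (rule filterlim_at_top_mono[OF filterlim_shift[OF s, of "-Y"]])
    show "\<forall>\<^sub>F n in sequentially. s n + - Y \<le> s n + y n"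
      using y by (intro always_eventually allI) (smt (verit))
  qed
  have "(\<lambda>n. u n x) \<longlonglongrightarrow> 0" for x
    unfolding u_def using filterlim_compose[OF increment[of x] s] by (rule LIM_zero)
  moreover have "(\<lambda>n. v n x) \<longlonglongrightarrow> 0" for x
    unfolding v_def using filterlim_compose[OF increment[of x] sy] by (rule LIM_zero)
  moreover have "u n \<in> borel_measurable borel" "v n \<in> borel_measurable borel" for n
    unfolding u_def v_def by measurable
  ultimately obtain w where w: "\<And>n. 0 \<le> w n" "\<And>n. w n \<le> 1"
    "(\<lambda>n. u n (y n + w n)) \<longlonglongrightarrow> 0" "(\<lambda>n. v n (w n)) \<longlonglongrightarrow> 0"
    using small_shift_point[of u v y Y] y by blast
  define R where "R n = a (s n + y n) / a (s n)" for n
  have R: "(\<lambda>n. R n - exp (\<rho> * y n)) \<longlonglongrightarrow> 0"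
    unfolding R_def by (rule a_ratio_seq[OF s y])
  have bR: "\<forall>\<^sub>F n in sequentially. norm (R n) \<le> 1 + exp (\<bar>\<rho>\<bar> * Y)"
    using tendstoD[OF R zero_less_one]
  proof eventually_elim
    case (elim n)
    with norm_exp_mult_le[OF y, of \<rho> n] show ?case unfolding dist_norm real_norm_def by linarith
  qed
  have bw: "\<forall>\<^sub>F n in sequentially. norm (box_cox \<rho> (w n)) \<le> 1"
    using w(1,2) box_cox_nonneg[OF \<rho>_nonpos] box_cox_le[OF \<rho>_nonpos]
    by (intro always_eventually allI) (smt (verit) real_norm_def)
  have "(\<lambda>n. u n (y n + w n) - v n (w n) * R n - (R n - exp (\<rho> * y n)) * box_cox \<rho> (w n)) \<longlonglongrightarrow> 0 - 0 - 0"
    by (intro tendsto_diff w lim_null_mult_right_bounded[OF w(4) bR] lim_null_mult_right_bounded[OF R bw])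
  hence "(\<lambda>n. u n (y n + w n) - v n (w n) * R n - (R n - exp (\<rho> * y n)) * box_cox \<rho> (w n)) \<longlonglongrightarrow> 0"
    by simp
  thus ?thesis
  proof (rule Lim_transform_eventually)
    show "\<forall>\<^sub>F n in sequentially. u n (y n + w n) - v n (w n) * R n - (R n - exp (\<rho> * y n)) * box_cox \<rho> (w n)
        = (\<psi> (s n + y n) - \<psi> (s n)) / a (s n) - box_cox \<rho> (y n)"
      using a_nonzero'[OF s] a_nonzero'[OF sy]
    proof eventually_elim
      case (elim n)
      have "v n (w n) * R n + R n * box_cox \<rho> (w n) = (v n (w n) + box_cox \<rho> (w n)) * R n"
        by (simp add: algebra_simps)
      also have "\<dots> = (\<psi> (s n + y n + w n) - \<psi> (s n + y n)) / a (s n)"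
        using elim by (simp add: v_def R_def)
      finally show ?case
        unfolding u_def box_cox_add[of \<rho> "y n" "w n"]
        by (simp add: algebra_simps diff_divide_distrib add_divide_distrib)
    qed
  qed
qed

section \<open>Locally uniform limits and Potter-type bounds\<close>

lemma a_ratio_uniform:
  assumes "0 < \<epsilon>"
  shows "eventually (\<lambda>s. \<forall>y. \<bar>y\<bar> \<le> Y \<longrightarrow> \<bar>a (s + y) / a s - exp (\<rho> * y)\<bar> < \<epsilon>) at_top"
  by (rule eventually_uniform_at_top[OF a_ratio_seq assms])

lemma \<psi>_increment_uniform:
  assumes "0 < \<epsilon>"
  shows "eventually (\<lambda>s. \<forall>y. \<bar>y\<bar> \<le> Y \<longrightarrow> \<bar>(\<psi> (s + y) - \<psi> s) / a s - box_cox \<rho> y\<bar> < \<epsilon>) at_top"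
  by (rule eventually_uniform_at_top[OF \<psi>_increment_seq assms])

text \<open>The filter is arbitrary so that the base point and the shift may be random, with
  convergence in probability, as well as deterministic sequences.\<close>

lemma a_ratio_tendsto:
  assumes s: "filterlim s at_top G" and y: "(y \<longlongrightarrow> y0) G"
  shows "((\<lambda>x. a (s x + y x) / a (s x)) \<longlongrightarrow> exp (\<rho> * y0)) G"
proof -
  have "((\<lambda>x. a (s x + y x) / a (s x) - exp (\<rho> * y x)) \<longlongrightarrow> 0) G"
  proof (rule tendstoI)
    fix e :: real assume e: "0 < e"
    have "eventually (\<lambda>x. \<forall>y. \<bar>y\<bar> \<le> \<bar>y0\<bar> + 1 \<longrightarrow> \<bar>a (s x + y) / a (s x) - exp (\<rho> * y)\<bar> < e) G"
      using a_ratio_uniform[OF e] s by (rule eventually_compose_filterlim)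
    moreover have "eventually (\<lambda>x. dist (y x) y0 < 1) G"
      using y by (rule tendstoD) simp
    ultimately show "eventually (\<lambda>x. dist (a (s x + y x) / a (s x) - exp (\<rho> * y x)) 0 < e) G"
      by eventually_elim (auto simp: dist_norm)
  qed
  moreover have "((\<lambda>x. exp (\<rho> * y x)) \<longlongrightarrow> exp (\<rho> * y0)) G"
    by (intro tendsto_intros y)
  ultimately have "((\<lambda>x. (a (s x + y x) / a (s x) - exp (\<rho> * y x)) + exp (\<rho> * y x)) \<longlongrightarrow> 0 + exp (\<rho> * y0)) G"
    by (rule tendsto_add)
  thus ?thesis by simp
qed

lemma unit_step:
  assumes "exp \<rho> < r"
  shows "eventually (\<lambda>s. a s \<noteq> 0 \<and> \<bar>a (s + 1)\<bar> \<le> r * \<bar>a s\<bar> \<and>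
    (\<forall>y. 0 \<le> y \<and> y \<le> 1 \<longrightarrow> \<bar>a (s + y)\<bar> \<le> 2 * \<bar>a s\<bar> \<and> \<bar>a s\<bar> \<le> 2 * exp (-\<rho>) * \<bar>a (s + y)\<bar> \<and>
      \<bar>\<psi> (s + y) - \<psi> s\<bar> \<le> 2 * \<bar>a s\<bar>)) at_top"
proof -
  \<comment> \<open>The first entry brings the ratio over a full unit down to \<open>r\<close>. The
    second keeps every ratio within the unit above \<open>exp \<rho> / 2\<close>, whence the
    constant \<open>2 * exp (-\<rho>)\<close>; it also keeps them below \<open>1 + 1/2\<close>,
    hence below 2.\<close>
  define \<epsilon> where "\<epsilon> = min (r - exp \<rho>) (exp \<rho> / 2)"
  have \<epsilon>: "0 < \<epsilon>" using assms by (simp add: \<epsilon>_def)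
  show ?thesis
    using a_nonzero a_ratio_uniform[OF \<epsilon>, of 1] \<psi>_increment_uniform[OF zero_less_one, of 1]
  proof eventually_elim
    case (elim s)
    have quot: "\<bar>x\<bar> \<le> c * \<bar>a s\<bar>" if "\<bar>x / a s\<bar> \<le> c" for x c
      using that elim(1) by (simp add: abs_divide divide_simps split: if_splits)
    have "\<bar>a (s + 1) / a s - exp \<rho>\<bar> < \<epsilon>" using elim(2)[rule_format, of 1] by simp
    hence "\<bar>a (s + 1) / a s\<bar> \<le> r" using exp_gt_zero[of \<rho>] unfolding \<epsilon>_def by linarith
    moreover {
      fix y :: real assume y: "0 \<le> y" "y \<le> 1"
      have e: "exp \<rho> \<le> exp (\<rho> * y)" "exp (\<rho> * y) \<le> 1" "exp \<rho> \<le> 1"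
        using mult_left_mono_neg[OF y(2) \<rho>_nonpos] y(1) \<rho>_nonpos by (auto simp: mult_nonpos_nonneg)
      have R: "\<bar>a (s + y) / a s - exp (\<rho> * y)\<bar> < \<epsilon>" using elim(2) y by auto
      hence "\<bar>a (s + y) / a s\<bar> \<le> 2" using e unfolding \<epsilon>_def by linarith
      moreover have "\<bar>a s\<bar> \<le> 2 * exp (-\<rho>) * \<bar>a (s + y)\<bar>"
      proof -
        have "exp \<rho> / 2 \<le> \<bar>a (s + y) / a s\<bar>" using R e unfolding \<epsilon>_def by linarith
        hence "exp \<rho> * \<bar>a s\<bar> \<le> 2 * \<bar>a (s + y)\<bar>" using elim(1) by (simp add: abs_divide field_simps)
        hence "exp (-\<rho>) * (exp \<rho> * \<bar>a s\<bar>) \<le> exp (-\<rho>) * (2 * \<bar>a (s + y)\<bar>)" by (rule mult_left_mono) simp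
        moreover have "exp (-\<rho>) * (exp \<rho> * \<bar>a s\<bar>) = \<bar>a s\<bar>" by (simp add: exp_minus)
        ultimately show ?thesis by linarith
      qed
      moreover have "\<bar>(\<psi> (s + y) - \<psi> s) / a s\<bar> \<le> 2"
        using elim(3)[rule_format, of y] y box_cox_nonneg[OF \<rho>_nonpos y(1)] box_cox_le[OF \<rho>_nonpos y(1)]
        by linarith
      ultimately have "\<bar>a (s + y)\<bar> \<le> 2 * \<bar>a s\<bar> \<and> \<bar>a s\<bar> \<le> 2 * exp (-\<rho>) * \<bar>a (s + y)\<bar> \<and>
        \<bar>\<psi> (s + y) - \<psi> s\<bar> \<le> 2 * \<bar>a s\<bar>" by (blast intro: quot)
    }
    ultimately show ?case using elim(1) quot by blast
  qed
qed

text \<open>The unit step is iterated \<open>nat \<lfloor>y\<rfloor>\<close> times and followed by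
  one fractional step. Increments of \<open>\<psi>\<close> telescope, which yields the geometric
  sum; the free parameter \<open>r > exp \<rho>\<close> decides whether that sum grows slowly or
  stays bounded.\<close>

lemma growth:
  assumes r: "exp \<rho> < r"
  shows "eventually (\<lambda>s. \<forall>y\<ge>0. \<bar>a (s + y)\<bar> \<le> 2 * r ^ nat \<lfloor>y\<rfloor> * \<bar>a s\<bar> \<and>
      \<bar>a s\<bar> \<le> (2 * exp (-\<rho>)) ^ Suc (nat \<lfloor>y\<rfloor>) * \<bar>a (s + y)\<bar> \<and>
      \<bar>\<psi> (s + y) - \<psi> s\<bar> \<le> 2 * \<bar>a s\<bar> * (\<Sum>j\<le>nat \<lfloor>y\<rfloor>. r ^ j)) at_top"
proof -
  define q where "q = 2 * exp (-\<rho>)"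
  have q: "q \<ge> 0" by (simp add: q_def)
  have r0: "r > 0" using r exp_gt_zero[of \<rho>] by linarith
  obtain S where S: "\<And>s. s \<ge> S \<Longrightarrow> \<bar>a (s + 1)\<bar> \<le> r * \<bar>a s\<bar>"
    "\<And>s y. s \<ge> S \<Longrightarrow> 0 \<le> y \<Longrightarrow> y \<le> 1 \<Longrightarrow> \<bar>a (s + y)\<bar> \<le> 2 * \<bar>a s\<bar>"
    "\<And>s y. s \<ge> S \<Longrightarrow> 0 \<le> y \<Longrightarrow> y \<le> 1 \<Longrightarrow> \<bar>a s\<bar> \<le> q * \<bar>a (s + y)\<bar>"
    "\<And>s y. s \<ge> S \<Longrightarrow> 0 \<le> y \<Longrightarrow> y \<le> 1 \<Longrightarrow> \<bar>\<psi> (s + y) - \<psi> s\<bar> \<le> 2 * \<bar>a s\<bar>"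
    using unit_step[OF r] unfolding eventually_at_top_linorder q_def by blast
  have "\<bar>a (s + y)\<bar> \<le> 2 * r ^ nat \<lfloor>y\<rfloor> * \<bar>a s\<bar> \<and> \<bar>a s\<bar> \<le> q ^ Suc (nat \<lfloor>y\<rfloor>) * \<bar>a (s + y)\<bar> \<and>
      \<bar>\<psi> (s + y) - \<psi> s\<bar> \<le> 2 * \<bar>a s\<bar> * (\<Sum>j\<le>nat \<lfloor>y\<rfloor>. r ^ j)"
    if s: "s \<ge> S" and y: "0 \<le> y" for s y
  proof -
    have pow: "\<bar>a (s + real i)\<bar> \<le> r ^ i * \<bar>a s\<bar> \<and> \<bar>a s\<bar> \<le> q ^ i * \<bar>a (s + real i)\<bar> \<and>
        \<bar>\<psi> (s + real i) - \<psi> s\<bar> \<le> 2 * \<bar>a s\<bar> * (\<Sum>j<i. r ^ j)" for i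
    proof (induction i)
      case (Suc i)
      have si: "s + real i \<ge> S" using s by simp
      have eq: "s + real (Suc i) = s + real i + 1" by simp
      have "\<bar>a (s + real (Suc i))\<bar> \<le> r * \<bar>a (s + real i)\<bar>" unfolding eq by (rule S(1)[OF si])
      also have "\<dots> \<le> r * (r ^ i * \<bar>a s\<bar>)" using Suc r0 by (intro mult_left_mono) auto
      finally have 1: "\<bar>a (s + real (Suc i))\<bar> \<le> r ^ Suc i * \<bar>a s\<bar>" by (simp add: mult_ac)
      have "\<bar>a s\<bar> \<le> q ^ i * \<bar>a (s + real i)\<bar>" using Suc by simp
      also have "\<dots> \<le> q ^ i * (q * \<bar>a (s + real (Suc i))\<bar>)"
        unfolding eq using q by (intro mult_left_mono S(3) si) auto
      finally have 2: "\<bar>a s\<bar> \<le> q ^ Suc i * \<bar>a (s + real (Suc i))\<bar>" by (simp add: mult_ac)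
      have "\<bar>\<psi> (s + real (Suc i)) - \<psi> s\<bar> \<le> \<bar>\<psi> (s + real i + 1) - \<psi> (s + real i)\<bar> + \<bar>\<psi> (s + real i) - \<psi> s\<bar>"
        unfolding eq by linarith
      also have "\<dots> \<le> 2 * (r ^ i * \<bar>a s\<bar>) + 2 * \<bar>a s\<bar> * (\<Sum>j<i. r ^ j)"
        using S(4)[OF si, of 1] Suc by linarith
      finally have "\<bar>\<psi> (s + real (Suc i)) - \<psi> s\<bar> \<le> 2 * \<bar>a s\<bar> * (\<Sum>j<Suc i. r ^ j)"
        by (simp add: algebra_simps)
      with 1 2 show ?case by blast
    qed auto
    define i where "i = nat \<lfloor>y\<rfloor>"
    define z where "z = y - real i"
    have z: "0 \<le> z" "z \<le> 1" and yz: "s + y = s + real i + z"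
      using y by (auto simp: z_def i_def) (linarith)?
    have si: "s + real i \<ge> S" using s by simp
    have "\<bar>a (s + y)\<bar> \<le> 2 * \<bar>a (s + real i)\<bar>" unfolding yz by (rule S(2)[OF si z])
    moreover have "\<bar>a s\<bar> \<le> q ^ i * (q * \<bar>a (s + y)\<bar>)"
      using pow[of i] S(3)[OF si z] q unfolding yz
      by (meson mult_left_mono order_trans zero_le_power)
    moreover have "\<bar>\<psi> (s + y) - \<psi> s\<bar> \<le> 2 * (r ^ i * \<bar>a s\<bar>) + 2 * \<bar>a s\<bar> * (\<Sum>j<i. r ^ j)"
      using S(4)[OF si z] pow[of i] unfolding yz by linarith
    ultimately show ?thesis
      using pow[of i] unfolding i_def[symmetric]
      by (auto simp: algebra_simps lessThan_Suc_atMost[symmetric])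
  qed
  thus ?thesis unfolding eventually_at_top_linorder q_def by blast
qed

text \<open>A crude comparison in both directions, made for replacing a deterministic level by a
  random threshold: if the distance of the two is bounded in probability, so is the exponential
  factor.\<close>

lemma two_sided_growth:
  obtains C S where "C \<ge> 0" "\<And>s s'. S \<le> s \<Longrightarrow> S \<le> s' \<Longrightarrow> \<bar>a s'\<bar> \<le> C * exp (C * \<bar>s' - s\<bar>) * \<bar>a s\<bar>"
proof -
  have r: "exp \<rho> < 2" using \<rho>_nonpos by (smt (verit) exp_le_one_iff)
  define q where "q = 2 * exp (-\<rho>)"
  have "exp 0 \<le> exp (-\<rho>)" using \<rho>_nonpos by (intro exp_le_cancel_iff[THEN iffD2]) auto
  hence q: "q \<ge> 2" by (simp add: q_def)
  have pw: "c ^ nat \<lfloor>y\<rfloor> \<le> exp (q * y)" if "0 \<le> c" "c \<le> q" "0 \<le> y" for c y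
  proof -
    have "c \<le> exp q" using that(2) exp_ge_add_one_self[of q] by linarith
    hence "c ^ nat \<lfloor>y\<rfloor> \<le> exp q ^ nat \<lfloor>y\<rfloor>" using that by (intro power_mono)
    also have "\<dots> = exp (real (nat \<lfloor>y\<rfloor>) * q)" by (simp add: exp_of_nat_mult)
    also have "\<dots> \<le> exp (q * y)" using q that(3) by (simp add: mult.commute mult_left_mono)
    finally show ?thesis .
  qed
  from growth[OF r] obtain S where S:
    "\<And>s y. s \<ge> S \<Longrightarrow> 0 \<le> y \<Longrightarrow> \<bar>a (s + y)\<bar> \<le> 2 * 2 ^ nat \<lfloor>y\<rfloor> * \<bar>a s\<bar>"
    "\<And>s y. s \<ge> S \<Longrightarrow> 0 \<le> y \<Longrightarrow> \<bar>a s\<bar> \<le> q ^ Suc (nat \<lfloor>y\<rfloor>) * \<bar>a (s + y)\<bar>"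
    unfolding eventually_at_top_linorder q_def by blast
  show thesis
  proof (rule that)
    show "q \<ge> 0" using q by simp
    fix s s' assume ss: "S \<le> s" "S \<le> s'"
    show "\<bar>a s'\<bar> \<le> q * exp (q * \<bar>s' - s\<bar>) * \<bar>a s\<bar>"
    proof (cases "s \<le> s'")
      case True
      have "\<bar>a s'\<bar> \<le> 2 * 2 ^ nat \<lfloor>s' - s\<rfloor> * \<bar>a s\<bar>" using S(1)[of s "s' - s"] ss True by simp
      also have "\<dots> \<le> q * exp (q * (s' - s)) * \<bar>a s\<bar>"
        using q True by (intro mult_right_mono mult_mono pw) auto
      finally show ?thesis using True by simp
    next
      case False
      have "\<bar>a s'\<bar> \<le> q * q ^ nat \<lfloor>s - s'\<rfloor> * \<bar>a s\<bar>" using S(2)[of s' "s - s'"] ss False by simp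
      also have "\<dots> \<le> q * exp (q * (s - s')) * \<bar>a s\<bar>"
        using q False by (intro mult_right_mono mult_mono pw) auto
      finally show ?thesis using False by simp
    qed
  qed
qed

text \<open>The choice \<open>r = exp (1/4)\<close> exceeds 1 and hence \<open>exp \<rho>\<close>;
  the geometric sum is then of the order of its last term, at most a multiple of
  \<open>exp (y / 4)\<close>.\<close>

lemma \<psi>_growth:
  obtains C where "C \<ge> 0"
    "eventually (\<lambda>s. \<forall>y\<ge>0. \<bar>\<psi> (s + y) - \<psi> s\<bar> \<le> C * \<bar>a s\<bar> * exp (y / 4)) at_top"
proof -
  define r :: real where "r = exp (1/4)"
  have r1: "r > 1" by (simp add: r_def)
  hence r: "exp \<rho> < r" using \<rho>_nonpos by (smt (verit) exp_le_one_iff)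
  define C where "C = 2 * (r / (r - 1))"
  have C: "C \<ge> 0" using r1 by (simp add: C_def)
  have sm: "(\<Sum>j\<le>nat \<lfloor>y\<rfloor>. r ^ j) \<le> r / (r - 1) * exp (y / 4)" if "0 \<le> y" for y
  proof -
    have "(\<Sum>j\<le>nat \<lfloor>y\<rfloor>. r ^ j) = (r ^ Suc (nat \<lfloor>y\<rfloor>) - 1) / (r - 1)"
      using r1 geometric_sum[of r "Suc (nat \<lfloor>y\<rfloor>)"] by (simp only: lessThan_Suc_atMost)
    also have "\<dots> \<le> r / (r - 1) * r ^ nat \<lfloor>y\<rfloor>" using r1 by (simp add: divide_simps)
    also have "r ^ nat \<lfloor>y\<rfloor> = exp (real (nat \<lfloor>y\<rfloor>) * (1/4))" by (simp only: r_def exp_of_nat_mult)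
    also have "r / (r - 1) * \<dots> \<le> r / (r - 1) * exp (y / 4)"
      using r1 that by (intro mult_left_mono) auto
    finally show ?thesis .
  qed
  show thesis
  proof (rule that[OF C])
    show "eventually (\<lambda>s. \<forall>y\<ge>0. \<bar>\<psi> (s + y) - \<psi> s\<bar> \<le> C * \<bar>a s\<bar> * exp (y / 4)) at_top"
      using growth[OF r]
    proof eventually_elim
      case (elim s)
      show ?case
      proof (intro allI impI)
        fix y :: real assume y: "0 \<le> y"
        have "\<bar>\<psi> (s + y) - \<psi> s\<bar> \<le> 2 * \<bar>a s\<bar> * (\<Sum>j\<le>nat \<lfloor>y\<rfloor>. r ^ j)" using elim y by blast
        also have "\<dots> \<le> 2 * \<bar>a s\<bar> * (r / (r - 1) * exp (y / 4))"
          by (intro mult_left_mono sm y) simp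
        finally show "\<bar>\<psi> (s + y) - \<psi> s\<bar> \<le> C * \<bar>a s\<bar> * exp (y / 4)" by (simp add: C_def mult_ac)
      qed
    qed
  qed
qed

text \<open>For \<open>\<rho> < 0\<close> the parameter \<open>r\<close> can be placed halfway
  between \<open>exp \<rho>\<close> and 1, so the geometric series converges and the bounds no
  longer depend on \<open>y\<close>. This is what permits extrapolation to a quantile arbitrarily
  far beyond the threshold.\<close>

lemma bounded_if_\<rho>_neg:
  assumes "\<rho> < 0"
  obtains C where "C \<ge> 0"
    "eventually (\<lambda>s. \<forall>y\<ge>0. \<bar>a (s + y)\<bar> \<le> C * \<bar>a s\<bar> \<and> \<bar>\<psi> (s + y) - \<psi> s\<bar> \<le> C * \<bar>a s\<bar>) at_top"
proof -
  define r :: real where "r = (1 + exp \<rho>) / 2"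
  have r1: "r < 1" and r0: "0 < r" and r: "exp \<rho> < r"
    using assms exp_gt_zero[of \<rho>] by (auto simp: r_def add_pos_pos)
  define C where "C = 2 + 2 / (1 - r)"
  have C: "C \<ge> 0" using r1 by (simp add: C_def)
  have sm: "(\<Sum>j\<le>i. r ^ j) \<le> 1 / (1 - r)" for i
  proof -
    have "(\<Sum>j<Suc i. r ^ j) = (1 - r ^ Suc i) / (1 - r)"
      using r1 geometric_sum[of r "Suc i"] minus_divide_divide[of "1 - r ^ Suc i" "1 - r"] by simp
    also have "\<dots> \<le> 1 / (1 - r)" using r0 r1 by (intro divide_right_mono) auto
    finally have "(\<Sum>j<Suc i. r ^ j) \<le> 1 / (1 - r)" .
    thus ?thesis by (simp only: lessThan_Suc_atMost)
  qed
  show thesis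
  proof (rule that[OF C])
    show "eventually (\<lambda>s. \<forall>y\<ge>0. \<bar>a (s + y)\<bar> \<le> C * \<bar>a s\<bar> \<and> \<bar>\<psi> (s + y) - \<psi> s\<bar> \<le> C * \<bar>a s\<bar>) at_top"
      using growth[OF r]
    proof eventually_elim
      case (elim s)
      show ?case
      proof (intro allI impI)
        fix y :: real assume y: "0 \<le> y"
        have "\<bar>\<psi> (s + y) - \<psi> s\<bar> \<le> 2 * \<bar>a s\<bar> * (\<Sum>j\<le>nat \<lfloor>y\<rfloor>. r ^ j)" using elim y by blast
        also have "\<dots> \<le> 2 * \<bar>a s\<bar> * (1 / (1 - r))" by (intro mult_left_mono sm) simp
        also have "\<dots> \<le> C * \<bar>a s\<bar>" by (simp add: C_def algebra_simps)
        finally have 1: "\<bar>\<psi> (s + y) - \<psi> s\<bar> \<le> C * \<bar>a s\<bar>" .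
        have "\<bar>a (s + y)\<bar> \<le> 2 * r ^ nat \<lfloor>y\<rfloor> * \<bar>a s\<bar>" using elim y by blast
        also have "\<dots> \<le> C * \<bar>a s\<bar>"
          using r0 r1 power_le_one[of r "nat \<lfloor>y\<rfloor>"] 
          by (intro mult_right_mono) (auto simp: C_def intro: add_increasing2)
        finally show "\<bar>a (s + y)\<bar> \<le> C * \<bar>a s\<bar> \<and> \<bar>\<psi> (s + y) - \<psi> s\<bar> \<le> C * \<bar>a s\<bar>" using 1 by simp
      qed
    qed
  qed
qed

text \<open>Up to some \<open>Y\<close> the locally uniform limit gives the error
  \<open>\<epsilon>\<close>; beyond \<open>Y\<close> both terms are bounded separately by multiples
  of \<open>exp (y / 4)\<close>, which are small compared with \<open>exp (y / 3)\<close>.\<close>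

lemma \<psi>_increment_dominated:
  assumes "0 < \<epsilon>"
  shows "eventually (\<lambda>s. \<forall>y\<ge>0. \<bar>(\<psi> (s + y) - \<psi> s) / a s - box_cox \<rho> y\<bar> \<le> \<epsilon> * exp (y / 3)) at_top"
proof -
  obtain C where C: "C \<ge> 0"
    "eventually (\<lambda>s. \<forall>y\<ge>0. \<bar>\<psi> (s + y) - \<psi> s\<bar> \<le> C * \<bar>a s\<bar> * exp (y / 4)) at_top"
    using \<psi>_growth .
  \<comment> \<open>The rate 1/12 is the gap 1/3 - 1/4, and the summand 4 comes from
    \<open>box_cox \<rho> y \<le> y \<le> 4 * exp (y / 4)\<close>.\<close>
  have "((\<lambda>y. (C + 4) * exp (- y / 12)) \<longlongrightarrow> (C + 4) * 0) at_top"
    by (intro tendsto_mult tendsto_const) real_asymp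
  hence "eventually (\<lambda>y. (C + 4) * exp (- y / 12) < \<epsilon>) at_top"
    using assms by (intro order_tendstoD) auto
  then obtain Y where Y: "\<And>y. y \<ge> Y \<Longrightarrow> (C + 4) * exp (- y / 12) < \<epsilon>"
    by (auto simp: eventually_at_top_linorder)
  show ?thesis
    using C(2) a_nonzero \<psi>_increment_uniform[OF assms, of Y]
  proof eventually_elim
    case (elim s)
    show ?case
    proof (intro allI impI)
      fix y :: real assume y: "0 \<le> y"
      show "\<bar>(\<psi> (s + y) - \<psi> s) / a s - box_cox \<rho> y\<bar> \<le> \<epsilon> * exp (y / 3)"
      proof (cases "y \<le> Y")
        case True
        hence "\<bar>(\<psi> (s + y) - \<psi> s) / a s - box_cox \<rho> y\<bar> \<le> \<epsilon>" using elim y by (auto intro: less_imp_le)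
        also have "\<dots> \<le> \<epsilon> * exp (y / 3)" using assms y by simp
        finally show ?thesis .
      next
        case False
        have "\<bar>(\<psi> (s + y) - \<psi> s) / a s\<bar> \<le> C * exp (y / 4)"
          using elim y by (simp add: abs_divide divide_simps mult_ac)
        moreover have "\<bar>box_cox \<rho> y\<bar> \<le> 4 * exp (y / 4)"
          using box_cox_nonneg[OF \<rho>_nonpos y] box_cox_le[OF \<rho>_nonpos y] exp_ge_add_one_self[of "y / 4"]
          by linarith
        ultimately have "\<bar>(\<psi> (s + y) - \<psi> s) / a s - box_cox \<rho> y\<bar> \<le> (C + 4) * exp (y / 4)"
          unfolding distrib_right by linarith
        also have "exp (y / 4) = exp (- y / 12) * exp (y / 3)" by (simp add: exp_add[symmetric])
        also have "(C + 4) * (exp (- y / 12) * exp (y / 3)) \<le> \<epsilon> * exp (y / 3)"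
          unfolding mult.assoc[symmetric] using Y[of y] False by (intro mult_right_mono) auto
        finally show ?thesis .
      qed
    qed
  qed
qed

end

section \<open>Order statistics\<close>

lemma nth_le_iff_less_length_filter:
  fixes ys :: "'b::linorder list"
  assumes "sorted ys" "i < length ys"
  shows "ys ! i \<le> t \<longleftrightarrow> i < length (filter (\<lambda>y. y \<le> t) ys)"
  using assms
proof (induction ys arbitrary: i)
  case (Cons y ys)
  show ?case
  proof (cases "y \<le> t")
    case True
    with Cons show ?thesis by (cases i) auto
  next
    case False
    have "y \<le> (y # ys) ! i" using Cons.prems by (cases i) auto
    moreover have "filter (\<lambda>y. y \<le> t) ys = []"
      using False Cons.prems by (auto simp: filter_empty_conv)
    ultimately show ?thesis using False by auto
  qed
qed simp

lemma order_stat_le_iff: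
  assumes "1 \<le> i" "i \<le> n"
  shows "order_stat i n x \<le> t \<longleftrightarrow> i \<le> card {j\<in>{1..n}. x j \<le> t}"
proof -
  let ?xs = "map x [1..<Suc n]"
  have "length (filter (\<lambda>y. y \<le> t) (sort ?xs)) = length (filter (\<lambda>y. y \<le> t) ?xs)"
    by (metis mset_filter mset_sort size_mset)
  also have "\<dots> = length (filter (\<lambda>j. x j \<le> t) [1..<Suc n])"
    by (simp add: filter_map comp_def del: upt_Suc)
  also have "\<dots> = card (set (filter (\<lambda>j. x j \<le> t) [1..<Suc n]))"
    by (rule distinct_card[symmetric]) (simp del: upt_Suc)
  also have "set (filter (\<lambda>j. x j \<le> t) [1..<Suc n]) = {j\<in>{1..n}. x j \<le> t}" by auto
  finally have "length (filter (\<lambda>y. y \<le> t) (sort ?xs)) = card {j\<in>{1..n}. x j \<le> t}" .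
  moreover have "sort ?xs ! (i - 1) \<le> t \<longleftrightarrow> i - 1 < length (filter (\<lambda>y. y \<le> t) (sort ?xs))"
    using assms by (intro nth_le_iff_less_length_filter) (auto simp del: upt_Suc)
  ultimately show ?thesis using assms by (simp only: order_stat_def) linarith
qed

text \<open>In terms of exceedances, the tail event of the threshold becomes an event about a sum of
  independent indicators. At least \<open>k + 1\<close> observations must exceed \<open>t\<close>,
  since the threshold itself is one of them.\<close>

lemma less_order_stat_iff:
  assumes "k < n"
  shows "t < order_stat (n - k) n x \<longleftrightarrow> k < card {j\<in>{1..n}. t < x j}"
proof -
  have "card {j\<in>{1..n}. x j \<le> t} + card {j\<in>{1..n}. t < x j} = card ({j\<in>{1..n}. x j \<le> t} \<union> {j\<in>{1..n}. t < x j})"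
    by (rule card_Un_disjoint[symmetric]) auto
  also have "{j\<in>{1..n}. x j \<le> t} \<union> {j\<in>{1..n}. t < x j} = {1..n}" by auto
  finally have "card {j\<in>{1..n}. x j \<le> t} + card {j\<in>{1..n}. t < x j} = n" by simp
  with order_stat_le_iff[of "n - k" n x t] assms show ?thesis by (simp add: not_le[symmetric]) linarith
qed

lemma order_stat_measurable:
  assumes [measurable]: "\<And>j. j \<in> {1..n} \<Longrightarrow> f j \<in> borel_measurable M" and i: "1 \<le> i" "i \<le> n"
  shows "(\<lambda>\<omega>. order_stat i n (\<lambda>j. f j \<omega>)) \<in> borel_measurable M"
proof (rule borel_measurableI_le)
  fix t
  have "{\<omega> \<in> space M. order_stat i n (\<lambda>j. f j \<omega>) \<le> t} =
      {\<omega> \<in> space M. real i \<le> (\<Sum>j\<in>{1..n}. of_bool (f j \<omega> \<le> t))}"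
    using i by (auto simp: order_stat_le_iff Int_def)
  also have "\<dots> \<in> sets M" by measurable
  finally show "{\<omega> \<in> space M. order_stat i n (\<lambda>j. f j \<omega>) \<le> t} \<in> sets M" .
qed

lemma order_stat_mem:
  assumes "1 \<le> i" "i \<le> n" shows "order_stat i n x \<in> x ` {1..n}"
proof -
  have "order_stat i n x \<in> set (sort (map x [1..<Suc n]))"
    unfolding order_stat_def using assms by (intro nth_mem) (simp del: upt_Suc)
  also have "\<dots> = x ` {1..n}" by (auto simp del: upt_Suc)
  finally show ?thesis .
qed

text \<open>A monotone map keeps a sorted list sorted. Monotonicity is asked for on a set only,
  because the quantile function \<open>Q\<close> below is controlled on positive arguments.\<close>

lemma order_stat_mono_on:
  assumes Q: "mono_on S Q" and x: "\<And>j. j \<in> {1..n} \<Longrightarrow> x j \<in> S" and i: "1 \<le> i" "i \<le> n"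
  shows "order_stat i n (\<lambda>j. Q (x j)) = Q (order_stat i n x)"
proof -
  let ?xs = "map x [1..<Suc n]"
  have set: "set ?xs \<subseteq> S" using x by (auto simp del: upt_Suc)
  have "sort (map Q ?xs) = map Q (sort ?xs)"
  proof (rule properties_for_sort)
    show "mset (map Q (sort ?xs)) = mset (map Q ?xs)" by (simp add: multiset.map_comp del: upt_Suc)
    show "sorted (map Q (sort ?xs))"
      unfolding sorted_map
      by (rule sorted_wrt_mono_rel[of _ "(\<le>)"])
         (use Q set in \<open>auto simp del: upt_Suc intro!: mono_onD[OF Q]\<close>)
  qed
  thus ?thesis using i by (simp add: order_stat_def comp_def del: upt_Suc)
qed

lemma order_stat_mono_index:
  assumes "1 \<le> i" "i \<le> i'" "i' \<le> n"
  shows "order_stat i n x \<le> order_stat i' n x"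
  unfolding order_stat_def by (rule sorted_nth_mono) (use assms in \<open>auto simp del: upt_Suc\<close>)

text \<open>Without ties, the indices with values strictly above the threshold are exactly those of
  the top \<open>k\<close>. Replacing the ordering by this index set makes symmetric products
  accessible without any permutation.\<close>

lemma order_stat_top:
  fixes \<phi> :: "real \<Rightarrow> 'c::comm_monoid_mult"
  assumes inj: "inj_on x {1..n}" and k: "k < n"
  defines "S \<equiv> {j\<in>{1..n}. order_stat (n - k) n x < x j}"
  shows "card S = k" "(\<Prod>i=1..k. \<phi> (order_stat (n - i + 1) n x)) = (\<Prod>j\<in>S. \<phi> (x j))"
proof -
  define ys where "ys = sort (map x [1..<Suc n])"
  have len: "length ys = n" by (simp add: ys_def del: upt_Suc)
  have set: "set ys = x ` {1..n}" by (auto simp: ys_def simp del: upt_Suc)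
  have dist: "distinct ys"
    unfolding ys_def distinct_sort distinct_map using inj
    by (auto simp del: upt_Suc simp: atLeastLessThanSuc_atLeastAtMost)
  have srt: "sorted ys" by (simp add: ys_def)
  have strict: "ys ! i < ys ! j \<longleftrightarrow> i < j" if "i < n" "j < n" for i j
  proof -
    have "ys ! i \<noteq> ys ! j" if "i \<noteq> j" using that \<open>i < n\<close> \<open>j < n\<close> dist len by (simp add: nth_eq_iff_index_eq)
    moreover have "ys ! i \<le> ys ! j" if "i \<le> j" using that \<open>j < n\<close> srt len by (simp add: sorted_nth_mono)
    moreover have "ys ! j \<le> ys ! i" if "j \<le> i" using that \<open>i < n\<close> srt len by (simp add: sorted_nth_mono)
    ultimately show ?thesis by (metis less_le not_le nless_le linorder_le_cases)
  qed
  have img: "x ` S = nth ys ` {n-k..<n}"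
  proof -
    have "x ` S = {v \<in> set ys. ys ! (n - k - 1) < v}"
      unfolding set S_def order_stat_def ys_def by auto
    also have "\<dots> = nth ys ` {n-k..<n}"
      using k strict len by (fastforce simp: in_set_conv_nth)
    finally show ?thesis .
  qed
  have injS: "inj_on x S" using inj by (rule inj_on_subset) (auto simp: S_def)
  have injn: "inj_on (nth ys) {n-k..<n}"
    using dist len by (auto simp: inj_on_def nth_eq_iff_index_eq)
  have "card S = card (x ` S)" using injS by (simp add: card_image)
  also have "\<dots> = k" unfolding img using injn k by (simp add: card_image)
  finally show "card S = k" .
  have "(\<Prod>i=1..k. \<phi> (order_stat (n - i + 1) n x)) = (\<Prod>i\<in>{n-k..<n}. \<phi> (ys ! i))"
    by (rule prod.reindex_bij_witness[of _ "\<lambda>i. n - i" "\<lambda>i. n - i"])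
       (use k in \<open>auto simp: order_stat_def ys_def\<close>)
  also have "\<dots> = (\<Prod>v\<in>x ` S. \<phi> v)"
    unfolding img using injn by (simp add: prod.reindex)
  also have "\<dots> = (\<Prod>j\<in>S. \<phi> (x j))" using injS by (simp add: prod.reindex)
  finally show "(\<Prod>i=1..k. \<phi> (order_stat (n - i + 1) n x)) = (\<Prod>j\<in>S. \<phi> (x j))" .
qed

section \<open>Excesses of exponential samples\<close>

lemma order_stat_cong:
  "(\<And>j. j \<in> {1..n} \<Longrightarrow> x j = x' j) \<Longrightarrow> order_stat i n x = order_stat i n x'"
  unfolding order_stat_def by (intro arg_cong2[where f = nth] arg_cong[where f = sort] map_cong) (auto simp del: upt_Suc)

definition std_exponential :: "real measure" where
  "std_exponential = density lborel (exponential_density 1)"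

lemma sets_std_exponential [measurable_cong, simp]: "sets std_exponential = sets borel"
  by (simp add: std_exponential_def)

lemma space_std_exponential [simp]: "space std_exponential = UNIV"
  by (simp add: std_exponential_def)

lemma prob_space_std_exponential: "prob_space std_exponential"
  unfolding std_exponential_def by (rule prob_space_exponential_density) simp

interpretation std_exponential: prob_space std_exponential
  by (rule prob_space_std_exponential)

lemma integral_std_exponential:
  fixes f :: "real \<Rightarrow> 'b::{banach, second_countable_topology}"
  assumes [measurable]: "f \<in> borel_measurable borel"
  shows "(\<integral>y. f y \<partial>std_exponential) = (\<integral>y. exponential_density 1 y *\<^sub>R f y \<partial>lborel)"
  unfolding std_exponential_def
  by (subst integral_density) (auto simp: exponential_density_nonneg)

lemma AE_std_exponential_pos: "AE y in std_exponential. 0 < y"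
proof -
  have "AE y in lborel. y \<noteq> (0::real)" by (rule AE_lborel_singleton)
  hence "AE y in lborel. 0 < ennreal (exponential_density 1 y) \<longrightarrow> 0 < y"
    by eventually_elim (auto simp: exponential_density_def)
  thus ?thesis unfolding std_exponential_def by (subst AE_density) auto
qed

lemma AE_std_exponential_neq: "AE y in std_exponential. y \<noteq> s"
proof -
  have "AE y in lborel. y \<noteq> (s::real)" by (rule AE_lborel_singleton)
  thus ?thesis unfolding std_exponential_def by (subst AE_density) auto
qed

text \<open>Translating the integration variable by \<open>s\<close> multiplies the density by
  \<open>exp (- s)\<close> on the positive half-line; the endpoint 0 is a null set.\<close>

lemma std_exponential_memoryless:
  fixes \<phi> :: "real \<Rightarrow> 'b::{banach, second_countable_topology}"
  assumes [measurable]: "\<phi> \<in> borel_measurable borel" and s: "0 \<le> s"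
  shows "(\<integral>y. (if s < y then \<phi> (y - s) else 0) \<partial>std_exponential) = exp (- s) *\<^sub>R (\<integral>y. \<phi> y \<partial>std_exponential)"
proof -
  have "(\<integral>y. (if s < y then \<phi> (y - s) else 0) \<partial>std_exponential) =
      (\<integral>y. exponential_density 1 y *\<^sub>R (if s < y then \<phi> (y - s) else 0) \<partial>lborel)"
    by (rule integral_std_exponential) measurable
  also have "\<dots> = (\<integral>y. exponential_density 1 (s + y) *\<^sub>R (if 0 < y then \<phi> y else 0) \<partial>lborel)"
    by (subst lborel_integral_real_affine[where c = 1 and t = s]) (simp_all cong: if_cong)
  also have "\<dots> = (\<integral>y. exp (- s) *\<^sub>R (exponential_density 1 y *\<^sub>R \<phi> y) \<partial>lborel)"
  proof (rule integral_cong_AE)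
    have "AE y in lborel. y \<noteq> (0::real)" by (rule AE_lborel_singleton)
    thus "AE y in lborel. exponential_density 1 (s + y) *\<^sub>R (if 0 < y then \<phi> y else 0) =
        exp (- s) *\<^sub>R (exponential_density 1 y *\<^sub>R \<phi> y)"
      by eventually_elim (use s in \<open>auto simp: exponential_density_def exp_add[symmetric]\<close>)
  qed measurable
  also have "\<dots> = exp (- s) *\<^sub>R (\<integral>y. \<phi> y \<partial>std_exponential)"
    by (simp add: integral_std_exponential del: scaleR_scaleR)
  finally show ?thesis .
qed

lemma std_exponential_measure_greaterThan:
  assumes "0 \<le> t" shows "measure std_exponential {t<..} = exp (- t)"
proof -
  have "measure std_exponential {t<..} = (\<integral>y. indicator {t<..} y \<partial>std_exponential)" by simp
  also have "\<dots> = (\<integral>y. (if t < y then (\<lambda>_. 1) (y - t) else 0) \<partial>std_exponential)"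
    by (intro Bochner_Integration.integral_cong) (auto simp: indicator_def)
  also have "\<dots> = exp (- t)"
    using std_exponential.prob_space
    by (subst std_exponential_memoryless[OF _ assms]) simp_all
  finally show ?thesis .
qed

section \<open>Products of exponential laws and the partition by the pivot\<close>

interpretation product_std_exponential: product_sigma_finite "\<lambda>_::nat. std_exponential"
  by unfold_locales

abbreviation exp_product :: "nat set \<Rightarrow> (nat \<Rightarrow> real) measure" where
  "exp_product I \<equiv> PiM I (\<lambda>_. std_exponential)"

lemma prob_space_exp_product: "prob_space (exp_product I)"
  by (rule prob_space_PiM) (rule prob_space_std_exponential)

lemma exp_product_component: "i \<in> I \<Longrightarrow> (\<lambda>x. x i) \<in> borel_measurable (exp_product I)"
  unfolding measurable_cong_sets[OF refl sets_std_exponential[symmetric]]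
  by (rule measurable_component_singleton)

text \<open>Fubini with the pivot coordinate \<open>r\<close> outermost: for a fixed pivot value
  \<open>s\<close> the remaining coordinates are independent and each factor involves only one of
  them, so the inner integral factorises.\<close>

lemma pivot_integral:
  fixes w :: "nat \<Rightarrow> real \<Rightarrow> real \<Rightarrow> 'b::{real_normed_field, banach, second_countable_topology}"
  assumes I: "finite I" "r \<notin> I"
    and w [measurable]: "\<And>i. i \<in> I \<Longrightarrow> (\<lambda>(y, s). w i y s) \<in> borel_measurable (borel \<Otimes>\<^sub>M borel)"
    and bound: "\<And>i y s. i \<in> I \<Longrightarrow> norm (w i y s) \<le> 1"
  shows "integrable (exp_product (insert r I)) (\<lambda>x. \<Prod>i\<in>I. w i (x i) (x r))"
    and "(\<integral>x. (\<Prod>i\<in>I. w i (x i) (x r)) \<partial>exp_product (insert r I)) =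
      (\<integral>s. (\<Prod>i\<in>I. \<integral>y. w i y s \<partial>std_exponential) \<partial>std_exponential)"
proof -
  interpret PI: prob_space "exp_product (insert r I)" by (rule prob_space_exp_product)
  let ?f = "\<lambda>x. \<Prod>i\<in>I. w i (x i) (x r)"
  have meas: "(\<lambda>x. w i (x i) (x r)) \<in> borel_measurable (exp_product (insert r I))"
    if i: "i \<in> I" for i
  proof -
    have "(\<lambda>x. (x i, x r)) \<in> measurable (exp_product (insert r I)) (borel \<Otimes>\<^sub>M borel)"
      using i by (intro measurable_Pair exp_product_component) auto
    from measurable_compose[OF this w[OF i]] show ?thesis by simp
  qed
  show int: "integrable (exp_product (insert r I)) ?f"
  proof (rule PI.integrable_const_bound[where B = 1])
    show "AE x in exp_product (insert r I). norm (?f x) \<le> 1"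
      unfolding prod_norm[symmetric] using bound by (intro AE_I2 prod_le_1) auto
    show "?f \<in> borel_measurable (exp_product (insert r I))"
      by (intro borel_measurable_prod meas)
  qed
  have wi: "integrable std_exponential (\<lambda>y. w i y s)" if i: "i \<in> I" for i s
  proof (rule std_exponential.integrable_const_bound[where B = 1])
    have "(\<lambda>y. (y, s)) \<in> measurable std_exponential (borel \<Otimes>\<^sub>M borel)" by measurable
    from measurable_compose[OF this w[OF i]] show "(\<lambda>y. w i y s) \<in> borel_measurable std_exponential" by simp
  qed (use bound i in auto)
  have ms: "(\<lambda>s. \<integral>y. w i y s \<partial>std_exponential) \<in> borel_measurable std_exponential" if i: "i \<in> I" for i
  proof (rule std_exponential.borel_measurable_lebesgue_integral)
    have "(\<lambda>(s, y). (y, s)) \<in> measurable (std_exponential \<Otimes>\<^sub>M std_exponential) (borel \<Otimes>\<^sub>M borel)" by measurable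
    from measurable_compose[OF this w[OF i]]
    show "(\<lambda>(s, y). w i y s) \<in> borel_measurable (std_exponential \<Otimes>\<^sub>M std_exponential)"
      by (simp add: case_prod_unfold)
  qed
  have "integral\<^sup>L (exp_product (insert r I)) ?f =
      integral\<^sup>L (PiM ({r} \<union> I) (\<lambda>_. std_exponential)) ?f" by simp
  also have "\<dots> = (\<integral>x. (\<integral>y. ?f (merge {r} I (x, y)) \<partial>PiM I (\<lambda>_. std_exponential)) \<partial>PiM {r} (\<lambda>_. std_exponential))"
    using I int by (intro product_std_exponential.product_integral_fold) auto
  also have "\<dots> = (\<integral>x. (\<integral>y. (\<Prod>i\<in>I. w i (y i) (x r)) \<partial>PiM I (\<lambda>_. std_exponential)) \<partial>PiM {r} (\<lambda>_. std_exponential))"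
    using I by (intro Bochner_Integration.integral_cong prod.cong) (auto simp: merge_def)
  also have "\<dots> = (\<integral>x. (\<Prod>i\<in>I. \<integral>y. w i y (x r) \<partial>std_exponential) \<partial>PiM {r} (\<lambda>_. std_exponential))"
    by (intro Bochner_Integration.integral_cong refl product_std_exponential.product_integral_prod I wi)
  also have "\<dots> = (\<integral>s. (\<Prod>i\<in>I. \<integral>y. w i y s \<partial>std_exponential) \<partial>std_exponential)"
    by (rule product_std_exponential.product_integral_singleton[where i = r]) (intro borel_measurable_prod ms)
  finally show "integral\<^sup>L (exp_product (insert r I)) ?f =
      (\<integral>s. (\<Prod>i\<in>I. \<integral>y. w i y s \<partial>std_exponential) \<partial>std_exponential)" .
qed

lemma AE_exp_product_inj: "AE x in exp_product {1..n}. inj_on x {1..n}"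
proof -
  have ne: "AE x in exp_product {1..n}. x i \<noteq> x j" if ij: "(i :: nat) \<in> {1..n}" "j \<in> {1..n}" "i \<noteq> j" for i j
  proof -
    let ?I = "{1..n} - {j}"
    have ins: "insert j ?I = {1..n}" using ij by auto
    \<comment> \<open>The indicator of \<open>x i = x j\<close> is written as a product over all
      indices other than \<open>j\<close>, with trivial factors except at \<open>i\<close>. With
      \<open>j\<close> as pivot, the factor at \<open>i\<close> integrates to the mass of a single
      point, which is 0.\<close>
    define w :: "nat \<Rightarrow> real \<Rightarrow> real \<Rightarrow> real" where "w i' y s = (if i' = i \<and> y \<noteq> s then 0 else 1)" for i' y s
    have w: "(\<lambda>(y, s). w i' y s) \<in> borel_measurable (borel \<Otimes>\<^sub>M borel)" for i'
      unfolding w_def case_prod_unfold by measurable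
    have eq: "(\<Prod>i'\<in>?I. w i' (x i') (x j)) = (if x i = x j then 1 else 0)" for x
      using ij by (subst prod.remove[of _ i]) (auto simp: w_def)
    have z: "(\<integral>y. w i y s \<partial>std_exponential) = 0" for s
    proof -
      have "(\<integral>y. w i y s \<partial>std_exponential) = (\<integral>y. 0 \<partial>std_exponential)"
        by (rule integral_cong_AE) (use AE_std_exponential_neq[of s] in \<open>auto simp: w_def\<close>)
      thus ?thesis by simp
    qed
    have int: "integrable (exp_product {1..n}) (\<lambda>x. if x i = x j then 1 else 0 :: real)"
      using pivot_integral(1)[of ?I j w, unfolded ins eq] w by (auto simp: w_def)
    have "(\<integral>x. (if x i = x j then 1 else 0) \<partial>exp_product {1..n}) =
        (\<integral>s. (\<Prod>i'\<in>?I. \<integral>y. w i' y s \<partial>std_exponential) \<partial>std_exponential)"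
      using pivot_integral(2)[of ?I j w, unfolded ins eq] w by (auto simp: w_def)
    also have "\<dots> = 0"
      using ij z by (subst prod_zero) (auto intro!: bexI[of _ i])
    finally have "AE x in exp_product {1..n}. (if x i = x j then 1 else 0 :: real) = 0"
      using integral_nonneg_eq_0_iff_AE[OF int] by auto
    thus ?thesis by eventually_elim (auto split: if_splits)
  qed
  have "AE x in exp_product {1..n}. \<forall>i\<in>{1..n}. \<forall>j\<in>{1..n}. i \<noteq> j \<longrightarrow> x i \<noteq> x j"
    by (intro AE_ball_countable[THEN iffD2] ballI AE_impI ne) auto
  thus ?thesis by eventually_elim (auto simp: inj_on_def)
qed

text \<open>With \<open>g\<close> the identity, dividing by \<open>k\<close> gives the Hill
  statistic of the data \<open>exp (x i)\<close>. A general \<open>g\<close> is kept because the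
  bias and the error bounds are averages of other functions over the same excesses.\<close>

definition excess_sum :: "(real \<Rightarrow> real) \<Rightarrow> nat \<Rightarrow> nat \<Rightarrow> (nat \<Rightarrow> real) \<Rightarrow> real" where
  "excess_sum g k n x = (\<Sum>i=1..k. g (order_stat (n - i + 1) n x - order_stat (n - k) n x))"

lemma excess_sum_measurable:
  assumes f: "\<And>j. j \<in> {1..n} \<Longrightarrow> f j \<in> borel_measurable M" and k: "k < n"
    and [measurable]: "g \<in> borel_measurable borel"
  shows "(\<lambda>\<omega>. excess_sum g k n (\<lambda>j. f j \<omega>)) \<in> borel_measurable M"
proof -
  have [measurable]: "(\<lambda>\<omega>. order_stat (n - i + 1) n (\<lambda>j. f j \<omega>)) \<in> borel_measurable M" if "i \<in> {1..k}" for i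
    using that k by (intro order_stat_measurable f) auto
  have [measurable]: "(\<lambda>\<omega>. order_stat (n - k) n (\<lambda>j. f j \<omega>)) \<in> borel_measurable M"
    using k by (intro order_stat_measurable f) auto
  show ?thesis unfolding excess_sum_def by measurable
qed

text \<open>Only one pair \<open>(r, S)\<close> contributes: \<open>r\<close> the index of the
  threshold and \<open>S\<close> the set of indices above it. Every other pair contains a vanishing
  factor, because nonzero factors force \<open>S\<close> to be exactly the set of indices above
  \<open>x r\<close>.\<close>

lemma top_products_partition:
  fixes \<phi> :: "real \<Rightarrow> complex"
  assumes inj: "inj_on x {1..n}" and k: "k < n"
  shows "(\<Prod>i=1..k. \<phi> (order_stat (n - i + 1) n x - order_stat (n - k) n x)) =
    (\<Sum>(r, S)\<in>(SIGMA r:{1..n}. {S. S \<subseteq> {1..n} - {r} \<and> card S = k}).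
      \<Prod>i\<in>{1..n} - {r}. if i \<in> S then if x r < x i then \<phi> (x i - x r) else 0 else if x i < x r then 1 else 0)"
    (is "?L = (\<Sum>(r, S)\<in>?A. ?t r S)")
proof -
  define Z where "Z = order_stat (n - k) n x"
  define S0 where "S0 = {j\<in>{1..n}. Z < x j}"
  have "Z \<in> x ` {1..n}" unfolding Z_def by (rule order_stat_mem) (use k in auto)
  then obtain r0 where r0: "r0 \<in> {1..n}" "x r0 = Z" by auto
  have cS0: "card S0 = k" using order_stat_top(1)[OF inj k] by (simp add: S0_def Z_def)
  have mem: "(r0, S0) \<in> ?A" using r0 cS0 by (auto simp: S0_def)
  have fin: "finite ?A" by (intro finite_SigmaI) auto
  have zero: "?t r S = 0" if rS: "(r, S) \<in> ?A" and ne: "(r, S) \<noteq> (r0, S0)" for r S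
  proof (rule ccontr)
    assume nz: "?t r S \<noteq> 0"
    have "finite ({1..n} - {r})" by simp
    from nz have all: "\<forall>i\<in>{1..n} - {r}. (if i \<in> S then if x r < x i then \<phi> (x i - x r) else 0 else if x i < x r then 1 else 0) \<noteq> 0"
      by (subst (asm) prod_zero_iff) auto
    have S: "S = {j\<in>{1..n}. x r < x j}"
    proof (intro set_eqI iffI)
      fix j assume "j \<in> S" thus "j \<in> {j\<in>{1..n}. x r < x j}"
        using all rS by (auto split: if_splits)
    next
      fix j assume j: "j \<in> {j\<in>{1..n}. x r < x j}"
      hence "j \<in> {1..n} - {r}" by auto
      from bspec[OF all this] j show "j \<in> S" by (auto split: if_splits)
    qed
    have rn: "r \<in> {1..n}" and cS: "card S = k" using rS by auto
    \<comment> \<open>The number of values above \<open>x r\<close> decides: a pivot below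
      \<open>Z\<close> has at least \<open>k + 1\<close> values above it, a pivot above
      \<open>Z\<close> has fewer than \<open>k\<close>, and a pivot equal to \<open>Z\<close> is
      \<open>r0\<close> since there are no ties.\<close>
    consider "x r < Z" | "Z < x r" | "x r = Z" by linarith
    thus False
    proof cases
      case 1
      hence "insert r0 S0 \<subseteq> S" using r0 unfolding S S0_def by auto
      hence "card (insert r0 S0) \<le> card S" by (intro card_mono) (auto simp: S)
      moreover have "r0 \<notin> S0" using r0 by (auto simp: S0_def)
      ultimately show False using cS cS0 by (simp add: S0_def)
    next
      case 2
      hence "S \<subset> S0" using rn unfolding S S0_def by auto
      hence "card S < card S0" by (intro psubset_card_mono) (auto simp: S0_def)
      with cS cS0 show False by simp
    next
      case 3
      hence "r = r0" using inj rn r0 by (auto dest: inj_onD)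
      with 3 S ne show False by (auto simp: S0_def)
    qed
  qed
  have "(\<Sum>(r, S)\<in>?A. ?t r S) = (\<Sum>(r, S)\<in>{(r0, S0)}. ?t r S)"
  proof (rule sum.mono_neutral_right[OF fin])
    show "\<forall>p\<in>?A - {(r0, S0)}. (case p of (r, S) \<Rightarrow> ?t r S) = 0"
    proof
      fix p assume p: "p \<in> ?A - {(r0, S0)}"
      obtain r S where rS: "p = (r, S)" by (cases p)
      with p show "(case p of (r, S) \<Rightarrow> ?t r S) = 0" using zero[of r S] by simp
    qed
  qed (use mem in simp)
  also have "\<dots> = ?t r0 S0" by simp
  also have "\<dots> = (\<Prod>i\<in>{1..n} - {r0}. if i \<in> S0 then \<phi> (x i - Z) else 1)"
  proof (rule prod.cong)
    fix i assume i: "i \<in> {1..n} - {r0}"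
    have "x i \<noteq> Z" using i r0 inj by (auto dest: inj_onD)
    with i show "(if i \<in> S0 then if x r0 < x i then \<phi> (x i - x r0) else 0 else if x i < x r0 then 1 else 0) =
      (if i \<in> S0 then \<phi> (x i - Z) else 1)" using r0 by (auto simp: S0_def)
  qed simp
  also have "\<dots> = (\<Prod>i\<in>S0. \<phi> (x i - Z))"
    using r0 by (intro prod.mono_neutral_cong_right) (auto simp: S0_def)
  also have "\<dots> = ?L"
    using order_stat_top(2)[OF inj k, of "\<lambda>v. \<phi> (v - Z)"] by (simp add: S0_def Z_def)
  finally show ?thesis by simp
qed

text \<open>The product space is partitioned by the index \<open>r\<close> of the pivot and the set \<open>S\<close> of indices above it.
  Given the pivot, memorylessness turns each factor into \<open>\<integral>\<phi>\<close> times a weight independent of \<open>\<phi>\<close>;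
  the total weight is found by taking \<open>\<phi> = 1\<close>.\<close>

lemma integral_top_product:
  fixes \<phi> :: "real \<Rightarrow> complex"
  assumes [measurable]: "\<phi> \<in> borel_measurable borel" and bound: "\<And>y. norm (\<phi> y) \<le> 1" and k: "k < n"
  shows "(\<integral>x. (\<Prod>i=1..k. \<phi> (order_stat (n - i + 1) n x - order_stat (n - k) n x)) \<partial>exp_product {1..n})
    = (\<integral>y. \<phi> y \<partial>std_exponential) ^ k"
proof -
  let ?A = "SIGMA r:{1..n}. {S. S \<subseteq> {1..n} - {r} \<and> card S = k}"
  let ?M = "exp_product {1..n}"
  interpret M: prob_space ?M by (rule prob_space_exp_product)
  define below :: "real \<Rightarrow> real"
    where "below s = (\<integral>y. (if y < s then 1 else 0) \<partial>std_exponential)" for s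
  \<comment> \<open>The weight left once \<open>\<phi>\<close> is factored out: given the pivot
    value \<open>s\<close>, each index of \<open>S\<close> lies above it with probability
    \<open>exp (- s)\<close>, every other index below it with probability
    \<open>below s\<close>.\<close>
  define J :: "nat \<Rightarrow> nat set \<Rightarrow> real \<Rightarrow> complex"
    where "J r S s = (\<Prod>i\<in>{1..n} - {r}. of_real (if i \<in> S then exp (- s) else below s))" for r S s
  define c where "c = (\<Sum>(r, S)\<in>?A. \<integral>s. J r S s \<partial>std_exponential)"
  define T where "T \<phi> = (\<integral>x. (\<Prod>i=1..k. \<phi> (order_stat (n - i + 1) n x - order_stat (n - k) n x)) \<partial>?M)"
    for \<phi> :: "real \<Rightarrow> complex"
  have fin: "finite ?A" by (intro finite_SigmaI) auto
  have below [measurable]: "below \<in> borel_measurable borel"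
  proof -
    have "(\<lambda>s. \<integral>y. (if y < s then 1 else 0 :: real) \<partial>std_exponential) \<in> borel_measurable borel"
      by (rule std_exponential.borel_measurable_lebesgue_integral) measurable
    thus ?thesis by (simp add: below_def[abs_def])
  qed
  have main: "T \<phi> = (\<integral>y. \<phi> y \<partial>std_exponential) ^ k * c"
    if [measurable]: "\<phi> \<in> borel_measurable borel" and bound: "\<And>y. norm (\<phi> y) \<le> 1" for \<phi>
  proof -
    define w where "w S i y s = (if i \<in> S then if s < y then \<phi> (y - s) else 0 else if y < s then 1 else 0)"
      for S :: "nat set" and i :: nat and y s :: real
    have w: "(\<lambda>(y, s). w S i y s) \<in> borel_measurable (borel \<Otimes>\<^sub>M borel)" for S i
      unfolding w_def case_prod_unfold by measurable
    have wb: "norm (w S i y s) \<le> 1" for S i y s using bound by (auto simp: w_def)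
    have ins: "insert r ({1..n} - {r}) = {1..n}" if "(r, S) \<in> ?A" for r S using that by auto
    have int: "integrable ?M (\<lambda>x. \<Prod>i\<in>{1..n} - {r}. w S i (x i) (x r))" if "(r, S) \<in> ?A" for r S
      using pivot_integral(1)[of "{1..n} - {r}" r "w S", OF _ _ w wb, unfolded ins[OF that]] by simp
    have term_eq: "(\<integral>x. (\<Prod>i\<in>{1..n} - {r}. w S i (x i) (x r)) \<partial>?M) =
        (\<integral>y. \<phi> y \<partial>std_exponential) ^ k * (\<integral>s. J r S s \<partial>std_exponential)" if rS: "(r, S) \<in> ?A" for r S
    proof -
      have "(\<integral>x. (\<Prod>i\<in>{1..n} - {r}. w S i (x i) (x r)) \<partial>?M) =
          (\<integral>s. (\<Prod>i\<in>{1..n} - {r}. \<integral>y. w S i y s \<partial>std_exponential) \<partial>std_exponential)"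
        using pivot_integral(2)[of "{1..n} - {r}" r "w S", OF _ _ w wb, unfolded ins[OF rS]] by simp
      also have "\<dots> = (\<integral>s. (\<integral>y. \<phi> y \<partial>std_exponential) ^ k * J r S s \<partial>std_exponential)"
      \<comment> \<open>Memorylessness needs a nonnegative pivot value, which is available almost
        surely only.\<close>
      proof (rule integral_cong_AE)
        show "AE s in std_exponential. (\<Prod>i\<in>{1..n} - {r}. \<integral>y. w S i y s \<partial>std_exponential) =
            (\<integral>y. \<phi> y \<partial>std_exponential) ^ k * J r S s"
          using AE_std_exponential_pos
        proof eventually_elim
          case (elim s)
          have "(\<Prod>i\<in>{1..n} - {r}. \<integral>y. w S i y s \<partial>std_exponential) =
              (\<Prod>i\<in>{1..n} - {r}. (if i \<in> S then (\<integral>y. \<phi> y \<partial>std_exponential) else 1) *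
                of_real (if i \<in> S then exp (- s) else below s))"
          proof (rule prod.cong)
            fix i assume "i \<in> {1..n} - {r}"
            have "(\<integral>y. (if y < s then 1 else 0 :: complex) \<partial>std_exponential) =
                (\<integral>y. of_real (if y < s then 1 else 0) \<partial>std_exponential)"
              by (intro Bochner_Integration.integral_cong) auto
            also have "\<dots> = of_real (below s)"
              unfolding below_def by (rule integral_complex_of_real)
            finally show "(\<integral>y. w S i y s \<partial>std_exponential) = (if i \<in> S then (\<integral>y. \<phi> y \<partial>std_exponential) else 1) *
                of_real (if i \<in> S then exp (- s) else below s)"
              using std_exponential_memoryless[of \<phi> s] elim
              by (auto simp: w_def scaleR_conv_of_real mult.commute)
          qed simp
          also have "\<dots> = (\<Prod>i\<in>{1..n} - {r}. if i \<in> S then (\<integral>y. \<phi> y \<partial>std_exponential) else 1) * J r S s"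
            by (simp only: prod.distrib J_def)
          also have "(\<Prod>i\<in>{1..n} - {r}. if i \<in> S then (\<integral>y. \<phi> y \<partial>std_exponential) else 1) =
              (\<Prod>i\<in>S. \<integral>y. \<phi> y \<partial>std_exponential)"
            using rS by (intro prod.mono_neutral_cong_right) auto
          finally show ?case using rS by simp
        qed
        show "(\<lambda>s. (\<integral>y. \<phi> y \<partial>std_exponential) ^ k * J r S s) \<in> borel_measurable std_exponential"
          unfolding J_def by measurable
        show "(\<lambda>s. \<Prod>i\<in>{1..n} - {r}. \<integral>y. w S i y s \<partial>std_exponential) \<in> borel_measurable std_exponential"
        proof (intro borel_measurable_prod std_exponential.borel_measurable_lebesgue_integral)
          fix i
          have "(\<lambda>(s, y). (y, s)) \<in> measurable (std_exponential \<Otimes>\<^sub>M std_exponential) (borel \<Otimes>\<^sub>M borel)" by measurable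
          from measurable_compose[OF this w]
          show "(\<lambda>(s, y). w S i y s) \<in> borel_measurable (std_exponential \<Otimes>\<^sub>M std_exponential)"
            by (simp add: case_prod_unfold)
        qed
      qed
      finally show ?thesis by simp
    qed
    have ms: "(\<lambda>x. order_stat i n x) \<in> borel_measurable ?M" if "1 \<le> i" "i \<le> n" for i
      by (rule order_stat_measurable[where f = "\<lambda>j x. x j", OF exp_product_component]) (use that in auto)
    have mos [measurable]: "(\<lambda>x. order_stat (n - i + 1) n x) \<in> borel_measurable ?M" if "i \<in> {1..k}" for i
      using that k by (intro ms) auto
    have mok [measurable]: "(\<lambda>x. order_stat (n - k) n x) \<in> borel_measurable ?M"
      using k by (intro ms) auto
    have "T \<phi> = (\<integral>x. (\<Sum>(r, S)\<in>?A. \<Prod>i\<in>{1..n} - {r}. w S i (x i) (x r)) \<partial>?M)"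
      unfolding T_def
    proof (rule integral_cong_AE)
      show "AE x in ?M. (\<Prod>i=1..k. \<phi> (order_stat (n - i + 1) n x - order_stat (n - k) n x)) =
          (\<Sum>(r, S)\<in>?A. \<Prod>i\<in>{1..n} - {r}. w S i (x i) (x r))"
        using AE_exp_product_inj[of n]
      proof eventually_elim
        case (elim x)
        show ?case unfolding w_def by (rule top_products_partition[OF elim k])
      qed
      show "(\<lambda>x. \<Sum>(r, S)\<in>?A. \<Prod>i\<in>{1..n} - {r}. w S i (x i) (x r)) \<in> borel_measurable ?M"
        using int by (intro borel_measurable_sum) auto
      show "(\<lambda>x. \<Prod>i=1..k. \<phi> (order_stat (n - i + 1) n x - order_stat (n - k) n x)) \<in> borel_measurable ?M"
        by (intro borel_measurable_prod measurable_compose[OF borel_measurable_diff that(1)] mos mok)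
    qed
    also have "\<dots> = (\<Sum>(r, S)\<in>?A. (\<integral>x. (\<Prod>i\<in>{1..n} - {r}. w S i (x i) (x r)) \<partial>?M))"
      using int unfolding case_prod_unfold by (intro Bochner_Integration.integral_sum) auto
    also have "\<dots> = (\<Sum>(r, S)\<in>?A. (\<integral>y. \<phi> y \<partial>std_exponential) ^ k * (\<integral>s. J r S s \<partial>std_exponential))"
      using term_eq by (intro sum.cong) auto
    also have "\<dots> = (\<integral>y. \<phi> y \<partial>std_exponential) ^ k * c"
      by (simp add: c_def sum_distrib_left case_prod_unfold)
    finally show ?thesis .
  qed
  have "T (\<lambda>_. 1) = 1" by (simp add: T_def M.prob_space del: One_nat_def)
  hence "c = 1" using main[of "\<lambda>_. 1"] using std_exponential.prob_space by simp
  with main[of \<phi>] bound show ?thesis by (simp add: T_def)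
qed

lemma (in prob_space) exp_product_law:
  assumes indep: "indep_vars (\<lambda>_. borel) Y {1..n}" and n: "0 < n"
    and law: "\<And>i. i \<in> {1..n} \<Longrightarrow> distr M borel (Y i) = std_exponential"
  shows "distr M (exp_product {1..n}) (\<lambda>\<omega>. \<lambda>i\<in>{1..n}. Y i \<omega>) = exp_product {1..n}"
proof -
  have rv: "random_variable borel (Y i)" if "i \<in> {1..n}" for i
    using indep that by (simp add: indep_vars_def2)
  have "distr M (exp_product {1..n}) (\<lambda>\<omega>. \<lambda>i\<in>{1..n}. Y i \<omega>) =
      distr M (PiM {1..n} (\<lambda>_. borel)) (\<lambda>\<omega>. \<lambda>i\<in>{1..n}. Y i \<omega>)"
    by (intro distr_cong sets_PiM_cong) auto
  also have "\<dots> = PiM {1..n} (\<lambda>i. distr M borel (Y i))"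
    using indep n by (subst indep_vars_iff_distr_eq_PiM'[symmetric]) (auto intro: rv)
  also have "\<dots> = exp_product {1..n}"
    by (intro PiM_cong law) auto
  finally show ?thesis .
qed

text \<open>\<open>iexp\<close> turns the sum into a product of one and the same function over the
  top excesses, the symmetric form evaluated by \<open>integral_top_product\<close>. The result is
  the characteristic function of a sum of \<open>k\<close> independent copies of
  \<open>g\<close>.\<close>

lemma (in prob_space) char_excess_sum:
  assumes indep: "indep_vars (\<lambda>_. borel) Y {1..n}"
    and law: "\<And>i. i \<in> {1..n} \<Longrightarrow> distr M borel (Y i) = std_exponential"
    and k: "k < n" and g [measurable]: "g \<in> borel_measurable borel"
  shows "char (distr M borel (\<lambda>\<omega>. excess_sum g k n (\<lambda>j. Y j \<omega>))) t = char (distr std_exponential borel g) t ^ k"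
proof -
  have rv: "random_variable borel (Y i)" if "i \<in> {1..n}" for i
    using indep that by (simp add: indep_vars_def2)
  let ?f = "\<lambda>x. iexp (t * excess_sum g k n x)"
  have em: "excess_sum g k n \<in> borel_measurable (exp_product {1..n})"
    by (rule excess_sum_measurable[where f = "\<lambda>j x. x j", OF exp_product_component]) (use k in auto)
  have mr: "(\<lambda>\<omega>. \<lambda>i\<in>{1..n}. Y i \<omega>) \<in> measurable M (exp_product {1..n})"
    by (intro measurable_restrict) (use rv in \<open>simp cong: measurable_cong_sets\<close>)
  have "char (distr M borel (\<lambda>\<omega>. excess_sum g k n (\<lambda>j. Y j \<omega>))) t =
      (CLINT \<omega>|M. ?f (\<lambda>j. Y j \<omega>))"
    unfolding char_def
    by (subst integral_distr) (use excess_sum_measurable[OF rv k g] in auto)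
  also have "\<dots> = (CLINT \<omega>|M. ?f (\<lambda>i\<in>{1..n}. Y i \<omega>))"
    by (intro Bochner_Integration.integral_cong refl arg_cong[where f = "\<lambda>u. iexp (t * u)"])
       (auto simp: excess_sum_def intro!: sum.cong arg_cong[where f = g] arg_cong2[where f = minus] order_stat_cong)
  also have "\<dots> = (CLINT x|distr M (exp_product {1..n}) (\<lambda>\<omega>. \<lambda>i\<in>{1..n}. Y i \<omega>). ?f x)"
    using em by (subst integral_distr[OF mr]) auto
  also have "\<dots> = (CLINT x|exp_product {1..n}. ?f x)"
    using k by (subst exp_product_law[OF indep _ law]) auto
  also have "\<dots> = (CLINT x|exp_product {1..n}. \<Prod>i=1..k. iexp (t * g (order_stat (n - i + 1) n x - order_stat (n - k) n x)))"
    by (simp add: excess_sum_def sum_distrib_left exp_sum)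
  also have "\<dots> = (CLINT y|std_exponential. iexp (t * g y)) ^ k"
    by (rule integral_top_product[OF _ _ k]) auto
  also have "(CLINT y|std_exponential. iexp (t * g y)) = char (distr std_exponential borel g) t"
    unfolding char_def by (subst integral_distr) auto
  finally show ?thesis .
qed

text \<open>Chebyshev's inequality, with the variance bounded by the second moment. The variance of
  the sum is built up one centred summand at a time, the cross term vanishing by
  independence.\<close>

lemma (in prob_space) indep_sum_deviation:
  fixes Y :: "'i \<Rightarrow> 'a \<Rightarrow> real" and \<mu> v :: real
  assumes I: "finite I" and indep: "indep_vars (\<lambda>_. borel) Y I"
    and sq: "\<And>i. i \<in> I \<Longrightarrow> integrable M (\<lambda>\<omega>. (Y i \<omega>)\<^sup>2)"
    and mean: "\<And>i. i \<in> I \<Longrightarrow> expectation (Y i) = \<mu>"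
    and second: "\<And>i. i \<in> I \<Longrightarrow> expectation (\<lambda>\<omega>. (Y i \<omega>)\<^sup>2) \<le> v"
    and a: "0 < a"
  shows "prob {\<omega>\<in>space M. a \<le> \<bar>(\<Sum>i\<in>I. Y i \<omega>) - card I * \<mu>\<bar>} \<le> card I * v / a\<^sup>2"
proof -
  have rv [measurable]: "random_variable borel (Y i)" if "i \<in> I" for i
    using indep that by (simp add: indep_vars_def2)
  have intY: "integrable M (Y i)" if "i \<in> I" for i
    using sq[OF that] rv[OF that] by (rule square_integrable_imp_integrable[rotated])
  define W where "W i \<omega> = Y i \<omega> - \<mu>" for i \<omega>
  have indepW: "indep_vars (\<lambda>_. borel) W I"
    unfolding W_def[abs_def] using indep by (rule indep_vars_compose2) auto
  have sqW_eq: "(W i \<omega>)\<^sup>2 = (Y i \<omega>)\<^sup>2 - 2 * \<mu> * Y i \<omega> + \<mu>\<^sup>2" for i \<omega>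
    by (simp add: W_def power2_diff)
  have sqW: "integrable M (\<lambda>\<omega>. (W i \<omega>)\<^sup>2)" if "i \<in> I" for i
    unfolding sqW_eq using sq[OF that] intY[OF that] by (intro Bochner_Integration.integrable_add Bochner_Integration.integrable_diff) auto
  have intW: "integrable M (W i)" if "i \<in> I" for i
    unfolding W_def[abs_def] using intY[OF that] by simp
  have meanW: "expectation (W i) = 0" if "i \<in> I" for i
    unfolding W_def[abs_def] using intY[OF that] mean[OF that] by (simp add: prob_space)
  have secW: "expectation (\<lambda>\<omega>. (W i \<omega>)\<^sup>2) \<le> v" if "i \<in> I" for i
  proof -
    have "expectation (\<lambda>\<omega>. (W i \<omega>)\<^sup>2) = expectation (\<lambda>\<omega>. (Y i \<omega>)\<^sup>2) - \<mu>\<^sup>2"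
      unfolding sqW_eq using sq[OF that] intY[OF that] mean[OF that] by (simp add: prob_space power2_eq_square)
    also have "\<dots> \<le> v" using second[OF that] zero_le_power2[of \<mu>] by linarith
    finally show ?thesis .
  qed
  have "integrable M (\<lambda>\<omega>. (\<Sum>i\<in>J. W i \<omega>)\<^sup>2) \<and> expectation (\<lambda>\<omega>. (\<Sum>i\<in>J. W i \<omega>)\<^sup>2) \<le> card J * v"
    if "finite J" "J \<subseteq> I" for J
    using that
  proof (induction J rule: finite_induct)
    case (insert i J)
    have iJ: "i \<in> I" "J \<subseteq> I" using insert by auto
    have rvS [measurable]: "(\<lambda>\<omega>. \<Sum>j\<in>J. W j \<omega>) \<in> borel_measurable M"
      using intW iJ by (intro borel_measurable_sum) auto
    have intS: "integrable M (\<lambda>\<omega>. \<Sum>j\<in>J. W j \<omega>)"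
      using intW iJ by (intro Bochner_Integration.integrable_sum) auto
    have ind: "indep_var borel (W i) borel (\<lambda>\<omega>. \<Sum>j\<in>J. W j \<omega>)"
      using insert by (intro indep_vars_sum indep_vars_subset[OF indepW]) auto
    have prod: "integrable M (\<lambda>\<omega>. W i \<omega> * (\<Sum>j\<in>J. W j \<omega>))"
      by (rule indep_var_integrable[OF ind intW[OF iJ(1)] intS])
    have prod0: "expectation (\<lambda>\<omega>. W i \<omega> * (\<Sum>j\<in>J. W j \<omega>)) = 0"
      using indep_var_lebesgue_integral[OF ind intW[OF iJ(1)] intS] meanW[OF iJ(1)] by simp
    have eq: "(\<Sum>j\<in>insert i J. W j \<omega>)\<^sup>2 = (W i \<omega>)\<^sup>2 + 2 * (W i \<omega> * (\<Sum>j\<in>J. W j \<omega>)) + (\<Sum>j\<in>J. W j \<omega>)\<^sup>2" for \<omega>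
      using insert by (simp add: power2_sum)
    have IH: "integrable M (\<lambda>\<omega>. (\<Sum>j\<in>J. W j \<omega>)\<^sup>2)" "expectation (\<lambda>\<omega>. (\<Sum>j\<in>J. W j \<omega>)\<^sup>2) \<le> card J * v"
      using insert iJ by auto
    show ?case
    proof
      show "integrable M (\<lambda>\<omega>. (\<Sum>j\<in>insert i J. W j \<omega>)\<^sup>2)"
        unfolding eq using sqW[OF iJ(1)] prod IH(1) by (intro Bochner_Integration.integrable_add integrable_mult_right) auto
      have "expectation (\<lambda>\<omega>. (\<Sum>j\<in>insert i J. W j \<omega>)\<^sup>2) = expectation (\<lambda>\<omega>. (W i \<omega>)\<^sup>2) +
          2 * expectation (\<lambda>\<omega>. W i \<omega> * (\<Sum>j\<in>J. W j \<omega>)) + expectation (\<lambda>\<omega>. (\<Sum>j\<in>J. W j \<omega>)\<^sup>2)"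
        unfolding eq using sqW[OF iJ(1)] prod IH(1) by simp
      also have "\<dots> \<le> card (insert i J) * v"
        using secW[OF iJ(1)] prod0 IH(2) insert by (simp add: algebra_simps)
      finally show "expectation (\<lambda>\<omega>. (\<Sum>j\<in>insert i J. W j \<omega>)\<^sup>2) \<le> card (insert i J) * v" .
    qed
  qed simp
  from this[OF I] have S: "integrable M (\<lambda>\<omega>. (\<Sum>i\<in>I. W i \<omega>)\<^sup>2)"
    "expectation (\<lambda>\<omega>. (\<Sum>i\<in>I. W i \<omega>)\<^sup>2) \<le> card I * v" by auto
  have rvS: "(\<lambda>\<omega>. \<Sum>j\<in>I. W j \<omega>) \<in> borel_measurable M"
    using intW by (intro borel_measurable_sum) auto
  have m0: "expectation (\<lambda>\<omega>. \<Sum>i\<in>I. W i \<omega>) = 0"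
    using intW meanW by (subst Bochner_Integration.integral_sum) auto
  have "prob {\<omega>\<in>space M. a \<le> \<bar>(\<Sum>i\<in>I. W i \<omega>) - 0\<bar>} \<le> expectation (\<lambda>\<omega>. ((\<Sum>i\<in>I. W i \<omega>) - 0)\<^sup>2) / a\<^sup>2"
    using Chebyshev_inequality[OF rvS S(1) a] unfolding m0 .
  also have "\<dots> \<le> card I * v / a\<^sup>2" using S(2) by (intro divide_right_mono) auto
  finally show ?thesis by (simp add: W_def sum_subtractf)
qed

text \<open>By uniqueness of characteristic functions, the excess sum has the law of the sum of
  \<open>g\<close> over the first \<open>k\<close> variables, to which the deviation bound for
  independent sums applies.\<close>

lemma (in prob_space) excess_sum_deviation:
  assumes indep: "indep_vars (\<lambda>_. borel) Y {1..n}"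
    and law: "\<And>i. i \<in> {1..n} \<Longrightarrow> distr M borel (Y i) = std_exponential"
    and k: "k < n" and g [measurable]: "g \<in> borel_measurable borel"
    and sq: "integrable std_exponential (\<lambda>y. (g y)\<^sup>2)" and a: "0 < a"
  shows "prob {\<omega>\<in>space M. a \<le> \<bar>excess_sum g k n (\<lambda>j. Y j \<omega>) - k * (\<integral>y. g y \<partial>std_exponential)\<bar>}
    \<le> k * (\<integral>y. (g y)\<^sup>2 \<partial>std_exponential) / a\<^sup>2"
proof -
  have rv [measurable]: "random_variable borel (Y i)" if "i \<in> {1..n}" for i
    using indep that by (simp add: indep_vars_def2)
  have em [measurable]: "(\<lambda>\<omega>. excess_sum g k n (\<lambda>j. Y j \<omega>)) \<in> borel_measurable M"
    by (rule excess_sum_measurable[OF rv k g])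
  have sub: "{1..k} \<subseteq> {1..n}" using k by auto
  have rvg: "random_variable borel (\<lambda>\<omega>. g (Y i \<omega>))" if "i \<in> {1..k}" for i
    using rv[of i] that sub by auto
  have sm [measurable]: "(\<lambda>\<omega>. \<Sum>i\<in>{1..k}. g (Y i \<omega>)) \<in> borel_measurable M"
    by (intro borel_measurable_sum rvg)
  have indepg: "indep_vars (\<lambda>_. borel) (\<lambda>i \<omega>. g (Y i \<omega>)) {1..k}"
    by (rule indep_vars_compose2[OF indep_vars_subset[OF indep sub]]) auto
  have gl: "distr M borel (\<lambda>\<omega>. g (Y i \<omega>)) = distr std_exponential borel g" if "i \<in> {1..k}" for i
    unfolding law[of i, symmetric, OF subsetD[OF sub that]]
    using rv[of i] that sub by (subst distr_distr) (auto simp: comp_def)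
  have trans: "integrable std_exponential h \<longleftrightarrow> integrable M (\<lambda>\<omega>. h (Y i \<omega>))"
    "(\<integral>y. h y \<partial>std_exponential) = expectation (\<lambda>\<omega>. h (Y i \<omega>))"
    if "i \<in> {1..k}" and [measurable]: "h \<in> borel_measurable borel" for i and h :: "real \<Rightarrow> real"
    unfolding law[of i, symmetric, OF subsetD[OF sub that(1)]]
    using rv[of i] that(1) sub by (simp_all add: integrable_distr_eq integral_distr)
  have eq: "distr M borel (\<lambda>\<omega>. excess_sum g k n (\<lambda>j. Y j \<omega>)) = distr M borel (\<lambda>\<omega>. \<Sum>i\<in>{1..k}. g (Y i \<omega>))"
  proof (rule Levy_uniqueness)
    show "char (distr M borel (\<lambda>\<omega>. excess_sum g k n (\<lambda>j. Y j \<omega>))) = char (distr M borel (\<lambda>\<omega>. \<Sum>i\<in>{1..k}. g (Y i \<omega>)))"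
    proof (rule ext)
      fix t
      have "char (distr M borel (\<lambda>\<omega>. \<Sum>i\<in>{1..k}. g (Y i \<omega>))) t = (\<Prod>i\<in>{1..k}. char (distr std_exponential borel g) t)"
        unfolding char_distr_sum[OF indepg] by (intro prod.cong refl) (simp only: gl)
      thus "char (distr M borel (\<lambda>\<omega>. excess_sum g k n (\<lambda>j. Y j \<omega>))) t = char (distr M borel (\<lambda>\<omega>. \<Sum>i\<in>{1..k}. g (Y i \<omega>))) t"
        by (simp only: char_excess_sum[OF indep law k g])(simp del: One_nat_def)
    qed
  qed (rule real_distribution_distr[OF em] real_distribution_distr[OF sm])+
  let ?B = "{s. a \<le> \<bar>s - k * (\<integral>y. g y \<partial>std_exponential)\<bar>}"
  have B: "?B \<in> sets borel" by measurable
  have "prob {\<omega>\<in>space M. excess_sum g k n (\<lambda>j. Y j \<omega>) \<in> ?B} = measure (distr M borel (\<lambda>\<omega>. excess_sum g k n (\<lambda>j. Y j \<omega>))) ?B"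
    by (subst measure_distr[OF em B]) (auto intro!: arg_cong[where f = prob])
  also have "\<dots> = prob {\<omega>\<in>space M. (\<Sum>i\<in>{1..k}. g (Y i \<omega>)) \<in> ?B}"
    unfolding eq by (subst measure_distr[OF sm B]) (auto intro!: arg_cong[where f = prob])
  also have "\<dots> \<le> card {1..k} * (\<integral>y. (g y)\<^sup>2 \<partial>std_exponential) / a\<^sup>2"
    using indep_sum_deviation[OF _ indepg _ _ _ a, where \<mu> = "\<integral>y. g y \<partial>std_exponential" and v = "\<integral>y. (g y)\<^sup>2 \<partial>std_exponential"]
      sq trans[of _ "\<lambda>y. (g y)\<^sup>2"] trans(2)[of _ g] by simp
  finally show ?thesis by simp
qed

text \<open>After taking square roots this is \<open>a \<le> 2 * sinh (a / 2)\<close>. The left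
  side, divided by \<open>k\<close>, is the Chebyshev bound that arises for the threshold.\<close>

lemma exp_ratio_bound:
  fixes a :: real
  assumes "0 < a"
  shows "exp (- a) / (1 - exp (- a))\<^sup>2 \<le> 1 / a\<^sup>2"
proof -
  have "a \<le> exp (a / 2) - exp (- a / 2)"
  proof -
    have "a / 2 \<le> (exp (a / 2) - inverse (exp (a / 2))) / 2" using assms by (intro real_le_x_sinh) simp
    thus ?thesis by (simp add: exp_minus)
  qed
  hence "a * exp (- a / 2) \<le> (exp (a / 2) - exp (- a / 2)) * exp (- a / 2)"
    by (intro mult_right_mono) auto
  also have "\<dots> = 1 - exp (- a)" by (simp add: left_diff_distrib exp_add[symmetric])
  finally have "(a * exp (- a / 2))\<^sup>2 \<le> (1 - exp (- a))\<^sup>2"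
    using assms by (intro power_mono) auto
  moreover have "(a * exp (- a / 2))\<^sup>2 = a\<^sup>2 * exp (- a)"
    by (simp add: power_mult_distrib exp_double[symmetric])
  moreover have "0 < (1 - exp (- a))\<^sup>2" using assms by simp
  ultimately show ?thesis using assms by (simp add: divide_simps mult.commute)
qed

lemma (in prob_space) exponential_count_deviation:
  fixes Y :: "nat \<Rightarrow> 'a \<Rightarrow> real" and n :: nat
  assumes indep: "indep_vars (\<lambda>_. borel) Y {1..n}"
    and law: "\<And>i. i \<in> {1..n} \<Longrightarrow> distr M borel (Y i) = std_exponential"
    and t: "0 \<le> t" and a: "0 < a"
  shows "prob {\<omega>\<in>space M. a \<le> \<bar>real (card {j\<in>{1..n}. t < Y j \<omega>}) - n * exp (- t)\<bar>} \<le> n * exp (- t) / a\<^sup>2"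
proof -
  have rv [measurable]: "random_variable borel (Y i)" if "i \<in> {1..n}" for i
    using indep that by (simp add: indep_vars_def2)
  let ?g = "indicator {t<..} :: real \<Rightarrow> real"
  have indepg: "indep_vars (\<lambda>_. borel) (\<lambda>i \<omega>. ?g (Y i \<omega>)) {1..n}"
    by (rule indep_vars_compose2[OF indep]) auto
  \<comment> \<open>An indicator equals its square, so \<open>exp (- t)\<close> serves both as mean
    and as second moment.\<close>
  have sq: "(?g y)\<^sup>2 = ?g y" for y by (simp add: indicator_def)
  have E: "expectation (\<lambda>\<omega>. ?g (Y i \<omega>)) = exp (- t)" if i: "i \<in> {1..n}" for i
  proof -
    have "expectation (\<lambda>\<omega>. ?g (Y i \<omega>)) = (\<integral>y. ?g y \<partial>std_exponential)"
      unfolding law[OF i, symmetric] using rv[OF i] by (subst integral_distr) auto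
    also have "\<dots> = exp (- t)" using std_exponential_measure_greaterThan[OF t] by simp
    finally show ?thesis .
  qed
  have int: "integrable M (\<lambda>\<omega>. ?g (Y i \<omega>))" if i: "i \<in> {1..n}" for i
    using rv[OF i] by (intro integrable_const_bound[where B = 1]) (auto simp: indicator_def)
  have "(\<Sum>i\<in>{1..n}. ?g (Y i \<omega>)) = card {j\<in>{1..n}. t < Y j \<omega>}" for \<omega>
    by (simp add: indicator_def of_bool_def sum.inter_filter[symmetric] del: One_nat_def)
  with indep_sum_deviation[OF _ indepg _ _ _ a, where \<mu> = "exp (- t)" and v = "exp (- t)"] E int
  show ?thesis by (simp add: sq)
qed

text \<open>If the threshold exceeds \<open>L + a\<close>, more than \<open>k\<close> observations
  do, although only \<open>k * exp (- a)\<close> are expected to; the lower side is analogous. Each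
  side costs \<open>1 / (k * a\<^sup>2)\<close>, whence the factor 2.\<close>

lemma (in prob_space) order_stat_deviation:
  assumes indep: "indep_vars (\<lambda>_. borel) Y {1..n}"
    and law: "\<And>i. i \<in> {1..n} \<Longrightarrow> distr M borel (Y i) = std_exponential"
    and k: "1 \<le> k" "k < n" and a: "0 < a"
  shows "prob {\<omega>\<in>space M. a < \<bar>order_stat (n - k) n (\<lambda>j. Y j \<omega>) - ln (real n / real k)\<bar>} \<le> 2 / (k * a\<^sup>2)"
proof -
  define Z where "Z \<omega> = order_stat (n - k) n (\<lambda>j. Y j \<omega>)" for \<omega>
  define C where "C t \<omega> = card {j\<in>{1..n}. t < Y j \<omega>}" for t \<omega>
  define L where "L = ln (real n / real k)"
  have L: "0 < L" using k by (simp add: L_def)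
  \<comment> \<open>The expected number of observations above \<open>L + b\<close>: the level
    \<open>L\<close> is the one for which \<open>k\<close> exceedances are expected.\<close>
  have nL: "n * exp (- (L + b)) = k * exp (- b)" for b
    using k by (simp add: L_def exp_diff exp_minus field_simps)
  have rv [measurable]: "random_variable borel (Y i)" if "i \<in> {1..n}" for i
    using indep that by (simp add: indep_vars_def2)
  have Cm [measurable]: "(\<lambda>\<omega>. real (C t \<omega>)) \<in> borel_measurable M" for t
  proof -
    have "real (C t \<omega>) = (\<Sum>i\<in>{1..n}. of_bool (t < Y i \<omega>))" for \<omega>
      by (simp add: C_def of_bool_def sum.inter_filter[symmetric] del: One_nat_def)
    hence eq: "(\<lambda>\<omega>. real (C t \<omega>)) = (\<lambda>\<omega>. \<Sum>i\<in>{1..n}. of_bool (t < Y i \<omega>))" by blast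
    show ?thesis unfolding eq by measurable
  qed
  have Zm [measurable]: "Z \<in> borel_measurable M"
    unfolding Z_def[abs_def] using k by (intro order_stat_measurable rv) auto
  have Zgt: "t < Z \<omega> \<longleftrightarrow> k < C t \<omega>" for t \<omega>
    unfolding Z_def C_def by (rule less_order_stat_iff[OF k(2)])
  have frac: "k * x / (k * y)\<^sup>2 = x / y\<^sup>2 / k" for x y :: real
    using k by (simp add: power2_eq_square)
  have ea: "0 < 1 - exp (- a)" "0 < exp a - 1" using a by auto
  have up: "prob {\<omega>\<in>space M. L + a < Z \<omega>} \<le> 1 / (k * a\<^sup>2)"
  proof -
    have "prob {\<omega>\<in>space M. L + a < Z \<omega>} \<le>
        prob {\<omega>\<in>space M. k * (1 - exp (- a)) \<le> \<bar>real (C (L + a) \<omega>) - n * exp (- (L + a))\<bar>}"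
      unfolding nL by (intro finite_measure_mono) (auto simp: Zgt right_diff_distrib)
    also have "\<dots> \<le> n * exp (- (L + a)) / (k * (1 - exp (- a)))\<^sup>2"
      unfolding C_def using k L a ea by (intro exponential_count_deviation[OF indep law]) auto
    also have "\<dots> = (exp (- a) / (1 - exp (- a))\<^sup>2) / k"
      unfolding nL by (rule frac)
    also have "\<dots> \<le> (1 / a\<^sup>2) / k" using exp_ratio_bound[OF a] by (intro divide_right_mono) auto
    finally show ?thesis by (simp add: mult.commute)
  qed
  have down: "prob {\<omega>\<in>space M. Z \<omega> < L - a} \<le> 1 / (k * a\<^sup>2)"
  proof (cases "0 \<le> L - a")
    case True
    have "prob {\<omega>\<in>space M. Z \<omega> < L - a} \<le>
        prob {\<omega>\<in>space M. k * (exp a - 1) \<le> \<bar>real (C (L - a) \<omega>) - n * exp (- (L - a))\<bar>}"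
      using nL[of "- a"] Zgt[of "L - a"]
      by (intro finite_measure_mono) (auto simp: right_diff_distrib not_less dest!: less_imp_le leD)
    also have "\<dots> \<le> n * exp (- (L - a)) / (k * (exp a - 1))\<^sup>2"
      unfolding C_def using k True ea by (intro exponential_count_deviation[OF indep law]) auto
    also have "\<dots> = (exp a / (exp a - 1)\<^sup>2) / k"
      using nL[of "- a"] by (simp add: frac)
    \<comment> \<open>Dividing numerator and denominator by \<open>exp (2 * a)\<close> leads back to
      the quantity estimated for the upper side.\<close>
    also have "exp a / (exp a - 1)\<^sup>2 = exp (- a) / (1 - exp (- a))\<^sup>2"
    proof -
      have "(1 - exp (- a))\<^sup>2 * exp a * exp a = ((1 - exp (- a)) * exp a)\<^sup>2" by (simp add: power2_eq_square)
      also have "(1 - exp (- a)) * exp a = exp a - 1" by (simp add: left_diff_distrib exp_minus)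
      finally show ?thesis using ea by (simp add: exp_minus divide_simps) 
    qed
    also have "\<dots> / k \<le> (1 / a\<^sup>2) / k" using exp_ratio_bound[OF a] by (intro divide_right_mono) auto
    finally show ?thesis by (simp add: mult.commute)
  next
    \<comment> \<open>At a negative level the formula \<open>exp (- t)\<close> for the tail fails,
      but exponential variables are almost surely positive, so the event is null.\<close>
    case False
    have "AE \<omega> in M. \<forall>i\<in>{1..n}. 0 < Y i \<omega>"
    proof (intro AE_ball_countable[THEN iffD2] ballI)
      fix i assume i: "i \<in> {1..n}"
      have "AE y in distr M borel (Y i). 0 < y" unfolding law[OF i] by (rule AE_std_exponential_pos)
      thus "AE \<omega> in M. 0 < Y i \<omega>" using rv[OF i] by (subst (asm) AE_distr_iff) auto
    qed simp
    hence "AE \<omega> in M. \<omega> \<notin> {\<omega>\<in>space M. Z \<omega> < L - a}"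
    proof eventually_elim
      case (elim \<omega>)
      have "Z \<omega> \<in> (\<lambda>j. Y j \<omega>) ` {1..n}" unfolding Z_def by (rule order_stat_mem) (use k in auto)
      with elim False show ?case by auto
    qed
    hence "prob {\<omega>\<in>space M. Z \<omega> < L - a} = 0"
      by (subst prob_eq_0) auto
    thus ?thesis by simp
  qed
  have "prob {\<omega>\<in>space M. a < \<bar>Z \<omega> - L\<bar>} \<le> prob ({\<omega>\<in>space M. L + a < Z \<omega>} \<union> {\<omega>\<in>space M. Z \<omega> < L - a})"
    by (intro finite_measure_mono) auto
  also have "\<dots> \<le> prob {\<omega>\<in>space M. L + a < Z \<omega>} + prob {\<omega>\<in>space M. Z \<omega> < L - a}"
    by (rule measure_Un_le) auto
  also have "\<dots> \<le> 1 / (k * a\<^sup>2) + 1 / (k * a\<^sup>2)" by (intro add_mono up down)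
  finally show ?thesis by (simp add: Z_def L_def)
qed

section \<open>Convergence in probability\<close>

context prob_space
begin

text \<open>Convergence in probability is rendered as convergence along this filter. Bad events are only
  required to be contained in measurable ones, so no measurability side conditions arise.\<close>

definition whp :: "(nat \<times> 'a) filter" where
  "whp = Abs_filter (\<lambda>Q. \<forall>\<epsilon>>0. \<forall>\<^sub>F n in sequentially. \<exists>B\<in>events. prob B < \<epsilon> \<and> (\<forall>x\<in>space M - B. Q (n, x)))"

lemma eventually_whp:
  "eventually Q whp \<longleftrightarrow> (\<forall>\<epsilon>>0. \<forall>\<^sub>F n in sequentially. \<exists>B\<in>events. prob B < \<epsilon> \<and> (\<forall>x\<in>space M - B. Q (n, x)))"
  unfolding whp_def
proof (rule eventually_Abs_filter, rule is_filter.intro)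
  show "\<forall>\<epsilon>>0. \<forall>\<^sub>F n in sequentially. \<exists>B\<in>events. prob B < \<epsilon> \<and> (\<forall>x\<in>space M - B. True)"
    by (intro allI impI always_eventually bexI[of _ "{}"]) auto
next
  fix Q R :: "nat \<times> 'a \<Rightarrow> bool"
  assume Q: "\<forall>\<epsilon>>0. \<forall>\<^sub>F n in sequentially. \<exists>B\<in>events. prob B < \<epsilon> \<and> (\<forall>x\<in>space M - B. Q (n, x))"
    and R: "\<forall>\<epsilon>>0. \<forall>\<^sub>F n in sequentially. \<exists>B\<in>events. prob B < \<epsilon> \<and> (\<forall>x\<in>space M - B. R (n, x))"
  show "\<forall>\<epsilon>>0. \<forall>\<^sub>F n in sequentially. \<exists>B\<in>events. prob B < \<epsilon> \<and> (\<forall>x\<in>space M - B. Q (n, x) \<and> R (n, x))"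
  proof (intro allI impI)
    fix \<epsilon> :: real assume "0 < \<epsilon>"
    hence "0 < \<epsilon> / 2" by simp
    with Q R have "\<forall>\<^sub>F n in sequentially. \<exists>B\<in>events. prob B < \<epsilon> / 2 \<and> (\<forall>x\<in>space M - B. Q (n, x))"
      "\<forall>\<^sub>F n in sequentially. \<exists>B\<in>events. prob B < \<epsilon> / 2 \<and> (\<forall>x\<in>space M - B. R (n, x))" by blast+
    thus "\<forall>\<^sub>F n in sequentially. \<exists>B\<in>events. prob B < \<epsilon> \<and> (\<forall>x\<in>space M - B. Q (n, x) \<and> R (n, x))"
    proof eventually_elim
      case (elim n)
      then obtain B C where BC: "B \<in> events" "prob B < \<epsilon> / 2" "\<forall>x\<in>space M - B. Q (n, x)"
        "C \<in> events" "prob C < \<epsilon> / 2" "\<forall>x\<in>space M - C. R (n, x)" by blast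
      have "prob (B \<union> C) < \<epsilon>" using measure_Un_le[OF BC(1,4)] BC by linarith
      with BC show ?case by (intro bexI[of _ "B \<union> C"]) auto
    qed
  qed
next
  fix Q R :: "nat \<times> 'a \<Rightarrow> bool"
  assume QR: "\<forall>z. Q z \<longrightarrow> R z"
    and Q: "\<forall>\<epsilon>>0. \<forall>\<^sub>F n in sequentially. \<exists>B\<in>events. prob B < \<epsilon> \<and> (\<forall>x\<in>space M - B. Q (n, x))"
  show "\<forall>\<epsilon>>0. \<forall>\<^sub>F n in sequentially. \<exists>B\<in>events. prob B < \<epsilon> \<and> (\<forall>x\<in>space M - B. R (n, x))"
  proof (intro allI impI)
    fix \<epsilon> :: real assume "0 < \<epsilon>"
    with Q have "\<forall>\<^sub>F n in sequentially. \<exists>B\<in>events. prob B < \<epsilon> \<and> (\<forall>x\<in>space M - B. Q (n, x))" by blast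
    thus "\<forall>\<^sub>F n in sequentially. \<exists>B\<in>events. prob B < \<epsilon> \<and> (\<forall>x\<in>space M - B. R (n, x))"
      by eventually_elim (use QR in blast)
  qed
qed

lemma filterlim_fst_whp: "filterlim fst sequentially whp"
  unfolding filterlim_iff eventually_whp
proof (intro allI impI)
  fix Q :: "nat \<Rightarrow> bool" and \<epsilon> :: real
  assume "eventually Q sequentially" "0 < \<epsilon>"
  thus "\<forall>\<^sub>F n in sequentially. \<exists>B\<in>events. prob B < \<epsilon> \<and> (\<forall>x\<in>space M - B. Q (fst (n, x)))"
    by (auto elim!: eventually_mono intro!: bexI[of _ "{}"])
qed

lemma eventually_fst_whp: "eventually Q sequentially \<Longrightarrow> eventually (\<lambda>z. Q (fst z)) whp"
  by (rule eventually_compose_filterlim[OF _ filterlim_fst_whp])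

lemma tendsto_fst_whp: "(f \<longlongrightarrow> c) sequentially \<Longrightarrow> ((\<lambda>z. f (fst z)) \<longlongrightarrow> c) whp"
  by (rule filterlim_compose[OF _ filterlim_fst_whp])

lemma at_top_fst_whp: "filterlim f at_top sequentially \<Longrightarrow> filterlim (\<lambda>z. f (fst z)) at_top whp"
  by (rule filterlim_compose[OF _ filterlim_fst_whp])

lemma eventually_whp_AE:
  assumes "\<And>n. AE x in M. Q n x"
  shows "eventually (\<lambda>z. Q (fst z) (snd z)) whp"
  unfolding eventually_whp
proof (intro allI impI always_eventually)
  fix \<epsilon> :: real and n assume "0 < \<epsilon>"
  obtain B where "{x\<in>space M. \<not> Q n x} \<subseteq> B" "emeasure M B = 0" "B \<in> events"
    using AE_E[OF assms[of n]] by auto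
  with \<open>0 < \<epsilon>\<close> show "\<exists>B\<in>events. prob B < \<epsilon> \<and> (\<forall>x\<in>space M - B. Q (fst (n, x)) (snd (n, x)))"
    by (intro bexI[of _ B]) (auto simp: measure_def)
qed

section \<open>Characteristic functions and Slutsky's lemma\<close>

lemma norm_iexp_diff_le: "norm (iexp a - iexp b) \<le> \<bar>a - b\<bar>"
proof -
  have "iexp a - iexp b = iexp b * (iexp (a - b) - 1)"
    by (simp add: right_diff_distrib exp_add[symmetric] algebra_simps)
  hence "norm (iexp a - iexp b) = norm (iexp (a - b) - 1)" by (simp add: norm_mult)
  also have "\<dots> \<le> \<bar>a - b\<bar>" using iexp_approx1[of "a - b" 0] by simp
  finally show ?thesis .
qed

lemma char_normal:
  assumes "0 < \<sigma>"
  shows "char (density lborel (normal_density \<mu> \<sigma>)) t = iexp (t * \<mu>) * char std_normal_distribution (t * \<sigma>)"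
proof -
  interpret N: prob_space std_normal_distribution by (rule prob_space_normal_density) simp
  have "distributed std_normal_distribution lborel (\<lambda>x. x) std_normal_density"
    by (auto simp: distributed_def distr_id2)
  from N.normal_density_affine[OF this, of \<sigma> \<mu>] assms
  have "distributed std_normal_distribution lborel (\<lambda>x. \<mu> + \<sigma> * x) (normal_density \<mu> \<sigma>)" by simp
  hence "density lborel (normal_density \<mu> \<sigma>) = distr std_normal_distribution lborel (\<lambda>x. \<mu> + \<sigma> * x)"
    by (simp add: distributed_def)
  also have "char \<dots> t = (CLINT x|std_normal_distribution. iexp (t * \<mu>) * iexp (t * \<sigma> * x))"
    unfolding char_def by (subst integral_distr) (auto simp: algebra_simps exp_add)
  also have "\<dots> = iexp (t * \<mu>) * char std_normal_distribution (t * \<sigma>)"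
    by (simp add: char_def)
  finally show ?thesis .
qed

text \<open>The characteristic function of \<open>W n\<close> is compared with that of
  \<open>\<mu> + \<sigma> * G n\<close>, whose limit is known. Off an exceptional set the integrands
  differ by at most \<open>\<bar>t\<bar> * \<delta>\<close>, on it by at most 2; continuity of
  characteristic functions then gives weak convergence.\<close>

theorem slutsky_normal:
  assumes G: "weak_conv_m (\<lambda>n. distr M borel (G n)) std_normal_distribution" and \<sigma>: "0 < \<sigma>"
    and rvG [measurable]: "\<And>n. G n \<in> borel_measurable M" and rvW [measurable]: "\<And>n. W n \<in> borel_measurable M"
    and R: "((\<lambda>(n, x). W n x - \<sigma> * G n x) \<longlongrightarrow> \<mu>) whp"
  shows "weak_conv_m (\<lambda>n. distr M borel (W n)) (density lborel (normal_density \<mu> \<sigma>))"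
proof (rule levy_continuity)
  show "real_distribution (distr M borel (W n))" for n by (rule real_distribution_distr) simp
  interpret N: prob_space "density lborel (normal_density \<mu> \<sigma>)" by (rule prob_space_normal_density[OF \<sigma>])
  show "real_distribution (density lborel (normal_density \<mu> \<sigma>))" by unfold_locales auto
  fix t
  have "(\<lambda>n. char (distr M borel (G n)) (t * \<sigma>)) \<longlonglongrightarrow> char std_normal_distribution (t * \<sigma>)"
    by (rule levy_continuity1[OF _ real_dist_normal_dist G]) (rule real_distribution_distr, simp)
  hence lim1: "(\<lambda>n. iexp (t * \<mu>) * char (distr M borel (G n)) (t * \<sigma>)) \<longlonglongrightarrow> char (density lborel (normal_density \<mu> \<sigma>)) t"
    unfolding char_normal[OF \<sigma>] by (intro tendsto_mult tendsto_const)
  have lim2: "(\<lambda>n. char (distr M borel (W n)) t - iexp (t * \<mu>) * char (distr M borel (G n)) (t * \<sigma>)) \<longlonglongrightarrow> 0"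
  proof (rule tendstoI)
    fix e :: real assume e: "0 < e"
    \<comment> \<open>Chosen so that the total error, at most
      \<open>(\<bar>t\<bar> + 2) * \<delta>\<close>, equals \<open>e / 2\<close>.\<close>
    define \<delta> where "\<delta> = e / (2 * (\<bar>t\<bar> + 2))"
    have \<delta>: "0 < \<delta>" using e by (simp add: \<delta>_def)
    have "eventually (\<lambda>z. dist ((\<lambda>(n, x). W n x - \<sigma> * G n x) z) \<mu> < \<delta>) whp"
      using R \<delta> by (rule tendstoD)
    hence "\<forall>\<^sub>F n in sequentially. \<exists>B\<in>events. prob B < \<delta> \<and> (\<forall>x\<in>space M - B. \<bar>W n x - \<sigma> * G n x - \<mu>\<bar> < \<delta>)"
      using \<delta> unfolding eventually_whp by (auto simp: dist_norm)
    thus "\<forall>\<^sub>F n in sequentially. dist (char (distr M borel (W n)) t - iexp (t * \<mu>) * char (distr M borel (G n)) (t * \<sigma>)) 0 < e"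
    proof eventually_elim
      case (elim n)
      then obtain B where B [measurable]: "B \<in> events" and pB: "prob B < \<delta>"
        and Bx: "\<And>x. x \<in> space M - B \<Longrightarrow> \<bar>W n x - \<sigma> * G n x - \<mu>\<bar> < \<delta>" by blast
      have i1: "integrable M (\<lambda>x. iexp (t * W n x))"
        by (rule integrable_const_bound[where B = 1]) auto
      have i2: "integrable M (\<lambda>x. iexp (t * (\<mu> + \<sigma> * G n x)))"
        by (rule integrable_const_bound[where B = 1]) auto
      have "iexp (t * \<mu>) * char (distr M borel (G n)) (t * \<sigma>) = (CLINT x|M. iexp (t * \<mu>) * iexp (t * \<sigma> * G n x))"
        unfolding char_def by (subst integral_distr) auto
      also have "\<dots> = (CLINT x|M. iexp (t * (\<mu> + \<sigma> * G n x)))"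
        by (intro Bochner_Integration.integral_cong) (auto simp: exp_add[symmetric] algebra_simps)
      finally have "char (distr M borel (W n)) t - iexp (t * \<mu>) * char (distr M borel (G n)) (t * \<sigma>) =
          (CLINT x|M. iexp (t * W n x)) - (CLINT x|M. iexp (t * (\<mu> + \<sigma> * G n x)))"
        unfolding char_def by (subst integral_distr) auto
      also have "\<dots> = (CLINT x|M. iexp (t * W n x) - iexp (t * (\<mu> + \<sigma> * G n x)))"
        using i1 i2 by (rule Bochner_Integration.integral_diff[symmetric])
      also have "norm \<dots> \<le> (\<integral>x. \<bar>t\<bar> * \<delta> + 2 * indicator B x \<partial>M)"
      proof (rule order_trans[OF integral_norm_bound integral_mono])
        show "integrable M (\<lambda>x. norm (iexp (t * W n x) - iexp (t * (\<mu> + \<sigma> * G n x))))"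
          using i1 i2 by (intro integrable_norm Bochner_Integration.integrable_diff)
        show "integrable M (\<lambda>x. \<bar>t\<bar> * \<delta> + 2 * indicator B x)"
          by (intro Bochner_Integration.integrable_add integrable_mult_right integrable_real_indicator)
             (auto simp: emeasure_eq_measure)
        fix x assume x: "x \<in> space M"
        show "norm (iexp (t * W n x) - iexp (t * (\<mu> + \<sigma> * G n x))) \<le> \<bar>t\<bar> * \<delta> + 2 * indicator B x"
        proof (cases "x \<in> B")
          case True
          have "norm (iexp (t * W n x) - iexp (t * (\<mu> + \<sigma> * G n x))) \<le> norm (iexp (t * W n x)) + norm (iexp (t * (\<mu> + \<sigma> * G n x)))"
            by (rule norm_triangle_ineq4)
          also have "\<dots> = 2" by (simp add: norm_exp_i_times[symmetric] del: norm_exp_i_times) 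
          finally show ?thesis using True \<delta> by (simp add: add_increasing)
        next
          case False
          have "norm (iexp (t * W n x) - iexp (t * (\<mu> + \<sigma> * G n x))) \<le> \<bar>t * W n x - t * (\<mu> + \<sigma> * G n x)\<bar>"
            by (rule norm_iexp_diff_le)
          also have "\<dots> = \<bar>t\<bar> * \<bar>W n x - \<sigma> * G n x - \<mu>\<bar>" by (simp add: abs_mult[symmetric] algebra_simps)
          also have "\<dots> \<le> \<bar>t\<bar> * \<delta>" using Bx[of x] x False by (intro mult_left_mono) (auto intro: less_imp_le)
          finally show ?thesis using False by simp
        qed
      qed
      also have "\<dots> = \<bar>t\<bar> * \<delta> + 2 * prob B"
        by (subst Bochner_Integration.integral_add) (auto simp: prob_space emeasure_eq_measure)
      also have "\<dots> \<le> (\<bar>t\<bar> + 2) * \<delta>" using pB by (simp add: distrib_right)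
      also have "\<dots> < e"
      proof -
        have "(\<bar>t\<bar> + 2) * \<delta> = e / 2" by (simp add: \<delta>_def field_simps)
        thus ?thesis using e by simp
      qed
      finally show ?case by (simp add: dist_norm)
    qed
  qed
  from tendsto_add[OF lim2 lim1]
  show "(\<lambda>n. char (distr M borel (W n)) t) \<longlonglongrightarrow> char (density lborel (normal_density \<mu> \<sigma>)) t" by simp
qed

text \<open>Boundedness in probability: a predicate along \<open>whp\<close> for a fixed bound would be too strong, so
  the bound is allowed to diverge arbitrarily slowly.\<close>

definition stoch_bounded :: "(nat \<times> 'a \<Rightarrow> real) \<Rightarrow> bool" where
  "stoch_bounded Y \<longleftrightarrow> (\<forall>L. filterlim L at_top sequentially \<longrightarrow> eventually (\<lambda>z. \<bar>Y z\<bar> \<le> L (fst z)) whp)"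

lemma stoch_boundedD:
  "stoch_bounded Y \<Longrightarrow> filterlim L at_top sequentially \<Longrightarrow> eventually (\<lambda>z. \<bar>Y z\<bar> \<le> L (fst z)) whp"
  by (simp add: stoch_bounded_def)

text \<open>A Chebyshev-type tail makes any diverging bound sufficient. Both premises are required
  for large \<open>n\<close> only, since the order statistics involved are meaningful once
  \<open>K n < N n\<close>.\<close>

lemma stoch_boundedI_deviation:
  assumes rv: "\<forall>\<^sub>F n in sequentially. (\<lambda>x. Y (n, x)) \<in> borel_measurable M"
    and dev: "\<forall>\<^sub>F n in sequentially. \<forall>a>0. prob {x\<in>space M. a < \<bar>Y (n, x)\<bar>} \<le> C / a\<^sup>2"
  shows "stoch_bounded Y"
  unfolding stoch_bounded_def eventually_whp
proof (intro allI impI)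
  fix L :: "nat \<Rightarrow> real" and \<epsilon> :: real
  assume L: "filterlim L at_top sequentially" and \<epsilon>: "0 < \<epsilon>"
  have "((\<lambda>a::real. C / a\<^sup>2) \<longlongrightarrow> 0) at_top" by real_asymp
  hence "(\<lambda>n. C / (L n)\<^sup>2) \<longlonglongrightarrow> 0" by (rule filterlim_compose[OF _ L])
  hence "\<forall>\<^sub>F n in sequentially. C / (L n)\<^sup>2 < \<epsilon>" using \<epsilon> by (rule order_tendstoD)
  moreover have "\<forall>\<^sub>F n in sequentially. 0 < L n"
    using L by (simp add: filterlim_at_top_dense)
  ultimately show "\<forall>\<^sub>F n in sequentially. \<exists>B\<in>events. prob B < \<epsilon> \<and> (\<forall>x\<in>space M - B. \<bar>Y (n, x)\<bar> \<le> L (fst (n, x)))"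
    using rv dev
  proof eventually_elim
    case (elim n)
    have [measurable]: "(\<lambda>x. Y (n, x)) \<in> borel_measurable M" by fact
    have "{x\<in>space M. L n < \<bar>Y (n, x)\<bar>} \<in> events" by measurable
    moreover have "prob {x\<in>space M. L n < \<bar>Y (n, x)\<bar>} < \<epsilon>"
      using elim by (auto intro: le_less_trans)
    ultimately show ?case by (intro bexI[of _ "{x\<in>space M. L n < \<bar>Y (n, x)\<bar>}"]) auto
  qed
qed

lemma stoch_bounded_mono:
  assumes "stoch_bounded Y'" "eventually (\<lambda>z. \<bar>Y z\<bar> \<le> \<bar>Y' z\<bar>) whp"
  shows "stoch_bounded Y"
  unfolding stoch_bounded_def
proof (intro allI impI)
  fix L :: "nat \<Rightarrow> real" assume "filterlim L at_top sequentially"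
  hence "eventually (\<lambda>z. \<bar>Y' z\<bar> \<le> L (fst z)) whp" by (rule stoch_boundedD[OF assms(1)])
  with assms(2) show "eventually (\<lambda>z. \<bar>Y z\<bar> \<le> L (fst z)) whp" by eventually_elim simp
qed

lemma stoch_bounded_add:
  assumes "stoch_bounded Y" "stoch_bounded Y'"
  shows "stoch_bounded (\<lambda>z. Y z + Y' z)"
  unfolding stoch_bounded_def
proof (intro allI impI)
  fix L :: "nat \<Rightarrow> real" assume L: "filterlim L at_top sequentially"
  have "filterlim (\<lambda>n. L n / 2) at_top sequentially"
    using filterlim_tendsto_pos_mult_at_top[OF tendsto_const[of "1/2::real"] _ L] by simp
  hence "eventually (\<lambda>z. \<bar>Y z\<bar> \<le> L (fst z) / 2) whp" "eventually (\<lambda>z. \<bar>Y' z\<bar> \<le> L (fst z) / 2) whp"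
    by (rule stoch_boundedD[OF assms(1)] stoch_boundedD[OF assms(2)])+
  thus "eventually (\<lambda>z. \<bar>Y z + Y' z\<bar> \<le> L (fst z)) whp" by eventually_elim linarith
qed

lemma stoch_bounded_mult:
  assumes "stoch_bounded Y" "stoch_bounded Y'"
  shows "stoch_bounded (\<lambda>z. Y z * Y' z)"
  unfolding stoch_bounded_def
proof (intro allI impI)
  fix L :: "nat \<Rightarrow> real" assume L: "filterlim L at_top sequentially"
  have "filterlim (\<lambda>n. sqrt (L n)) at_top sequentially" by (rule filterlim_compose[OF sqrt_at_top L])
  hence "eventually (\<lambda>z. \<bar>Y z\<bar> \<le> sqrt (L (fst z))) whp" "eventually (\<lambda>z. \<bar>Y' z\<bar> \<le> sqrt (L (fst z))) whp"
    by (rule stoch_boundedD[OF assms(1)] stoch_boundedD[OF assms(2)])+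
  moreover have "eventually (\<lambda>z. 0 \<le> L (fst z)) whp"
    using L by (intro eventually_fst_whp) (simp add: filterlim_at_top)
  ultimately show "eventually (\<lambda>z. \<bar>Y z * Y' z\<bar> \<le> L (fst z)) whp"
  proof eventually_elim
    case (elim z)
    hence "\<bar>Y z\<bar> * \<bar>Y' z\<bar> \<le> sqrt (L (fst z)) * sqrt (L (fst z))" by (intro mult_mono) auto
    with elim show ?case by (simp add: abs_mult)
  qed
qed

lemma stoch_bounded_tendsto:
  assumes "(Y \<longlongrightarrow> c) whp" shows "stoch_bounded Y"
  unfolding stoch_bounded_def
proof (intro allI impI)
  fix L :: "nat \<Rightarrow> real" assume L: "filterlim L at_top sequentially"
  have "eventually (\<lambda>z. dist (Y z) c < 1) whp" using assms by (rule tendstoD) simp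
  moreover have "eventually (\<lambda>z. \<bar>c\<bar> + 1 \<le> L (fst z)) whp"
    using L by (intro eventually_fst_whp) (simp add: filterlim_at_top)
  ultimately show "eventually (\<lambda>z. \<bar>Y z\<bar> \<le> L (fst z)) whp"
  proof eventually_elim
    case (elim z) thus ?case unfolding dist_norm real_norm_def by linarith
  qed
qed

lemma stoch_bounded_const: "stoch_bounded (\<lambda>_. c)"
  by (rule stoch_bounded_tendsto[OF tendsto_const])

lemma stoch_bounded_fst:
  assumes "b \<in> O(\<lambda>_. 1)" shows "stoch_bounded (\<lambda>z. b (fst z))"
proof -
  obtain c where c: "eventually (\<lambda>n. norm (b n) \<le> c * norm (1::real)) sequentially"
    using assms by (rule landau_o.bigE)
  show ?thesis
    by (rule stoch_bounded_mono[OF stoch_bounded_const[of c]])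
       (use eventually_fst_whp[OF c] in \<open>auto elim!: eventually_mono\<close>)
qed

lemma stoch_bounded_sum:
  assumes "finite I" "\<And>i. i \<in> I \<Longrightarrow> stoch_bounded (Y i)"
  shows "stoch_bounded (\<lambda>z. \<Sum>i\<in>I. Y i z)"
  using assms by (induction I rule: finite_induct) (auto intro: stoch_bounded_const stoch_bounded_add)

lemma stoch_bounded_exp:
  assumes Y: "stoch_bounded Y" and c: "0 \<le> c"
  shows "stoch_bounded (\<lambda>z. exp (c * \<bar>Y z\<bar>))"
  unfolding stoch_bounded_def
proof (intro allI impI)
  fix L :: "nat \<Rightarrow> real" assume L: "filterlim L at_top sequentially"
  have "filterlim (\<lambda>n. ln (L n)) at_top sequentially"
    by (rule filterlim_compose[OF ln_at_top L])
  hence "filterlim (\<lambda>n. 1 / (c + 1) * ln (L n)) at_top sequentially"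
    using c by (intro filterlim_tendsto_pos_mult_at_top[OF tendsto_const]) auto
  hence "eventually (\<lambda>z. \<bar>Y z\<bar> \<le> 1 / (c + 1) * ln (L (fst z))) whp" by (rule stoch_boundedD[OF Y])
  moreover have "eventually (\<lambda>z. 0 < L (fst z)) whp"
    using L by (intro eventually_fst_whp) (simp add: filterlim_at_top_dense)
  ultimately show "eventually (\<lambda>z. \<bar>exp (c * \<bar>Y z\<bar>)\<bar> \<le> L (fst z)) whp"
  proof eventually_elim
    case (elim z)
    have "c * \<bar>Y z\<bar> \<le> (c + 1) * \<bar>Y z\<bar>" by (simp add: algebra_simps)
    also have "\<dots> \<le> ln (L (fst z))" using elim c by (simp add: field_simps)
    finally have "exp (c * \<bar>Y z\<bar>) \<le> exp (ln (L (fst z)))" by simp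
    with elim show ?case by simp
  qed
qed

lemma stoch_bounded_null:
  assumes Y: "stoch_bounded Y" and \<delta>: "\<delta> \<longlonglongrightarrow> 0"
  shows "((\<lambda>z. \<delta> (fst z) * Y z) \<longlongrightarrow> 0) whp"
proof -
  \<comment> \<open>This sequence diverges, yet more slowly than \<open>1 / \<delta> n\<close>, so
    its product with \<open>\<delta> n\<close> still vanishes. The summand \<open>1 / Suc n\<close>
    guards against \<open>\<delta> n = 0\<close>.\<close>
  define L where "L n = 1 / sqrt (\<bar>\<delta> n\<bar> + 1 / real (Suc n))" for n
  have arg: "(\<lambda>n. sqrt (\<bar>\<delta> n\<bar> + 1 / real (Suc n))) \<longlonglongrightarrow> sqrt (\<bar>0\<bar> + 0)"
    by (intro tendsto_real_sqrt tendsto_add tendsto_rabs \<delta> LIMSEQ_Suc[OF lim_1_over_n])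
  have pos: "0 < sqrt (\<bar>\<delta> n\<bar> + 1 / real (Suc n))" for n by (simp add: add_nonneg_pos)
  have "filterlim (\<lambda>n. inverse (sqrt (\<bar>\<delta> n\<bar> + 1 / real (Suc n)))) at_top sequentially"
    by (rule filterlim_inverse_at_top) (use arg pos in simp_all)
  hence "filterlim L at_top sequentially" by (simp add: L_def[abs_def] inverse_eq_divide)
  hence ev: "eventually (\<lambda>z. \<bar>Y z\<bar> \<le> L (fst z)) whp" by (rule stoch_boundedD[OF Y])
  have lim: "((\<lambda>z. sqrt (\<bar>\<delta> (fst z)\<bar> + 1 / real (Suc (fst z)))) \<longlongrightarrow> 0) whp"
    using tendsto_fst_whp[OF arg] by simp
  show ?thesis
  proof (rule Lim_null_comparison[OF _ lim])
    show "eventually (\<lambda>z. norm (\<delta> (fst z) * Y z) \<le> sqrt (\<bar>\<delta> (fst z)\<bar> + 1 / real (Suc (fst z)))) whp"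
      using ev
    proof eventually_elim
      case (elim z)
      let ?s = "\<bar>\<delta> (fst z)\<bar> + 1 / real (Suc (fst z))"
      have s: "0 < ?s" by (simp add: add_nonneg_pos)
      have "norm (\<delta> (fst z) * Y z) = \<bar>\<delta> (fst z)\<bar> * \<bar>Y z\<bar>" by (simp add: abs_mult)
      also have "\<dots> \<le> ?s * (1 / sqrt ?s)"
        using elim unfolding L_def by (intro mult_mono) auto
      also have "\<dots> = sqrt ?s" using s real_div_sqrt[of ?s] by simp
      finally show ?case .
    qed
  qed
qed

end

section \<open>Exponential moments\<close>

text \<open>Exponential tilting: \<open>exp (c * y)\<close> times the density of rate 1 is
  \<open>1 / (1 - c)\<close> times the density of rate \<open>1 - c\<close>.\<close>

lemma std_exponential_exp_moment:
  assumes c: "c < 1"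
  shows "integrable std_exponential (\<lambda>y. exp (c * y))" "(\<integral>y. exp (c * y) \<partial>std_exponential) = 1 / (1 - c)"
proof -
  interpret E: prob_space "density lborel (exponential_density (1 - c))"
    by (rule prob_space_exponential_density) (use c in simp)
  have meas: "exponential_density (1 - c) \<in> borel_measurable borel" by measurable
  have int1: "integrable lborel (exponential_density (1 - c))"
    using E.integrable_const[of "1::real"] c
    by (subst (asm) integrable_density) (auto simp: exponential_density_nonneg)
  have val1: "integral\<^sup>L lborel (exponential_density (1 - c)) = 1"
  proof -
    have "1 = (\<integral>y. (1::real) \<partial>density lborel (exponential_density (1 - c)))"
      using E.prob_space by simp
    also have "\<dots> = integral\<^sup>L lborel (exponential_density (1 - c))"
      using c by (subst integral_density) (auto simp: exponential_density_nonneg)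
    finally show ?thesis by simp
  qed
  have eq: "exponential_density 1 y *\<^sub>R exp (c * y) = (1 / (1 - c)) * exponential_density (1 - c) y" for y
    using c by (simp add: exponential_density_def mult_exp_exp right_diff_distrib)
  show "integrable std_exponential (\<lambda>y. exp (c * y))"
    unfolding std_exponential_def
    by (subst integrable_density) (use int1 in \<open>auto simp: exponential_density_nonneg eq[unfolded real_scaleR_def]\<close>)
  show "(\<integral>y. exp (c * y) \<partial>std_exponential) = 1 / (1 - c)"
    by (subst integral_std_exponential) (simp_all add: eq[unfolded real_scaleR_def] val1)
qed

text \<open>Squaring the bound gives the exponent \<open>2 / 3 < 1\<close>, for which the
  exponential moment is finite.\<close>

lemma std_exponential_square_integrable:
  assumes [measurable]: "g \<in> borel_measurable borel" and bound: "\<And>y. 0 \<le> y \<Longrightarrow> \<bar>g y\<bar> \<le> C * exp (y / 3)"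
  shows "integrable std_exponential (\<lambda>y. (g y)\<^sup>2)"
proof (rule Bochner_Integration.integrable_bound)
  show "integrable std_exponential (\<lambda>y. C\<^sup>2 * exp (2 / 3 * y))"
    by (intro integrable_mult_right std_exponential_exp_moment) simp
  show "AE y in std_exponential. norm ((g y)\<^sup>2) \<le> norm (C\<^sup>2 * exp (2 / 3 * y))"
    using AE_std_exponential_pos
  proof eventually_elim
    case (elim y)
    have "\<bar>g y\<bar>\<^sup>2 \<le> (C * exp (y / 3))\<^sup>2" using bound[of y] elim by (intro power_mono) auto
    also have "\<dots> = C\<^sup>2 * exp (2 / 3 * y)" by (simp add: power_mult_distrib exp_double[symmetric])
    finally show ?case by simp
  qed
qed measurable

lemma std_exponential_distributed: "distributed std_exponential lborel (\<lambda>x. x) (exponential_density 1)"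
  by (auto simp: distributed_def distr_id2 std_exponential_def exponential_density_nonneg)

lemma std_exponential_mean: "(\<integral>y. y \<partial>std_exponential) = 1"
  using std_exponential.exponential_distributed_expectation[OF _ std_exponential_distributed] by simp

lemma std_exponential_second_moment:
  "integrable std_exponential (\<lambda>y. y)" "integrable std_exponential (\<lambda>y. y\<^sup>2)" "(\<integral>y. y\<^sup>2 \<partial>std_exponential) = 2"
proof -
  show sq: "integrable std_exponential (\<lambda>y. y\<^sup>2)"
  proof (rule std_exponential_square_integrable[where C = 3])
    fix y :: real assume "0 \<le> y"
    moreover have "1 + y / 3 \<le> exp (y / 3)" by (rule exp_ge_add_one_self)
    ultimately show "\<bar>y\<bar> \<le> 3 * exp (y / 3)" by linarith
  qed simp
  show int: "integrable std_exponential (\<lambda>y. y)"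
    by (rule std_exponential.square_integrable_imp_integrable[OF _ sq]) simp
  have "std_exponential.variance (\<lambda>y. y) = 1"
    using std_exponential.exponential_distributed_variance[OF _ std_exponential_distributed] by simp
  thus "(\<integral>y. y\<^sup>2 \<partial>std_exponential) = 2"
    using std_exponential.variance_eq[OF int sq] by (simp add: std_exponential_mean)
qed

text \<open>This mean is the origin of the factor \<open>1 / (1 - \<rho>)\<close> in the asymptotic
  bias.\<close>

lemma std_exponential_box_cox_mean:
  assumes "\<rho> \<le> 0" shows "(\<integral>y. box_cox \<rho> y \<partial>std_exponential) = 1 / (1 - \<rho>)"
proof (cases "\<rho> = 0")
  case True
  thus ?thesis by (simp add: box_cox_def std_exponential_mean)
next
  case False
  hence \<rho>: "\<rho> < 1" using assms by simp
  have "(\<integral>y. box_cox \<rho> y \<partial>std_exponential) = (\<integral>y. (exp (\<rho> * y) - 1) / \<rho> \<partial>std_exponential)"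
    using False by (simp add: box_cox_def)
  also have "\<dots> = (1 / (1 - \<rho>) - 1) / \<rho>"
    using std_exponential_exp_moment[OF \<rho>] std_exponential.prob_space by simp
  also have "\<dots> = 1 / (1 - \<rho>)" using \<rho> False by (simp add: field_simps)
  finally show ?thesis .
qed

section \<open>Exponential scores and the second-order condition\<close>

lemma tail_quantile_eq_quantile:
  assumes t: "0 < t" and F: "\<And>x. F x \<le> 1"
  shows "tail_quantile F t = quantile F (1 - 1 / t)"
proof -
  have "ereal t \<le> 1 / ereal (1 - F x) \<longleftrightarrow> 1 - 1 / t \<le> F x" for x
  proof (cases "F x = 1")
    \<comment> \<open>The extended quotient is infinite here, so the left side holds, and so does
      \<open>1 - 1 / t \<le> 1\<close>.\<close>
    case True
    thus ?thesis using t by (simp add: divide_ereal_def flip: zero_ereal_def)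
  next
    case False
    hence "0 < 1 - F x" using F[of x] by simp
    thus ?thesis using t by (simp add: one_ereal_def field_simps)
  qed
  thus ?thesis by (simp add: tail_quantile_def quantile_def)
qed

locale continuous_distribution = cdf_distribution M for M :: "real measure" +
  assumes continuous_cdf: "continuous_on UNIV (cdf M)"
begin

text \<open>The tail quantile function in logarithmic scale: \<open>Q s\<close> is
  \<open>tail_quantile C (exp s)\<close>. For \<open>s \<le> 0\<close> the level is not positive and
  the value is the junk constant \<open>Inf UNIV\<close>.\<close>

abbreviation Q :: "real \<Rightarrow> real" where "Q s \<equiv> quantile C (1 - exp (- s))"

lemma quantile_le_iff: "0 < u \<Longrightarrow> u < 1 \<Longrightarrow> quantile C u \<le> x \<longleftrightarrow> u \<le> C x"
  using pseudoinverse[of u x] by (simp add: quantile_def)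

text \<open>Continuity enters through the limit from the left: to the left of the quantile the
  distribution function stays below \<open>u\<close>, hence so does its value at the
  quantile.\<close>

lemma cdf_quantile:
  assumes "0 < u" "u < 1" shows "C (quantile C u) = u"
proof (rule antisym)
  show "u \<le> C (quantile C u)" using quantile_le_iff[OF assms] by blast
  show "C (quantile C u) \<le> u"
  proof (rule tendsto_upperbound)
    have "isCont C (quantile C u)" using continuous_cdf by (simp add: continuous_on_eq_continuous_at)
    thus "(C \<longlongrightarrow> C (quantile C u)) (at_left (quantile C u))"
      by (auto simp: isCont_def intro: tendsto_mono[OF at_le])
    show "\<forall>\<^sub>F x in at_left (quantile C u). C x \<le> u"
      using eventually_at_left_real[of "quantile C u - 1" "quantile C u"] quantile_le_iff[OF assms]
      by (auto elim!: eventually_mono) (meson less_imp_le not_le order_less_le_trans)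
  qed simp
qed

lemma Q_mono: "0 < s \<Longrightarrow> s \<le> s' \<Longrightarrow> Q s \<le> Q s'"
  using mono_I unfolding quantile_def by (rule mono_onD) auto

lemma Q_measurable [measurable]: "Q \<in> borel_measurable borel"
proof (rule borel_measurable_piecewise_mono[of "{{..0}, {0<..}}"])
  have "Q s = Inf UNIV" if "s \<le> 0" for s
  proof -
    have "1 - exp (- s) \<le> C x" for x
      using that cdf_nonneg[of x] by (smt (verit) one_le_exp_iff)
    thus ?thesis by (simp add: quantile_def)
  qed
  hence "mono_on {..0} Q" by (auto intro!: mono_onI)
  moreover have "mono_on {0<..} Q" by (auto intro!: mono_onI Q_mono)
  ultimately show "c \<in> {{..0}, {0<..}} \<Longrightarrow> mono_on c Q" for c by blast
qed auto

section \<open>Transformation of the data to exponential scores\<close>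

definition exp_score :: "real \<Rightarrow> real" where "exp_score x = - ln (1 - C x)"

lemma exp_score_measurable [measurable]: "exp_score \<in> borel_measurable borel"
  unfolding exp_score_def by measurable

abbreviation uniform01 :: "real measure" where
  "uniform01 \<equiv> restrict_space lborel {0<..<1}"

lemma AE_uniform01: "AE u in uniform01. 0 < u \<and> u < 1"
  by (auto simp: space_restrict_space intro!: AE_I2)

lemma I_measurable_uniform: "I \<in> borel_measurable uniform01"
  using measurable_CI by (simp add: measurable_def space_restrict_space sets_restrict_space)

text \<open>\<open>M\<close> is the law of \<open>I u\<close> with \<open>u\<close> uniform on the
  unit interval. At a point \<open>I u\<close> the distribution function returns \<open>u\<close>,
  so \<open>Q\<close> undoes the score; the converse direction \<open>C x\<close> to
  \<open>x\<close> may fail on flat stretches, which carry no mass.\<close>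

lemma AE_exp_score: "AE x in M. 0 < exp_score x \<and> Q (exp_score x) = x"
proof -
  have meas: "{x \<in> space borel. 0 < exp_score x \<and> C x < 1 \<and> Q (exp_score x) = x} \<in> sets borel"
    by measurable
  have "AE u in uniform01. 0 < exp_score (I u) \<and> C (I u) < 1 \<and> Q (exp_score (I u)) = I u"
    using AE_uniform01
  proof eventually_elim
    case (elim u)
    have "C (I u) = u" using cdf_quantile[of u] elim by (simp add: quantile_def)
    thus ?case using elim by (simp add: exp_score_def ln_less_zero quantile_def)
  qed
  hence "AE x in distr uniform01 borel I. 0 < exp_score x \<and> C x < 1 \<and> Q (exp_score x) = x"
    by (subst AE_distr_iff[OF I_measurable_uniform meas])
  hence "AE x in M. 0 < exp_score x \<and> C x < 1 \<and> Q (exp_score x) = x" unfolding distr_I_eq_M .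
  thus ?thesis by eventually_elim simp
qed

lemma distr_exp_score: "distr M borel exp_score = std_exponential"
proof -
  have "distributed M lborel exp_score (exponential_density 1)"
  proof (rule exponential_distributedI)
    fix a :: real assume a: "0 \<le> a"
    define v where "v = 1 - exp (- a)"
    have v: "0 \<le> v" "v < 1" using a by (auto simp: v_def)
    have A: "{x. exp_score x \<le> a} \<in> sets borel" by measurable
    have "emeasure M {x \<in> space M. exp_score x \<le> a} = emeasure (distr uniform01 borel I) {x. exp_score x \<le> a}"
      unfolding distr_I_eq_M by (simp add: space_eq_univ)
    also have "\<dots> = emeasure uniform01 (I -` {x. exp_score x \<le> a} \<inter> space uniform01)"
      by (rule emeasure_distr[OF I_measurable_uniform A])
    \<comment> \<open>Expressed in the uniform variable, the score of \<open>I u\<close> is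
      \<open>- ln (1 - u)\<close>, so the event is the interval up to
      \<open>1 - exp (- a)\<close>.\<close>
    also have "I -` {x. exp_score x \<le> a} \<inter> space uniform01 = {u\<in>{0<..<1}. u \<le> v}"
    proof -
      have "exp_score (I u) \<le> a \<longleftrightarrow> u \<le> v" if "0 < u" "u < 1" for u
      proof -
        have "exp_score (I u) = - ln (1 - u)" using cdf_quantile[OF that] by (simp add: exp_score_def quantile_def)
        also have "\<dots> \<le> a \<longleftrightarrow> exp (- a) \<le> 1 - u" using that
          by (metis diff_gt_0_iff_gt ln_ge_iff minus_le_iff)
        finally show ?thesis by (auto simp: v_def)
      qed
      thus ?thesis by (auto simp: space_restrict_space)
    qed
    also have "emeasure uniform01 {u\<in>{0<..<1}. u \<le> v} = emeasure lborel {u\<in>{0<..<1}. u \<le> v}"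
      by (rule emeasure_restrict_space) auto
    also have "{u\<in>{0<..<1}. u \<le> v} = {0<..v}" using v by auto
    also have "emeasure lborel {0<..v} = ennreal (1 - exp (- a * 1))" using v by (simp add: v_def)
    also have "\<dots> = 1 - ennreal (exp (- a * 1))" by (simp add: ennreal_minus flip: ennreal_1)
    finally show "emeasure M {x \<in> space M. exp_score x \<le> a} = 1 - ennreal (exp (- a * 1))" .
  qed auto
  thus ?thesis
    by (simp add: distributed_def std_exponential_def cong: distr_cong)
qed

text \<open>Passing to logarithms turns the second-order condition on ratios of \<open>U\<close> into an additive
  one; replacing \<open>A\<close> by a normalised increment of \<open>\<psi>\<close> makes the rate function measurable.\<close>

lemma second_order_log:
  assumes so: "second_order_condition C \<gamma> \<rho> A"
  defines "\<psi> \<equiv> \<lambda>s. ln (Q s) - \<gamma> * s"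
  defines "a \<equiv> \<lambda>s. (\<psi> (s + 1) - \<psi> s) / box_cox \<rho> 1"
  shows "eventually (\<lambda>s. 0 < Q s) at_top" and "extended_regular_variation \<psi> a \<rho>"
    and "((\<lambda>t. a (ln t) / A t) \<longlongrightarrow> 1) at_top"
proof -
  have \<gamma>: "0 < \<gamma>" and \<rho>: "\<rho> \<le> 0" and A0: "(A \<longlongrightarrow> 0) at_top"
    and sgn: "(\<forall>\<^sub>F t in at_top. 0 < A t) \<or> (\<forall>\<^sub>F t in at_top. A t < 0)"
    and lim: "\<And>x. 0 < x \<Longrightarrow> ((\<lambda>t. 1 / A t * (tail_quantile C (t * x) / tail_quantile C t - x powr \<gamma>)) \<longlongrightarrow>
        x powr \<gamma> * (if \<rho> = 0 then ln x else (x powr \<rho> - 1) / \<rho>)) at_top"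
    using so by (auto simp: second_order_condition_def)
  define B where "B s = A (exp s)" for s
  have B0: "(B \<longlongrightarrow> 0) at_top" unfolding B_def by (rule filterlim_compose[OF A0 exp_at_top])
  have "\<forall>\<^sub>F t in at_top. A t \<noteq> 0" using sgn by (auto elim!: eventually_mono)
  hence Bnz: "\<forall>\<^sub>F s in at_top. B s \<noteq> 0" unfolding B_def by (rule eventually_compose_filterlim[OF _ exp_at_top])
  have UQ: "tail_quantile C (exp s) = Q s" for s
    using tail_quantile_eq_quantile[of "exp s" C] cdf_bounded_prob by (simp add: exp_minus inverse_eq_divide)
  define r where "r y s = Q (s + y) / Q s" for y s
  have ratio: "((\<lambda>s. (r y s - exp (\<gamma> * y)) / B s) \<longlongrightarrow> exp (\<gamma> * y) * box_cox \<rho> y) at_top" for y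
  proof -
    have "((\<lambda>s. 1 / A (exp s) * (tail_quantile C (exp s * exp y) / tail_quantile C (exp s) - exp y powr \<gamma>)) \<longlongrightarrow>
        exp y powr \<gamma> * (if \<rho> = 0 then ln (exp y) else (exp y powr \<rho> - 1) / \<rho>)) at_top"
      by (rule filterlim_compose[OF lim exp_at_top]) simp
    moreover have "exp y powr \<gamma> * (if \<rho> = 0 then ln (exp y) else (exp y powr \<rho> - 1) / \<rho>) = exp (\<gamma> * y) * box_cox \<rho> y"
      by (simp add: powr_def box_cox_def mult.commute)
    moreover have "1 / A (exp s) * (tail_quantile C (exp s * exp y) / tail_quantile C (exp s) - exp y powr \<gamma>) =
        (r y s - exp (\<gamma> * y)) / B s" for s
      unfolding exp_add[symmetric] UQ by (simp add: powr_def r_def B_def mult.commute)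
    ultimately show ?thesis by simp
  qed
  have r_lim: "(r y \<longlongrightarrow> exp (\<gamma> * y)) at_top" for y
  proof -
    have "((\<lambda>s. (r y s - exp (\<gamma> * y)) / B s * B s + exp (\<gamma> * y)) \<longlongrightarrow>
        exp (\<gamma> * y) * box_cox \<rho> y * 0 + exp (\<gamma> * y)) at_top"
      by (intro tendsto_intros ratio B0)
    hence "((\<lambda>s. (r y s - exp (\<gamma> * y)) / B s * B s + exp (\<gamma> * y)) \<longlongrightarrow> exp (\<gamma> * y)) at_top" by simp
    thus ?thesis
      by (rule Lim_transform_eventually) (use Bnz in \<open>auto elim!: eventually_mono\<close>)
  qed
  show Qpos: "eventually (\<lambda>s. 0 < Q s) at_top"
  proof -
    have "eventually (\<lambda>s. 1 < r 1 s) at_top" using r_lim[of 1] \<gamma> by (intro order_tendstoD) auto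
    with eventually_gt_at_top[of 0] show ?thesis
    proof eventually_elim
      case (elim s)
      \<comment> \<open>A negative \<open>Q s\<close> would make the ratio at most 1 by
        monotonicity, and \<open>Q s = 0\<close> would make it 0 by the convention for division;
        both contradict the limit \<open>exp \<gamma> > 1\<close>.\<close>
      have "Q s \<le> Q (s + 1)" using elim by (intro Q_mono) auto
      with elim(2) show "0 < Q s" by (cases "Q s" "0::real" rule: linorder_cases) (auto simp: r_def divide_simps)
    qed
  qed
  have inc: "((\<lambda>s. (\<psi> (s + y) - \<psi> s) / B s) \<longlongrightarrow> box_cox \<rho> y) at_top" for y
  proof -
    \<comment> \<open>Then \<open>r y s = exp (\<gamma> * y) * (1 + B s * \<delta> s)\<close>, so
      the logarithm is \<open>\<gamma> * y + B s * \<delta> s\<close> up to a quadratic error, which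
      is negligible even after division by \<open>B s\<close>.\<close>
    define \<delta> where "\<delta> s = (r y s - exp (\<gamma> * y)) / B s / exp (\<gamma> * y)" for s
    have \<delta>: "(\<delta> \<longlongrightarrow> box_cox \<rho> y) at_top"
      unfolding \<delta>_def using tendsto_divide[OF ratio[of y] tendsto_const[of "exp (\<gamma> * y)"]] by simp
    have B\<delta>: "((\<lambda>s. B s * \<delta> s) \<longlongrightarrow> 0) at_top"
      using tendsto_mult[OF B0 \<delta>] by simp
    have "((\<lambda>s. 2 * \<bar>B s * \<delta> s\<bar> * \<bar>\<delta> s\<bar>) \<longlongrightarrow> 2 * \<bar>0\<bar> * \<bar>box_cox \<rho> y\<bar>) at_top"
      by (intro tendsto_intros B\<delta> \<delta>)
    hence err: "((\<lambda>s. 2 * \<bar>B s * \<delta> s\<bar> * \<bar>\<delta> s\<bar>) \<longlongrightarrow> 0) at_top" by simp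
    have sh: "filterlim (\<lambda>s. s + y) at_top at_top"
      by (subst add.commute) (rule filterlim_tendsto_add_at_top[OF tendsto_const filterlim_ident])
    have small: "eventually (\<lambda>s. \<bar>B s * \<delta> s\<bar> < 1 / 2) at_top"
      using tendstoD[OF B\<delta>, of "1/2"] by (simp add: dist_norm)
    have "((\<lambda>s. (\<psi> (s + y) - \<psi> s) / B s - \<delta> s) \<longlongrightarrow> 0) at_top"
    proof (rule Lim_null_comparison[OF _ err])
      show "\<forall>\<^sub>F s in at_top. norm ((\<psi> (s + y) - \<psi> s) / B s - \<delta> s) \<le> 2 * \<bar>B s * \<delta> s\<bar> * \<bar>\<delta> s\<bar>"
        using small Bnz Qpos eventually_compose_filterlim[OF Qpos sh]
      proof eventually_elim
        case (elim s)
        define z where "z = B s * \<delta> s"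
        have rz: "r y s = exp (\<gamma> * y) * (1 + z)" using elim by (simp add: z_def \<delta>_def field_simps)
        have z: "\<bar>z\<bar> < 1 / 2" using elim by (simp add: z_def)
        have "\<psi> (s + y) - \<psi> s = ln (r y s) - \<gamma> * y"
          using elim by (simp add: \<psi>_def r_def ln_div algebra_simps)
        also have "\<dots> = ln (1 + z)" unfolding rz using z by (subst ln_mult) auto
        finally have "(\<psi> (s + y) - \<psi> s) / B s - \<delta> s = (ln (1 + z) - z) / B s"
          using elim by (simp add: z_def diff_divide_distrib)
        also have "norm \<dots> \<le> 2 * z\<^sup>2 / \<bar>B s\<bar>"
          using abs_ln_one_plus_x_minus_x_bound[of z] z by (simp add: abs_divide divide_right_mono)
        also have "\<dots> = 2 * \<bar>z\<bar> * (\<bar>z\<bar> / \<bar>B s\<bar>)" by (simp add: power2_eq_square)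
        also have "\<bar>z\<bar> / \<bar>B s\<bar> = \<bar>\<delta> s\<bar>" using elim(2) by (simp add: z_def abs_mult)
        finally show ?case by (simp add: z_def)
      qed
    qed
    from tendsto_add[OF this \<delta>] show ?thesis by simp
  qed
  have aB: "((\<lambda>s. a s / B s) \<longlongrightarrow> 1) at_top"
    using tendsto_divide[OF inc[of 1] tendsto_const[of "box_cox \<rho> 1"]] box_cox_1_pos[of \<rho>]
    by (simp add: a_def mult.commute)
  have "((\<lambda>t. a (ln t) / B (ln t)) \<longlongrightarrow> 1) at_top" by (rule filterlim_compose[OF aB ln_at_top])
  thus "((\<lambda>t. a (ln t) / A t) \<longlongrightarrow> 1) at_top"
  proof (rule Lim_transform_eventually)
    show "\<forall>\<^sub>F t in at_top. a (ln t) / B (ln t) = a (ln t) / A t"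
      using eventually_gt_at_top[of 0] by eventually_elim (simp add: B_def)
  qed
  have aBpos: "eventually (\<lambda>s. 0 < a s / B s) at_top" using aB by (rule order_tendstoD) simp
  show "extended_regular_variation \<psi> a \<rho>"
  proof
    show psi_meas: "\<psi> \<in> borel_measurable borel" unfolding \<psi>_def by measurable
    show "a \<in> borel_measurable borel" unfolding a_def
      by (intro borel_measurable_divide borel_measurable_diff psi_meas measurable_compose[OF _ psi_meas]) auto
    show "\<rho> \<le> 0" by fact
    show "\<forall>\<^sub>F s in at_top. a s \<noteq> 0" using aBpos by (auto elim!: eventually_mono)
    fix y
    have "((\<lambda>s. ((\<psi> (s + y) - \<psi> s) / B s) / (a s / B s)) \<longlongrightarrow> box_cox \<rho> y / 1) at_top"
      by (intro tendsto_divide inc aB) simp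
    hence "((\<lambda>s. ((\<psi> (s + y) - \<psi> s) / B s) / (a s / B s)) \<longlongrightarrow> box_cox \<rho> y) at_top" by simp
    thus "((\<lambda>s. (\<psi> (s + y) - \<psi> s) / a s) \<longlongrightarrow> box_cox \<rho> y) at_top"
      by (rule Lim_transform_eventually) (use Bnz in \<open>auto elim!: eventually_mono\<close>)
  qed
qed

end

section \<open>Tail asymptotics of one exponential sample\<close>

text \<open>The bias is only bounded and \<open>K\<close> need not diverge, so that subsamples of
  both groups are instances; divergence of \<open>K\<close> is added as a premise where a limit is
  asserted.\<close>

locale exponential_sample = prob_space M + extended_regular_variation \<psi> a \<rho>
  for M :: "'a measure" and \<psi> a :: "real \<Rightarrow> real" and \<rho> :: real +
  fixes Y :: "nat \<Rightarrow> 'a \<Rightarrow> real" and N K :: "nat \<Rightarrow> nat"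
  assumes indep: "indep_vars (\<lambda>_. borel) Y {1..}"
    and law: "\<And>i. 1 \<le> i \<Longrightarrow> distr M borel (Y i) = std_exponential"
    and N_top: "filterlim N at_top sequentially"
    and K_pos: "\<And>n. 1 \<le> K n"
    and frac: "(\<lambda>n. real (K n) / real (N n)) \<longlonglongrightarrow> 0"
    and bias: "(\<lambda>n. sqrt (real (K n)) * a (ln (real (N n) / real (K n)))) \<in> O(\<lambda>_. 1)"
begin

text \<open>The deterministic counterpart of the random threshold \<open>Z\<close>: among
  \<open>N n\<close> standard exponentials, \<open>K n\<close> are expected to exceed
  \<open>S n\<close>.\<close>

definition S :: "nat \<Rightarrow> real" where
  "S n = ln (real (N n) / real (K n))"

definition Z :: "nat \<times> 'a \<Rightarrow> real" where
  "Z z = order_stat (N (fst z) - K (fst z)) (N (fst z)) (\<lambda>i. Y i (snd z))"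

definition avg :: "(real \<Rightarrow> real) \<Rightarrow> nat \<times> 'a \<Rightarrow> real" where
  "avg g z = excess_sum g (K (fst z)) (N (fst z)) (\<lambda>i. Y i (snd z)) / real (K (fst z))"

definition dev :: "nat \<times> 'a \<Rightarrow> real" where
  "dev z = (\<Sum>i=1..K (fst z). \<psi> (order_stat (N (fst z) - i + 1) (N (fst z)) (\<lambda>i. Y i (snd z))) - \<psi> (Z z))
    / real (K (fst z))"

lemma K_pos': "0 < K n" "0 < real (K n)" using K_pos[of n] by auto

lemma rv [measurable]: "1 \<le> i \<Longrightarrow> random_variable borel (Y i)"
  using indep by (simp add: indep_vars_def2)

lemma indep': "indep_vars (\<lambda>_. borel) Y {1..n}"
  by (rule indep_vars_subset[OF indep]) auto

lemma N_pos: "eventually (\<lambda>n. 0 < N n) sequentially"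
  by (rule eventually_compose_filterlim[OF eventually_gt_at_top N_top])

lemma K_less_N: "eventually (\<lambda>n. K n < N n) sequentially"
proof -
  have "eventually (\<lambda>n. real (K n) / real (N n) < 1) sequentially"
    using frac by (rule order_tendstoD) simp
  with N_pos show ?thesis by eventually_elim simp
qed

lemma ratio_top: "filterlim (\<lambda>n. real (N n) / real (K n)) at_top sequentially"
proof -
  have "filterlim (\<lambda>n. inverse (real (K n) / real (N n))) at_top sequentially"
    by (rule filterlim_inverse_at_top[OF frac])
       (use N_pos K_pos' in \<open>auto elim!: eventually_mono\<close>)
  thus ?thesis by simp
qed

lemma S_top: "filterlim S at_top sequentially"
  unfolding S_def by (rule filterlim_compose[OF ln_at_top ratio_top])

lemma sqrt_K_ge_1: "1 \<le> sqrt (real (K n))"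
  using K_pos[of n] by simp

lemma inverse_sqrt_K_bounded: "(\<lambda>n. 1 / sqrt (real (K n))) \<in> O(\<lambda>_. 1)"
  by (rule bigoI[of _ 1]) (use sqrt_K_ge_1 in \<open>simp add: divide_simps\<close>)

lemma threshold_bounded: "stoch_bounded (\<lambda>z. sqrt (real (K (fst z))) * (Z z - S (fst z)))"
proof (rule stoch_boundedI_deviation[where C = 2])
  show "\<forall>\<^sub>F n in sequentially. (\<lambda>x. sqrt (real (K (fst (n, x)))) * (Z (n, x) - S (fst (n, x)))) \<in> borel_measurable M"
    using K_less_N
  proof eventually_elim
    case (elim n)
    have [measurable]: "(\<lambda>x. order_stat (N n - K n) (N n) (\<lambda>i. Y i x)) \<in> borel_measurable M"
      by (rule order_stat_measurable) (use elim in auto)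
    show ?case by (simp add: Z_def)
  qed
  show "\<forall>\<^sub>F n in sequentially. \<forall>a>0. prob {x \<in> space M. a < \<bar>sqrt (real (K (fst (n, x)))) * (Z (n, x) - S (fst (n, x)))\<bar>} \<le> 2 / a\<^sup>2"
    using K_less_N
  proof eventually_elim
    case (elim n)
    show ?case
    proof (intro allI impI)
      fix b :: real assume b: "0 < b"
      have "b < \<bar>sqrt (real (K n)) * v\<bar> \<longleftrightarrow> b / sqrt (real (K n)) < \<bar>v\<bar>" for v
        using K_pos'[of n] by (simp add: abs_mult divide_simps mult.commute)
      hence "prob {x \<in> space M. b < \<bar>sqrt (real (K (fst (n, x)))) * (Z (n, x) - S (fst (n, x)))\<bar>} =
          prob {x \<in> space M. b / sqrt (real (K n)) < \<bar>order_stat (N n - K n) (N n) (\<lambda>j. Y j x) - ln (real (N n) / real (K n))\<bar>}"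
        by (simp add: Z_def S_def)
      also have "\<dots> \<le> 2 / (K n * (b / sqrt (real (K n)))\<^sup>2)"
        using K_pos[of n] K_pos'[of n] elim b by (intro order_stat_deviation[OF indep' law]) auto
      also have "\<dots> = 2 / b\<^sup>2" using K_pos'[of n] by (simp add: power_divide)
      finally show "prob {x \<in> space M. b < \<bar>sqrt (real (K (fst (n, x)))) * (Z (n, x) - S (fst (n, x)))\<bar>} \<le> 2 / b\<^sup>2" .
    qed
  qed
qed

lemma avg_bounded:
  assumes g [measurable]: "g \<in> borel_measurable borel" and bound: "\<And>y. 0 \<le> y \<Longrightarrow> \<bar>g y\<bar> \<le> C * exp (y / 3)"
  shows "stoch_bounded (\<lambda>z. sqrt (real (K (fst z))) * (avg g z - (\<integral>y. g y \<partial>std_exponential)))"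
proof (rule stoch_boundedI_deviation[where C = "\<integral>y. (g y)\<^sup>2 \<partial>std_exponential"])
  let ?v = "\<integral>y. (g y)\<^sup>2 \<partial>std_exponential"
  let ?m = "\<integral>y. g y \<partial>std_exponential"
  have sq: "integrable std_exponential (\<lambda>y. (g y)\<^sup>2)"
    by (rule std_exponential_square_integrable[OF g bound])
  have em: "K n < N n \<Longrightarrow> (\<lambda>x. excess_sum g (K n) (N n) (\<lambda>i. Y i x)) \<in> borel_measurable M" for n
    by (rule excess_sum_measurable) auto
  show "\<forall>\<^sub>F n in sequentially. (\<lambda>x. sqrt (real (K (fst (n, x)))) * (avg g (n, x) - ?m)) \<in> borel_measurable M"
    using K_less_N
  proof eventually_elim
    case (elim n)
    from em[OF this] have [measurable]: "(\<lambda>x. excess_sum g (K n) (N n) (\<lambda>i. Y i x)) \<in> borel_measurable M" .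
    show ?case by (simp add: avg_def)
  qed
  show "\<forall>\<^sub>F n in sequentially. \<forall>a>0. prob {x \<in> space M. a < \<bar>sqrt (real (K (fst (n, x)))) * (avg g (n, x) - ?m)\<bar>} \<le> ?v / a\<^sup>2"
    using K_less_N
  proof eventually_elim
    case (elim n)
    show ?case
    proof (intro allI impI)
      fix b :: real assume b: "0 < b"
      from em[OF elim] have [measurable]: "(\<lambda>x. excess_sum g (K n) (N n) (\<lambda>i. Y i x)) \<in> borel_measurable M" .
      have impl: "b * sqrt (real (K n)) \<le> \<bar>e - K n * ?m\<bar>" if "b < \<bar>sqrt (real (K n)) * (e / K n - ?m)\<bar>" for e
      proof -
        have "b * sqrt (real (K n)) \<le> \<bar>sqrt (real (K n)) * (e / K n - ?m)\<bar> * sqrt (real (K n))"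
          using that by (intro mult_right_mono) auto
        also have "\<dots> = \<bar>(sqrt (real (K n)) * sqrt (real (K n))) * (e / K n - ?m)\<bar>"
          by (simp add: abs_mult)
        also have "(sqrt (real (K n)) * sqrt (real (K n))) * (e / K n - ?m) = e - K n * ?m"
          using K_pos'[of n] by (simp add: field_simps)
        finally show ?thesis .
      qed
      have "prob {x \<in> space M. b < \<bar>sqrt (real (K (fst (n, x)))) * (avg g (n, x) - ?m)\<bar>} \<le>
          prob {x \<in> space M. b * sqrt (real (K n)) \<le> \<bar>excess_sum g (K n) (N n) (\<lambda>j. Y j x) - K n * ?m\<bar>}"
        using impl by (intro finite_measure_mono) (auto simp: avg_def)
      also have "\<dots> \<le> K n * ?v / (b * sqrt (real (K n)))\<^sup>2"
        using K_pos'[of n] elim b sq by (intro excess_sum_deviation[OF indep' law]) auto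
      also have "\<dots> = ?v / b\<^sup>2" using K_pos'[of n] by (simp add: power_mult_distrib)
      finally show "prob {x \<in> space M. b < \<bar>sqrt (real (K (fst (n, x)))) * (avg g (n, x) - ?m)\<bar>} \<le> ?v / b\<^sup>2" .
    qed
  qed
qed

lemma avg_stoch_bounded:
  assumes g: "g \<in> borel_measurable borel" and bound: "\<And>y. 0 \<le> y \<Longrightarrow> \<bar>g y\<bar> \<le> C * exp (y / 3)"
  shows "stoch_bounded (avg g)"
proof -
  let ?m = "\<integral>y. g y \<partial>std_exponential"
  have "stoch_bounded (\<lambda>z. 1 / sqrt (real (K (fst z))) * (sqrt (real (K (fst z))) * (avg g z - ?m)) + ?m)"
    by (intro stoch_bounded_add stoch_bounded_mult stoch_bounded_const avg_bounded[OF g bound]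
        stoch_bounded_fst[OF inverse_sqrt_K_bounded])
  thus ?thesis using K_pos'(1) by simp
qed

text \<open>\<open>S / 2\<close> diverges and is therefore an admissible bound for the
  stochastically bounded quantity \<open>sqrt K * (Z - S)\<close>. As \<open>sqrt K \<ge> 1\<close>,
  the threshold stays above \<open>S / 2\<close> with high probability.\<close>

lemma Z_top: "filterlim Z at_top whp"
proof -
  have S2: "filterlim (\<lambda>n. 1 / 2 * S n) at_top sequentially"
    by (rule filterlim_tendsto_pos_mult_at_top[OF tendsto_const _ S_top]) simp
  have "eventually (\<lambda>z. \<bar>sqrt (real (K (fst z))) * (Z z - S (fst z))\<bar> \<le> 1 / 2 * S (fst z)) whp"
    by (rule stoch_boundedD[OF threshold_bounded S2])
  hence "eventually (\<lambda>z. 1 / 2 * S (fst z) \<le> Z z) whp"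
  proof eventually_elim
    case (elim z)
    have "1 * \<bar>Z z - S (fst z)\<bar> \<le> \<bar>sqrt (real (K (fst z))) * (Z z - S (fst z))\<bar>"
      unfolding abs_mult using sqrt_K_ge_1[of "fst z"] by (intro mult_right_mono) auto
    from order_trans[OF this elim] have "\<bar>Z z - S (fst z)\<bar> \<le> S (fst z) / 2" by simp
    moreover have "S (fst z) - Z z \<le> \<bar>Z z - S (fst z)\<bar>" by (metis abs_ge_self abs_minus_commute)
    ultimately show ?case by linarith
  qed
  thus ?thesis by (rule filterlim_at_top_mono[OF at_top_fst_whp[OF S2]])
qed

text \<open>If \<open>K\<close> stays bounded, \<open>Z - S\<close> need not vanish, so
  \<open>a (Z z)\<close> and \<open>a (S n)\<close> need not be equivalent. The two-sided growth
  bound still compares them, up to a factor that is bounded in probability.\<close>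

lemma rate_at_threshold_bounded: "stoch_bounded (\<lambda>z. sqrt (real (K (fst z))) * a (Z z))"
proof -
  obtain C s0 where C: "C \<ge> 0" "\<And>s s'. s0 \<le> s \<Longrightarrow> s0 \<le> s' \<Longrightarrow> \<bar>a s'\<bar> \<le> C * exp (C * \<bar>s' - s\<bar>) * \<bar>a s\<bar>"
    by (rule two_sided_growth) blast
  have "stoch_bounded (\<lambda>z. C * exp (C * \<bar>sqrt (real (K (fst z))) * (Z z - S (fst z))\<bar>) *
      (sqrt (real (K (fst z))) * a (S (fst z))))"
    using bias unfolding S_def[symmetric]
    by (intro stoch_bounded_mult stoch_bounded_const stoch_bounded_exp threshold_bounded C(1) stoch_bounded_fst)
  thus ?thesis
  proof (rule stoch_bounded_mono)
    have "eventually (\<lambda>z. s0 \<le> Z z) whp" using Z_top by (simp add: filterlim_at_top)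
    moreover have "eventually (\<lambda>z. s0 \<le> S (fst z)) whp"
      using S_top by (intro eventually_fst_whp) (simp add: filterlim_at_top)
    ultimately show "\<forall>\<^sub>F z in whp. \<bar>sqrt (real (K (fst z))) * a (Z z)\<bar> \<le>
        \<bar>C * exp (C * \<bar>sqrt (real (K (fst z))) * (Z z - S (fst z))\<bar>) * (sqrt (real (K (fst z))) * a (S (fst z)))\<bar>"
    proof eventually_elim
      case (elim z)
      have "1 * \<bar>Z z - S (fst z)\<bar> \<le> \<bar>sqrt (real (K (fst z))) * (Z z - S (fst z))\<bar>"
        unfolding abs_mult using sqrt_K_ge_1[of "fst z"] by (intro mult_right_mono) auto
      hence e: "exp (C * \<bar>Z z - S (fst z)\<bar>) \<le> exp (C * \<bar>sqrt (real (K (fst z))) * (Z z - S (fst z))\<bar>)"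
        using C(1) by (simp add: mult_left_mono)
      have "\<bar>a (Z z)\<bar> \<le> C * exp (C * \<bar>Z z - S (fst z)\<bar>) * \<bar>a (S (fst z))\<bar>" using C(2) elim by blast
      also have "\<dots> \<le> C * exp (C * \<bar>sqrt (real (K (fst z))) * (Z z - S (fst z))\<bar>) * \<bar>a (S (fst z))\<bar>"
        by (intro mult_right_mono mult_left_mono e C(1)) auto
      finally have "sqrt (real (K (fst z))) * \<bar>a (Z z)\<bar> \<le> sqrt (real (K (fst z))) *
          (C * exp (C * \<bar>sqrt (real (K (fst z))) * (Z z - S (fst z))\<bar>) * \<bar>a (S (fst z))\<bar>)"
        by (rule mult_left_mono) simp
      thus ?case using C(1) by (simp add: abs_mult mult_ac)
    qed
  qed
qed

lemma excess_nonneg: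
  assumes "K n < N n" "i \<in> {1..K n}"
  shows "0 \<le> order_stat (N n - i + 1) (N n) y - order_stat (N n - K n) (N n) y"
  using order_stat_mono_index[of "N n - K n" "N n - i + 1" "N n" y] assms by auto

text \<open>The growth bound for \<open>\<psi>\<close>, started at the random threshold, separates
  the rate \<open>a (Z z)\<close> from an average of \<open>exp (y / 3)\<close> over the excesses;
  both are under control without \<open>K\<close> diverging.\<close>

lemma dev_bounded: "stoch_bounded (\<lambda>z. sqrt (real (K (fst z))) * dev z)"
proof -
  obtain C where C: "C \<ge> 0"
    "eventually (\<lambda>s. \<forall>y\<ge>0. \<bar>\<psi> (s + y) - \<psi> s\<bar> \<le> C * \<bar>a s\<bar> * exp (y / 4)) at_top"
    using \<psi>_growth .
  have "stoch_bounded (\<lambda>z. C * (sqrt (real (K (fst z))) * a (Z z)) * avg (\<lambda>y. exp (y / 3)) z)"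
    by (intro stoch_bounded_mult stoch_bounded_const rate_at_threshold_bounded avg_stoch_bounded[where C = 1]) auto
  thus ?thesis
  proof (rule stoch_bounded_mono)
    show "\<forall>\<^sub>F z in whp. \<bar>sqrt (real (K (fst z))) * dev z\<bar> \<le>
        \<bar>C * (sqrt (real (K (fst z))) * a (Z z)) * avg (\<lambda>y. exp (y / 3)) z\<bar>"
      using eventually_compose_filterlim[OF C(2) Z_top] eventually_fst_whp[OF K_less_N]
    proof eventually_elim
      case (elim z)
      let ?n = "fst z"
      let ?o = "\<lambda>i. order_stat (N ?n - i + 1) (N ?n) (\<lambda>i. Y i (snd z))"
      have "\<bar>\<Sum>i=1..K ?n. \<psi> (?o i) - \<psi> (Z z)\<bar> \<le> (\<Sum>i=1..K ?n. \<bar>\<psi> (?o i) - \<psi> (Z z)\<bar>)"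
        by (rule sum_abs)
      also have "\<dots> \<le> (\<Sum>i=1..K ?n. C * \<bar>a (Z z)\<bar> * exp ((?o i - Z z) / 3))"
      proof (rule sum_mono)
        fix i assume i: "i \<in> {1..K ?n}"
        have nn: "0 \<le> ?o i - Z z" using excess_nonneg[OF elim(2) i] by (simp add: Z_def)
        have "\<bar>\<psi> (?o i) - \<psi> (Z z)\<bar> \<le> C * \<bar>a (Z z)\<bar> * exp ((?o i - Z z) / 4)"
          using elim(1)[rule_format, OF nn] by simp
        also have "\<dots> \<le> C * \<bar>a (Z z)\<bar> * exp ((?o i - Z z) / 3)"
          using C(1) nn by (intro mult_left_mono) auto
        finally show "\<bar>\<psi> (?o i) - \<psi> (Z z)\<bar> \<le> C * \<bar>a (Z z)\<bar> * exp ((?o i - Z z) / 3)" .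
      qed
      also have "\<dots> = C * \<bar>a (Z z)\<bar> * excess_sum (\<lambda>y. exp (y / 3)) (K ?n) (N ?n) (\<lambda>i. Y i (snd z))"
        by (simp add: excess_sum_def Z_def sum_distrib_left)
      finally have "\<bar>dev z\<bar> \<le> C * \<bar>a (Z z)\<bar> * avg (\<lambda>y. exp (y / 3)) z"
        unfolding dev_def avg_def using K_pos'[of ?n] by (simp add: abs_divide divide_right_mono)
      hence "sqrt (real (K ?n)) * \<bar>dev z\<bar> \<le> sqrt (real (K ?n)) * (C * \<bar>a (Z z)\<bar> * avg (\<lambda>y. exp (y / 3)) z)"
        by (rule mult_left_mono) simp
      moreover have "0 \<le> avg (\<lambda>y. exp (y / 3)) z" unfolding avg_def excess_sum_def
        by (intro divide_nonneg_nonneg sum_nonneg) auto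
      ultimately show ?case using C(1) by (simp add: abs_mult mult_ac)
    qed
  qed
qed

lemma avg_tendsto:
  assumes K_top: "filterlim K at_top sequentially"
    and g: "g \<in> borel_measurable borel" and bound: "\<And>y. 0 \<le> y \<Longrightarrow> \<bar>g y\<bar> \<le> C * exp (y / 3)"
  shows "(avg g \<longlongrightarrow> (\<integral>y. g y \<partial>std_exponential)) whp"
proof -
  have "filterlim (\<lambda>n. sqrt (real (K n))) at_top sequentially"
    by (rule filterlim_compose[OF sqrt_at_top filterlim_compose[OF filterlim_real_sequentially K_top]])
  hence "(\<lambda>n. 1 / sqrt (real (K n))) \<longlonglongrightarrow> 0"
    by (intro tendsto_divide_0[OF tendsto_const] filterlim_at_top_imp_at_infinity)
  from stoch_bounded_null[OF avg_bounded[OF g bound] this]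
  have "((\<lambda>z. avg g z - (\<integral>y. g y \<partial>std_exponential)) \<longlongrightarrow> 0) whp"
    using K_pos'(1) by simp
  thus ?thesis by (rule LIM_zero_cancel)
qed

text \<open>Replacing each increment of \<open>\<psi>\<close> by \<open>a (Z z)\<close> times
  \<open>box_cox \<rho>\<close> of the excess leaves a product: \<open>sqrt K * a (Z z)\<close>
  tends to \<open>\<Lambda>\<close>, and the average of \<open>box_cox \<rho>\<close> to its mean
  \<open>1 / (1 - \<rho>)\<close>.\<close>

lemma dev_tendsto:
  assumes K_top: "filterlim K at_top sequentially"
    and lim: "(\<lambda>n. sqrt (real (K n)) * a (S n)) \<longlonglongrightarrow> \<Lambda>"
  shows "((\<lambda>z. sqrt (real (K (fst z))) * dev z) \<longlongrightarrow> \<Lambda> / (1 - \<rho>)) whp"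
proof -
  let ?K = "\<lambda>z. sqrt (real (K (fst z)))"
  have sK: "filterlim (\<lambda>n. sqrt (real (K n))) at_top sequentially"
    by (rule filterlim_compose[OF sqrt_at_top filterlim_compose[OF filterlim_real_sequentially K_top]])
  hence "(\<lambda>n. 1 / sqrt (real (K n))) \<longlonglongrightarrow> 0"
    by (intro tendsto_divide_0[OF tendsto_const] filterlim_at_top_imp_at_infinity)
  from stoch_bounded_null[OF threshold_bounded this]
  have ZS: "((\<lambda>z. Z z - S (fst z)) \<longlongrightarrow> 0) whp" using K_pos'(1) by simp
  have Sw: "filterlim (\<lambda>z. S (fst z)) at_top whp" by (rule at_top_fst_whp[OF S_top])
  have T: "((\<lambda>z. ?K z * a (Z z)) \<longlongrightarrow> \<Lambda>) whp"
  proof -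
    have "((\<lambda>z. ?K z * a (S (fst z)) * (a (S (fst z) + (Z z - S (fst z))) / a (S (fst z)))) \<longlongrightarrow> \<Lambda> * exp (\<rho> * 0)) whp"
      by (intro tendsto_mult a_ratio_tendsto[OF Sw ZS] tendsto_fst_whp[OF lim])
    hence "((\<lambda>z. ?K z * a (S (fst z)) * (a (S (fst z) + (Z z - S (fst z))) / a (S (fst z)))) \<longlongrightarrow> \<Lambda>) whp" by simp
    thus ?thesis
      by (rule Lim_transform_eventually) (use a_nonzero'[OF Sw] in \<open>auto elim!: eventually_mono\<close>)
  qed
  have box: "(avg (box_cox \<rho>) \<longlongrightarrow> 1 / (1 - \<rho>)) whp"
    unfolding std_exponential_box_cox_mean[OF \<rho>_nonpos, symmetric]
  proof (rule avg_tendsto[OF K_top, where C = 3])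
    fix y :: real assume y: "0 \<le> y"
    have "1 + y / 3 \<le> exp (y / 3)" by (rule exp_ge_add_one_self)
    with box_cox_nonneg[OF \<rho>_nonpos y] box_cox_le[OF \<rho>_nonpos y] y
    show "\<bar>box_cox \<rho> y\<bar> \<le> 3 * exp (y / 3)" by linarith
  qed simp
  have sb: "((\<lambda>z. ?K z * a (Z z) * avg (\<lambda>y. exp (y / 3)) z) \<longlongrightarrow> \<Lambda> * (\<integral>y. exp (y / 3) \<partial>std_exponential)) whp"
    by (intro tendsto_mult T avg_tendsto[OF K_top, where C = 1]) auto
  \<comment> \<open>An upper bound, valid with high probability, for the factor that multiplies
    \<open>\<epsilon>\<close> in the error; hence the choice
    \<open>\<epsilon> = e / B\<close>.\<close>
  define B where "B = \<bar>\<Lambda> * (\<integral>y. exp (y / 3) \<partial>std_exponential)\<bar> + 1"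
  have B: "0 < B" by (simp add: B_def add_nonneg_pos)
  have Bev: "eventually (\<lambda>z. \<bar>?K z * a (Z z) * avg (\<lambda>y. exp (y / 3)) z\<bar> < B) whp"
    using tendsto_rabs[OF sb] by (rule order_tendstoD) (simp add: B_def)
  have diff: "((\<lambda>z. ?K z * dev z - ?K z * a (Z z) * avg (box_cox \<rho>) z) \<longlongrightarrow> 0) whp"
  proof (rule tendstoI)
    fix e :: real assume e: "0 < e"
    define \<epsilon> where "\<epsilon> = e / B"
    have \<epsilon>: "0 < \<epsilon>" using e B by (simp add: \<epsilon>_def)
    show "eventually (\<lambda>z. dist (?K z * dev z - ?K z * a (Z z) * avg (box_cox \<rho>) z) 0 < e) whp"
      using eventually_compose_filterlim[OF \<psi>_increment_dominated[OF \<epsilon>] Z_top] Bev a_nonzero'[OF Z_top]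
        eventually_fst_whp[OF K_less_N]
    proof eventually_elim
      case (elim z)
      let ?n = "fst z"
      let ?o = "\<lambda>i. order_stat (N ?n - i + 1) (N ?n) (\<lambda>i. Y i (snd z))"
      have eq: "dev z - a (Z z) * avg (box_cox \<rho>) z =
          (\<Sum>i=1..K ?n. \<psi> (?o i) - \<psi> (Z z) - a (Z z) * box_cox \<rho> (?o i - Z z)) / real (K ?n)"
        by (simp add: dev_def avg_def excess_sum_def Z_def sum_subtractf sum_distrib_left diff_divide_distrib)
      have "\<bar>dev z - a (Z z) * avg (box_cox \<rho>) z\<bar> \<le> (\<Sum>i=1..K ?n. \<epsilon> * \<bar>a (Z z)\<bar> * exp ((?o i - Z z) / 3)) / real (K ?n)"
        unfolding eq abs_divide abs_of_nat
      proof (intro divide_right_mono order_trans[OF sum_abs] sum_mono)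
        fix i assume i: "i \<in> {1..K ?n}"
        have nn: "0 \<le> ?o i - Z z" using excess_nonneg[OF elim(4) i] by (simp add: Z_def)
        have "\<bar>\<psi> (?o i) - \<psi> (Z z) - a (Z z) * box_cox \<rho> (?o i - Z z)\<bar> =
            \<bar>(\<psi> (?o i) - \<psi> (Z z)) / a (Z z) - box_cox \<rho> (?o i - Z z)\<bar> * \<bar>a (Z z)\<bar>"
          unfolding abs_mult[symmetric] left_diff_distrib[of _ _ "a (Z z)"] using elim(3) by (simp add: mult.commute)
        also have "\<dots> \<le> \<epsilon> * exp ((?o i - Z z) / 3) * \<bar>a (Z z)\<bar>"
          using elim(1)[rule_format, OF nn] by (intro mult_right_mono) auto
        finally show "\<bar>\<psi> (?o i) - \<psi> (Z z) - a (Z z) * box_cox \<rho> (?o i - Z z)\<bar> \<le> \<epsilon> * \<bar>a (Z z)\<bar> * exp ((?o i - Z z) / 3)"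
          by (simp add: mult_ac)
      qed simp
      also have "(\<Sum>i=1..K ?n. \<epsilon> * \<bar>a (Z z)\<bar> * exp ((?o i - Z z) / 3)) / real (K ?n) = \<epsilon> * \<bar>a (Z z)\<bar> * avg (\<lambda>y. exp (y / 3)) z"
        by (simp add: avg_def excess_sum_def Z_def sum_distrib_left)
      finally have 1: "?K z * \<bar>dev z - a (Z z) * avg (box_cox \<rho>) z\<bar> \<le> ?K z * (\<epsilon> * \<bar>a (Z z)\<bar> * avg (\<lambda>y. exp (y / 3)) z)"
        by (rule mult_left_mono) simp
      have "0 \<le> avg (\<lambda>y. exp (y / 3)) z" unfolding avg_def excess_sum_def
        by (intro divide_nonneg_nonneg sum_nonneg) auto
      hence 2: "?K z * (\<epsilon> * \<bar>a (Z z)\<bar> * avg (\<lambda>y. exp (y / 3)) z) = \<epsilon> * \<bar>?K z * a (Z z) * avg (\<lambda>y. exp (y / 3)) z\<bar>"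
        by (simp add: abs_mult mult_ac)
      have "\<epsilon> * \<bar>?K z * a (Z z) * avg (\<lambda>y. exp (y / 3)) z\<bar> < \<epsilon> * B" using elim(2) \<epsilon> by (intro mult_strict_left_mono)
      moreover have "\<epsilon> * B = e" using B by (simp add: \<epsilon>_def)
      ultimately have "\<bar>?K z * (dev z - a (Z z) * avg (box_cox \<rho>) z)\<bar> < e"
        using 1 2 unfolding abs_mult by simp
      thus ?case by (simp add: dist_norm right_diff_distrib mult.assoc)
    qed
  qed
  from tendsto_add[OF diff tendsto_mult[OF T box]]
  show ?thesis by simp
qed

end

section \<open>Sums over independent samples\<close>

text \<open>Order statistics pass through the monotone map \<open>Q\<close>, and
  \<open>ln (Q s)\<close> is \<open>\<gamma> * s + \<psi> s\<close>. Positivity is assumed at the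
  threshold only and spreads upwards by monotonicity.\<close>

lemma (in continuous_distribution) hill_of_exponentials:
  fixes \<gamma> :: real and x y :: "nat \<Rightarrow> real"
  assumes y: "\<And>i. i \<in> {1..n} \<Longrightarrow> 0 < y i" and x: "\<And>i. i \<in> {1..n} \<Longrightarrow> x i = Q (y i)"
    and k: "1 \<le> k" "k < n" and pos: "0 < Q (order_stat (n - k) n y)"
  defines "\<psi> \<equiv> \<lambda>s. ln (Q s) - \<gamma> * s"
  shows "order_stat (n - k) n x = Q (order_stat (n - k) n y)"
    and "hill k n x = \<gamma> * (excess_sum (\<lambda>e. e) k n y / real k) +
      (\<Sum>i=1..k. \<psi> (order_stat (n - i + 1) n y) - \<psi> (order_stat (n - k) n y)) / real k"
proof -
  have os: "order_stat i n x = Q (order_stat i n y)" if "1 \<le> i" "i \<le> n" for i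
  proof -
    have "order_stat i n x = order_stat i n (\<lambda>j. Q (y j))" by (rule order_stat_cong) (rule x)
    also have "\<dots> = Q (order_stat i n y)"
      by (rule order_stat_mono_on[where S = "{0<..}"]) (use that y in \<open>auto intro!: mono_onI Q_mono\<close>)
    finally show ?thesis .
  qed
  show Z: "order_stat (n - k) n x = Q (order_stat (n - k) n y)" by (rule os) (use k in auto)
  have zpos: "0 < order_stat (n - k) n y"
  proof -
    have "order_stat (n - k) n y \<in> y ` {1..n}" by (rule order_stat_mem) (use k in auto)
    thus ?thesis using y by auto
  qed
  have "ln (order_stat (n - i + 1) n x / order_stat (n - k) n x) =
      \<gamma> * (order_stat (n - i + 1) n y - order_stat (n - k) n y) +
      (\<psi> (order_stat (n - i + 1) n y) - \<psi> (order_stat (n - k) n y))" if i: "i \<in> {1..k}" for i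
  proof -
    have le: "order_stat (n - k) n y \<le> order_stat (n - i + 1) n y"
      by (rule order_stat_mono_index) (use i k in auto)
    have "0 < Q (order_stat (n - i + 1) n y)" using Q_mono[OF zpos le] pos by linarith
    moreover have "order_stat (n - i + 1) n x = Q (order_stat (n - i + 1) n y)" by (rule os) (use i k in auto)
    ultimately show ?thesis using pos by (simp add: Z ln_div \<psi>_def algebra_simps)
  qed
  hence "(\<Sum>i=1..k. ln (order_stat (n - i + 1) n x / order_stat (n - k) n x)) =
      (\<Sum>i=1..k. \<gamma> * (order_stat (n - i + 1) n y - order_stat (n - k) n y) +
      (\<psi> (order_stat (n - i + 1) n y) - \<psi> (order_stat (n - k) n y)))" by (intro sum.cong) auto
  thus "hill k n x = \<gamma> * (excess_sum (\<lambda>e. e) k n y / real k) +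
      (\<Sum>i=1..k. \<psi> (order_stat (n - i + 1) n y) - \<psi> (order_stat (n - k) n y)) / real k"
    by (simp only: hill_def excess_sum_def sum.distrib sum_distrib_left[symmetric]) (simp add: add_divide_distrib)
qed

context prob_space
begin

lemma indep_vars_column:
  fixes Y :: "nat \<Rightarrow> nat \<Rightarrow> 'a \<Rightarrow> real"
  assumes indep: "indep_vars (\<lambda>_. borel) (\<lambda>(i, j). Y i j) (I \<times> J)" and j: "j \<in> J"
  shows "indep_vars (\<lambda>_. borel) (\<lambda>i. Y i j) I"
proof -
  have "indep_vars (\<lambda>i. PiM {(i, j)} (\<lambda>_. borel)) (\<lambda>i \<omega>. restrict (\<lambda>q. (\<lambda>(i, j). Y i j) q \<omega>) {(i, j)}) I"
    by (rule indep_vars_restrict[OF indep]) (use j in \<open>auto simp: disjoint_family_on_def\<close>)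
  hence "indep_vars (\<lambda>_. borel) (\<lambda>i \<omega>. (restrict (\<lambda>q. (\<lambda>(i, j). Y i j) q \<omega>) {(i, j)}) (i, j)) I"
    by (rule indep_vars_compose2[where Y = "\<lambda>i v. v (i, j)"]) auto
  thus ?thesis by simp
qed

lemma indep_excess_sums:
  fixes Y :: "nat \<Rightarrow> nat \<Rightarrow> 'a \<Rightarrow> real"
  assumes indep: "indep_vars (\<lambda>_. borel) (\<lambda>(i, j). Y i j) ({1..} \<times> J)"
    and k: "\<And>j. j \<in> J \<Longrightarrow> k j < n j" and g: "g \<in> borel_measurable borel"
  shows "indep_vars (\<lambda>_. borel) (\<lambda>j x. excess_sum g (k j) (n j) (\<lambda>i. Y i j x)) J"
proof -
  have "indep_vars (\<lambda>j. PiM ({1..n j} \<times> {j}) (\<lambda>_. borel))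
      (\<lambda>j \<omega>. restrict (\<lambda>q. (\<lambda>(i, j). Y i j) q \<omega>) ({1..n j} \<times> {j})) J"
    by (rule indep_vars_restrict[OF indep]) (auto simp: disjoint_family_on_def)
  hence "indep_vars (\<lambda>_. borel) (\<lambda>j \<omega>. excess_sum g (k j) (n j)
      (\<lambda>i. (restrict (\<lambda>q. (\<lambda>(i, j). Y i j) q \<omega>) ({1..n j} \<times> {j})) (i, j))) J"
  proof (rule indep_vars_compose2[where Y = "\<lambda>j v. excess_sum g (k j) (n j) (\<lambda>i. v (i, j))"])
    fix j assume j: "j \<in> J"
    show "(\<lambda>v. excess_sum g (k j) (n j) (\<lambda>i. v (i, j))) \<in> borel_measurable (PiM ({1..n j} \<times> {j}) (\<lambda>_. borel))"
      by (rule excess_sum_measurable[where f = "\<lambda>i v. v (i, j)"]) (use k[OF j] g in auto)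
  qed
  also have "?this \<longleftrightarrow> ?thesis"
    by (intro indep_vars_cong refl ext)
       (auto simp: excess_sum_def intro!: sum.cong arg_cong[where f = g] arg_cong2[where f = minus] order_stat_cong)
  finally show ?thesis .
qed

text \<open>The characteristic function of the total is the product of the powers with exponents
  \<open>k j\<close>, hence depends on their sum only. The right side takes all its variables from
  column 1, so that it is a partial sum of one fixed sequence.\<close>

lemma total_excess_law:
  fixes Y :: "nat \<Rightarrow> nat \<Rightarrow> 'a \<Rightarrow> real"
  assumes indep: "indep_vars (\<lambda>_. borel) (\<lambda>(i, j). Y i j) ({1..} \<times> {1..m})"
    and law: "\<And>i j. 1 \<le> i \<Longrightarrow> j \<in> {1..m} \<Longrightarrow> distr M borel (Y i j) = std_exponential"
    and k: "\<And>j. j \<in> {1..m} \<Longrightarrow> k j < n j" and m: "1 \<le> m"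
  shows "distr M borel (\<lambda>x. \<Sum>j=1..m. excess_sum (\<lambda>e. e) (k j) (n j) (\<lambda>i. Y i j x)) =
    distr M borel (\<lambda>x. \<Sum>i<(\<Sum>j=1..m. k j). Y (Suc i) 1 x)"
proof -
  let ?phi = "char std_exponential"
  have col: "indep_vars (\<lambda>_. borel) (\<lambda>i. Y i j) {1..}" if "j \<in> {1..m}" for j
    by (rule indep_vars_column[OF indep that])
  have rv: "random_variable borel (Y i j)" if "1 \<le> i" "j \<in> {1..m}" for i j
    using col[OF that(2)] that(1) by (simp add: indep_vars_def2)
  have ind1: "indep_vars (\<lambda>_. borel) (\<lambda>j x. excess_sum (\<lambda>e. e) (k j) (n j) (\<lambda>i. Y i j x)) {1..m}"
    by (rule indep_excess_sums[OF indep k]) auto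
  have ind2: "indep_vars (\<lambda>_. borel) (\<lambda>i. Y (Suc i) 1) {..<q}" for q
  proof -
    have "indep_vars (\<lambda>i. PiM {Suc i} (\<lambda>_. borel)) (\<lambda>i \<omega>. restrict (\<lambda>q. Y q 1 \<omega>) {Suc i}) {..<q}"
      by (rule indep_vars_restrict[OF col[of 1]]) (use m in \<open>auto simp: disjoint_family_on_def\<close>)
    hence "indep_vars (\<lambda>_. borel) (\<lambda>i \<omega>. (restrict (\<lambda>q. Y q 1 \<omega>) {Suc i}) (Suc i)) {..<q}"
      by (rule indep_vars_compose2[where Y = "\<lambda>i v. v (Suc i)"]) auto
    thus ?thesis by simp
  qed
  have id: "distr std_exponential borel (\<lambda>e. e) = std_exponential"
    by (rule distr_id2) simp
  show ?thesis
  proof (rule Levy_uniqueness)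
    show "real_distribution (distr M borel (\<lambda>x. \<Sum>j=1..m. excess_sum (\<lambda>e. e) (k j) (n j) (\<lambda>i. Y i j x)))"
      by (intro real_distribution_distr borel_measurable_sum excess_sum_measurable rv k) auto
    show "real_distribution (distr M borel (\<lambda>x. \<Sum>i<(\<Sum>j=1..m. k j). Y (Suc i) 1 x))"
      by (intro real_distribution_distr borel_measurable_sum rv) (use m in auto)
    show "char (distr M borel (\<lambda>x. \<Sum>j=1..m. excess_sum (\<lambda>e. e) (k j) (n j) (\<lambda>i. Y i j x))) =
      char (distr M borel (\<lambda>x. \<Sum>i<(\<Sum>j=1..m. k j). Y (Suc i) 1 x))"
    proof
      fix t
      have "char (distr M borel (\<lambda>x. \<Sum>j=1..m. excess_sum (\<lambda>e. e) (k j) (n j) (\<lambda>i. Y i j x))) t =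
          (\<Prod>j=1..m. ?phi t ^ k j)"
        unfolding char_distr_sum[OF ind1]
      proof (rule prod.cong)
        fix j assume j: "j \<in> {1..m}"
        show "char (distr M borel (\<lambda>x. excess_sum (\<lambda>e. e) (k j) (n j) (\<lambda>i. Y i j x))) t = ?phi t ^ k j"
          using char_excess_sum[OF indep_vars_subset[OF col[OF j]] law[OF _ j] k[OF j], of "\<lambda>e. e" t]
          by (simp add: id)
      qed simp
      also have "\<dots> = ?phi t ^ (\<Sum>j=1..m. k j)" by (simp add: power_sum)
      also have "\<dots> = (\<Prod>i<(\<Sum>j=1..m. k j). char (distr M borel (Y (Suc i) 1)) t)"
        using m by (simp add: law)
      also have "\<dots> = char (distr M borel (\<lambda>x. \<Sum>i<(\<Sum>j=1..m. k j). Y (Suc i) 1 x)) t"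
        by (rule char_distr_sum[OF ind2, symmetric])
      finally show "char (distr M borel (\<lambda>x. \<Sum>j=1..m. excess_sum (\<lambda>e. e) (k j) (n j) (\<lambda>i. Y i j x))) t =
        char (distr M borel (\<lambda>x. \<Sum>i<(\<Sum>j=1..m. k j). Y (Suc i) 1 x)) t" .
    qed
  qed
qed

section \<open>Central limit theorem for the pooled excess\<close>

lemma weak_conv_m_cong:
  assumes "weak_conv_m \<mu> L" "\<forall>\<^sub>F n in sequentially. \<mu> n = \<nu> n"
  shows "weak_conv_m \<nu> L"
  unfolding weak_conv_m_def weak_conv_def
proof (intro allI impI)
  fix x assume "isCont (cdf L) x"
  with assms(1) have "(\<lambda>n. cdf (\<mu> n) x) \<longlonglongrightarrow> cdf L x" by (simp add: weak_conv_m_def weak_conv_def)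
  thus "(\<lambda>n. cdf (\<nu> n) x) \<longlonglongrightarrow> cdf L x"
    by (rule Lim_transform_eventually) (use assms(2) in \<open>auto elim!: eventually_mono\<close>)
qed

lemma weak_conv_m_compose:
  assumes "weak_conv_m \<mu> L" "filterlim k sequentially sequentially"
  shows "weak_conv_m (\<lambda>n. \<mu> (k n)) L"
  unfolding weak_conv_m_def weak_conv_def
proof (intro allI impI)
  fix x assume "isCont (cdf L) x"
  with assms(1) have "(\<lambda>n. cdf (\<mu> n) x) \<longlonglongrightarrow> cdf L x" by (simp add: weak_conv_m_def weak_conv_def)
  thus "(\<lambda>n. cdf (\<mu> (k n)) x) \<longlonglongrightarrow> cdf L x" by (rule filterlim_compose[OF _ assms(2)])
qed

text \<open>Since the law of the total is that of a partial sum of a fixed i.i.d. sequence, the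
  classical theorem evaluated along \<open>k n\<close> suffices, and no triangular array has to be
  treated.\<close>

lemma total_excess_clt:
  fixes Y :: "nat \<Rightarrow> nat \<Rightarrow> 'a \<Rightarrow> real"
  assumes indep: "indep_vars (\<lambda>_. borel) (\<lambda>(i, j). Y i j) ({1..} \<times> {1..m})"
    and law: "\<And>i j. 1 \<le> i \<Longrightarrow> j \<in> {1..m} \<Longrightarrow> distr M borel (Y i j) = std_exponential"
    and K: "\<forall>\<^sub>F n in sequentially. \<forall>j\<in>{1..m}. K j n < N j n" and m: "1 \<le> m"
    and k: "filterlim (\<lambda>n. \<Sum>j=1..m. K j n) sequentially sequentially"
  shows "weak_conv_m (\<lambda>n. distr M borel (\<lambda>x. ((\<Sum>j=1..m. excess_sum (\<lambda>e. e) (K j n) (N j n) (\<lambda>i. Y i j x)) -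
      real (\<Sum>j=1..m. K j n)) / sqrt (real (\<Sum>j=1..m. K j n)))) std_normal_distribution"
proof -
  have col: "indep_vars (\<lambda>_. borel) (\<lambda>i. Y i j) {1..}" if "j \<in> {1..m}" for j
    by (rule indep_vars_column[OF indep that])
  have rv: "random_variable borel (Y i j)" if "1 \<le> i" "j \<in> {1..m}" for i j
    using col[OF that(2)] that(1) by (simp add: indep_vars_def2)
  have m1: "1 \<in> {1..m}" using m by simp
  have "indep_vars (\<lambda>i. PiM {Suc i} (\<lambda>_. borel)) (\<lambda>i \<omega>. restrict (\<lambda>q. Y q 1 \<omega>) {Suc i}) UNIV"
    by (rule indep_vars_restrict[OF col[OF m1]]) (auto simp: disjoint_family_on_def)
  hence "indep_vars (\<lambda>_. borel) (\<lambda>i \<omega>. (restrict (\<lambda>q. Y q 1 \<omega>) {Suc i}) (Suc i)) UNIV"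
    by (rule indep_vars_compose2[where Y = "\<lambda>i v. v (Suc i)"]) auto
  hence ind: "indep_vars (\<lambda>_. borel) (\<lambda>i. Y (Suc i) 1) UNIV" by simp
  have rv1 [measurable]: "random_variable borel (Y (Suc i) 1)" for i by (rule rv) (use m1 in auto)
  have law1: "distr M borel (Y (Suc i) 1) = std_exponential" for i by (rule law) (use m1 in auto)
  have int: "integrable M (Y (Suc i) 1)" for i
    using std_exponential_second_moment(1) unfolding law1[of i, symmetric] by (subst (asm) integrable_distr_eq) (use rv1[of i] in auto)
  have sq: "integrable M (\<lambda>x. (Y (Suc i) 1 x)\<^sup>2)" for i
    using std_exponential_second_moment(2) unfolding law1[of i, symmetric] by (subst (asm) integrable_distr_eq) (use rv1[of i] in auto)
  have mean: "expectation (Y (Suc i) 1) = 1" for i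
    using std_exponential_mean unfolding law1[of i, symmetric] by (subst (asm) integral_distr) (use rv1[of i] in auto)
  have m2: "expectation (\<lambda>x. (Y (Suc i) 1 x)\<^sup>2) = 2" for i
    using std_exponential_second_moment(3) unfolding law1[of i, symmetric] by (subst (asm) integral_distr) (use rv1[of i] in auto)
  have var: "variance (Y (Suc i) 1) = 1\<^sup>2" for i
  proof -
    have "variance (Y (Suc i) 1) = expectation (\<lambda>x. (Y (Suc i) 1 x)\<^sup>2) - (expectation (Y (Suc i) 1))\<^sup>2"
      by (rule variance_eq[OF int sq])
    also have "\<dots> = 1\<^sup>2" unfolding mean m2 by simp
    finally show ?thesis .
  qed
  have "weak_conv_m (\<lambda>q. distr M borel (\<lambda>x. (\<Sum>i<q. Y (Suc i) 1 x - 1) / sqrt (real q * 1\<^sup>2))) std_normal_distribution"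
    by (rule central_limit_theorem[OF ind mean _ sq var law1]) simp
  from weak_conv_m_compose[OF this k]
  show ?thesis
  proof (rule weak_conv_m_cong)
    show "\<forall>\<^sub>F n in sequentially. distr M borel (\<lambda>x. (\<Sum>i<\<Sum>j=1..m. K j n. Y (Suc i) 1 x - 1) / sqrt (real (\<Sum>j=1..m. K j n) * 1\<^sup>2)) =
        distr M borel (\<lambda>x. ((\<Sum>j=1..m. excess_sum (\<lambda>e. e) (K j n) (N j n) (\<lambda>i. Y i j x)) -
          real (\<Sum>j=1..m. K j n)) / sqrt (real (\<Sum>j=1..m. K j n)))"
      using K
    proof eventually_elim
      case (elim n)
      let ?k = "\<Sum>j=1..m. K j n"
      let ?h = "\<lambda>s. (s - real ?k) / sqrt (real ?k)"
      have t1: "(\<lambda>x. \<Sum>i<?k. Y (Suc i) 1 x) \<in> borel_measurable M" by measurable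
      have t2: "(\<lambda>x. \<Sum>j=1..m. excess_sum (\<lambda>e. e) (K j n) (N j n) (\<lambda>i. Y i j x)) \<in> borel_measurable M"
        using elim by (intro borel_measurable_sum excess_sum_measurable rv) auto
      have hm: "?h \<in> borel_measurable borel" by measurable
      have "distr M borel (\<lambda>x. (\<Sum>i<?k. Y (Suc i) 1 x - 1) / sqrt (real ?k * 1\<^sup>2)) =
          distr M borel (\<lambda>x. ?h (\<Sum>i<?k. Y (Suc i) 1 x))"
        by (simp add: sum_subtractf)
      also have "\<dots> = distr (distr M borel (\<lambda>x. \<Sum>i<?k. Y (Suc i) 1 x)) borel ?h"
        by (subst distr_distr[OF hm t1]) (simp add: comp_def)
      also have "distr M borel (\<lambda>x. \<Sum>i<?k. Y (Suc i) 1 x) =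
          distr M borel (\<lambda>x. \<Sum>j=1..m. excess_sum (\<lambda>e. e) (K j n) (N j n) (\<lambda>i. Y i j x))"
        using elim by (intro total_excess_law[OF indep law _ m, symmetric]) auto
      also have "distr \<dots> borel ?h = distr M borel (\<lambda>x. ?h (\<Sum>j=1..m. excess_sum (\<lambda>e. e) (K j n) (N j n) (\<lambda>i. Y i j x)))"
        by (subst distr_distr[OF hm t2]) (simp add: comp_def)
      finally show ?case .
    qed
  qed
qed

lemma slutsky_normal_eventually:
  assumes G: "weak_conv_m (\<lambda>n. distr M borel (G n)) std_normal_distribution" and \<sigma>: "0 < \<sigma>"
    and rvG: "\<forall>\<^sub>F n in sequentially. G n \<in> borel_measurable M"
    and rvW: "\<forall>\<^sub>F n in sequentially. W n \<in> borel_measurable M"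
    and R: "((\<lambda>z. W (fst z) (snd z) - \<sigma> * G (fst z) (snd z)) \<longlongrightarrow> \<mu>) whp"
  shows "weak_conv_m (\<lambda>n. distr M borel (W n)) (density lborel (normal_density \<mu> \<sigma>))"
proof -
  \<comment> \<open>Measurability is available for large \<open>n\<close> only; the finitely many
    other terms are replaced by 0, which changes no limit.\<close>
  define cut :: "(nat \<Rightarrow> 'a \<Rightarrow> real) \<Rightarrow> nat \<Rightarrow> 'a \<Rightarrow> real"
    where "cut F n = (if F n \<in> borel_measurable M then F n else (\<lambda>_. 0))" for F n
  have eG: "\<forall>\<^sub>F n in sequentially. G n = cut G n" using rvG by eventually_elim (simp add: cut_def)
  have eW: "\<forall>\<^sub>F n in sequentially. W n = cut W n" using rvW by eventually_elim (simp add: cut_def)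
  have "weak_conv_m (\<lambda>n. distr M borel (cut W n)) (density lborel (normal_density \<mu> \<sigma>))"
  proof (rule slutsky_normal[OF _ \<sigma>])
    show "weak_conv_m (\<lambda>n. distr M borel (cut G n)) std_normal_distribution"
      by (rule weak_conv_m_cong[OF G]) (use eG in \<open>auto elim!: eventually_mono\<close>)
    show "cut G n \<in> borel_measurable M" "cut W n \<in> borel_measurable M" for n by (auto simp: cut_def)
    show "((\<lambda>(n, x). cut W n x - \<sigma> * cut G n x) \<longlongrightarrow> \<mu>) whp"
      unfolding case_prod_unfold using R
    proof (rule Lim_transform_eventually)
      show "\<forall>\<^sub>F z in whp. W (fst z) (snd z) - \<sigma> * G (fst z) (snd z) = cut W (fst z) (snd z) - \<sigma> * cut G (fst z) (snd z)"
        using eventually_fst_whp[OF eG] eventually_fst_whp[OF eW] by eventually_elim simp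
    qed
  qed
  thus ?thesis by (rule weak_conv_m_cong) (use eW in \<open>auto elim!: eventually_mono\<close>)
qed

end

lemma abs_exp_minus_one_minus_le:
  fixes v :: real
  assumes "\<bar>v\<bar> \<le> 1" shows "\<bar>exp v - 1 - v\<bar> \<le> v\<^sup>2"
proof -
  have lower: "1 + v \<le> exp v" by (rule exp_ge_add_one_self)
  have upper: "exp v \<le> 1 + v + v\<^sup>2"
  proof (cases "0 \<le> v")
    case True
    thus ?thesis using assms by (intro exp_bound) auto
  next
    case False
    have nn: "0 \<le> 1 + v + v\<^sup>2" using assms by (simp add: add_nonneg_nonneg)
    have "1 - v \<le> exp (- v)" using exp_ge_add_one_self[of "- v"] by simp
    \<comment> \<open>For negative \<open>v\<close>, the product with
      \<open>1 + v + v\<^sup>2\<close> telescopes to \<open>1 - v ^ 3\<close>, which is at least 1;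
      this bounds \<open>exp v\<close> from above.\<close>
    hence "(1 - v) * (1 + v + v\<^sup>2) \<le> exp (- v) * (1 + v + v\<^sup>2)" using nn by (rule mult_right_mono)
    moreover have "(1 - v) * (1 + v + v\<^sup>2) = 1 - v ^ 3" by (simp add: algebra_simps power2_eq_square power3_eq_cube)
    moreover have "v ^ 3 \<le> 0" using False by (simp add: power3_eq_cube mult_nonneg_nonpos mult_nonpos_nonpos)
    ultimately have "1 \<le> exp (- v) * (1 + v + v\<^sup>2)" by linarith
    hence "exp v * 1 \<le> exp v * (exp (- v) * (1 + v + v\<^sup>2))" by (intro mult_left_mono) auto
    thus ?thesis by (simp add: mult.assoc[symmetric] exp_add[symmetric])
  qed
  show ?thesis using lower upper by linarith
qed

section \<open>The pooled Hill estimator\<close>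

locale pooled_sample = prob_space P
  for P :: "'a measure" +
  fixes X :: "nat \<Rightarrow> nat \<Rightarrow> 'a \<Rightarrow> real" and D :: "real measure"
    and \<gamma> \<rho> :: real and A :: "real \<Rightarrow> real"
    and m l :: nat and N K :: "nat \<Rightarrow> nat \<Rightarrow> nat"
    and b c \<Lambda> :: "nat \<Rightarrow> real"
  assumes indep: "indep_vars (\<lambda>_. borel) (\<lambda>(i, j). X i j) ({1..} \<times> {1..m})"
    and ident: "\<And>i j. 1 \<le> i \<Longrightarrow> j \<in> {1..m} \<Longrightarrow> distr P borel (X i j) = D"
    and cont: "continuous_on UNIV (cdf D)"
    and C2: "second_order_condition (cdf D) \<gamma> \<rho> A"
    and N_top: "\<And>j. j \<in> {1..m} \<Longrightarrow> filterlim (N j) at_top sequentially"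
    and K_pos: "\<And>j n. j \<in> {1..m} \<Longrightarrow> 1 \<le> K j n"
    and l: "l \<in> {1..m - 1}"
    and low_top: "\<And>j. j \<in> {1..l} \<Longrightarrow> filterlim (K j) at_top sequentially"
    and frac: "\<And>j. j \<in> {1..m} \<Longrightarrow> (\<lambda>n. real (K j n) / real (N j n)) \<longlonglongrightarrow> 0"
    and low_b: "\<And>j. j \<in> {1..l} \<Longrightarrow> 0 < b j \<and> (\<lambda>n. real (N 1 n) / real (N j n)) \<longlonglongrightarrow> b j"
    and low_c: "\<And>j. j \<in> {1..l} \<Longrightarrow> 0 < c j \<and> (\<lambda>n. real (K 1 n) / real (K j n)) \<longlonglongrightarrow> c j"
    and low_bias: "\<And>j. j \<in> {1..l} \<Longrightarrow>
          (\<lambda>n. sqrt (real (K j n)) * A (real (N j n) / real (K j n))) \<longlonglongrightarrow> \<Lambda> j"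
    and high_negl: "\<And>j. j \<in> {l+1..m} \<Longrightarrow>
          filterlim (\<lambda>n. real (K 1 n) / real (K j n)) at_top sequentially"
    and high_bias: "\<And>j. j \<in> {l+1..m} \<Longrightarrow>
          (\<lambda>n. sqrt (real (K j n)) * A (real (N j n) / real (K j n))) \<in> O(\<lambda>_. 1)"
begin

lemma l_le: "1 \<le> l" "l \<le> m" "1 \<le> m" "1 \<in> {1..m}" "1 \<in> {1..l}"
  using l by auto

lemma low_in: "j \<in> {1..l} \<Longrightarrow> j \<in> {1..m}" using l by auto

lemma rvX: "1 \<le> i \<Longrightarrow> j \<in> {1..m} \<Longrightarrow> X i j \<in> borel_measurable P"
  using indep by (auto simp: indep_vars_def2)

sublocale D: continuous_distribution D
proof -
  have "real_distribution D"
    using real_distribution_distr[OF rvX[of 1 1]] ident[of 1 1] l_le by simp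
  thus "continuous_distribution D"
    using cont by (simp add: continuous_distribution_def cdf_distribution_def continuous_distribution_axioms_def)
qed

definition \<psi> :: "real \<Rightarrow> real" where "\<psi> = (\<lambda>s. ln (D.Q s) - \<gamma> * s)"

definition a :: "real \<Rightarrow> real" where "a = (\<lambda>s. (\<psi> (s + 1) - \<psi> s) / box_cox \<rho> 1)"

lemma \<gamma>_pos: "0 < \<gamma>" and \<rho>_le: "\<rho> \<le> 0"
  using C2 by (auto simp: second_order_condition_def)

lemma A_nonzero: "\<forall>\<^sub>F t in at_top. A t \<noteq> 0"
  using C2 unfolding second_order_condition_def by (auto elim!: eventually_mono)

sublocale erv: extended_regular_variation \<psi> a \<rho>
  unfolding a_def \<psi>_def by (rule D.second_order_log(2)[OF C2])

lemma Q_pos: "\<forall>\<^sub>F s in at_top. 0 < D.Q s"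
  by (rule D.second_order_log(1)[OF C2])

lemma a_over_A: "((\<lambda>t. a (ln t) / A t) \<longlongrightarrow> 1) at_top"
  unfolding a_def \<psi>_def by (rule D.second_order_log(3)[OF C2])

lemma tendsto_a_of_A:
  assumes "filterlim t at_top G" "((\<lambda>x. w x * A (t x)) \<longlongrightarrow> L) G"
  shows "((\<lambda>x. w x * a (ln (t x))) \<longlongrightarrow> L) G"
proof -
  have "((\<lambda>x. w x * A (t x) * (a (ln (t x)) / A (t x))) \<longlongrightarrow> L * 1) G"
    by (intro tendsto_mult assms filterlim_compose[OF a_over_A])
  hence "((\<lambda>x. w x * A (t x) * (a (ln (t x)) / A (t x))) \<longlongrightarrow> L) G" by simp
  thus ?thesis
    by (rule Lim_transform_eventually)
       (use eventually_compose_filterlim[OF A_nonzero assms(1)] in \<open>auto elim!: eventually_mono\<close>)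
qed

lemma tendsto_A_of_a:
  assumes "filterlim t at_top G" "((\<lambda>x. w x * a (ln (t x))) \<longlongrightarrow> L) G"
  shows "((\<lambda>x. w x * A (t x)) \<longlongrightarrow> L) G"
proof -
  have lnt: "filterlim (\<lambda>x. ln (t x)) at_top G" by (rule filterlim_compose[OF ln_at_top assms(1)])
  have "((\<lambda>x. w x * a (ln (t x)) / (a (ln (t x)) / A (t x))) \<longlongrightarrow> L / 1) G"
    by (intro tendsto_divide assms filterlim_compose[OF a_over_A]) simp
  hence "((\<lambda>x. w x * a (ln (t x)) / (a (ln (t x)) / A (t x))) \<longlongrightarrow> L) G" by simp
  thus ?thesis
    by (rule Lim_transform_eventually)
       (use erv.a_nonzero'[OF lnt] in \<open>auto elim!: eventually_mono\<close>)
qed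

lemma a_le_A:
  assumes "filterlim t at_top sequentially"
  shows "\<forall>\<^sub>F n in sequentially. \<bar>a (ln (t n))\<bar> \<le> 2 * \<bar>A (t n)\<bar>"
proof -
  have "(\<lambda>n. a (ln (t n)) / A (t n)) \<longlonglongrightarrow> 1" by (rule filterlim_compose[OF a_over_A assms])
  hence "\<forall>\<^sub>F n in sequentially. \<bar>a (ln (t n)) / A (t n)\<bar> < 2"
    using tendsto_rabs by (intro order_tendstoD) fastforce+
  with eventually_compose_filterlim[OF A_nonzero assms] show ?thesis
    by eventually_elim (simp add: abs_divide divide_simps)
qed

definition Y :: "nat \<Rightarrow> nat \<Rightarrow> 'a \<Rightarrow> real" where "Y i j x = D.exp_score (X i j x)"

lemma indep_Y: "indep_vars (\<lambda>_. borel) (\<lambda>(i, j). Y i j) ({1..} \<times> {1..m})"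
proof -
  have "indep_vars (\<lambda>_. borel) (\<lambda>q x. D.exp_score ((\<lambda>(i, j). X i j) q x)) ({1..} \<times> {1..m})"
    by (rule indep_vars_compose2[OF indep]) simp
  thus ?thesis by (simp add: Y_def[abs_def] case_prod_unfold)
qed

lemma law_Y: "1 \<le> i \<Longrightarrow> j \<in> {1..m} \<Longrightarrow> distr P borel (Y i j) = std_exponential"
  using rvX[of i j] unfolding Y_def[abs_def] D.distr_exp_score[symmetric]
  by (subst ident[symmetric, of i j]) (auto simp: distr_distr comp_def)

lemma AE_Y: "AE x in P. \<forall>i\<in>{1..}. \<forall>j\<in>{1..m}. 0 < Y i j x \<and> D.Q (Y i j x) = X i j x"
proof (intro AE_ball_countable[THEN iffD2] ballI)
  fix i j :: nat assume ij: "i \<in> {1..}" "j \<in> {1..m}"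
  have i1: "1 \<le> i" using ij(1) by (simp only: atLeast_iff)
  have "AE y in distr P borel (X i j). 0 < D.exp_score y \<and> D.Q (D.exp_score y) = y"
    unfolding ident[OF i1 ij(2)] by (rule D.AE_exp_score)
  thus "AE x in P. 0 < Y i j x \<and> D.Q (Y i j x) = X i j x"
    using rvX[of i j] ij unfolding Y_def by (subst (asm) AE_distr_iff) auto
qed auto

lemma K_pos': "j \<in> {1..m} \<Longrightarrow> 0 < K j n" "j \<in> {1..m} \<Longrightarrow> 0 < real (K j n)"
  using K_pos[of j n] by auto

lemma K1_nonzero [simp]: "K 1 n \<noteq> 0" "K (Suc 0) n \<noteq> 0"
  using K_pos'(1)[OF l_le(4), of n] by simp_all

lemma N_pos: "j \<in> {1..m} \<Longrightarrow> \<forall>\<^sub>F n in sequentially. 0 < N j n"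
  by (rule eventually_compose_filterlim[OF eventually_gt_at_top N_top])

lemma ratio_top:
  assumes j: "j \<in> {1..m}"
  shows "filterlim (\<lambda>n. real (N j n) / real (K j n)) at_top sequentially"
proof -
  have "filterlim (\<lambda>n. inverse (real (K j n) / real (N j n))) at_top sequentially"
    by (rule filterlim_inverse_at_top[OF frac[OF j]])
       (use N_pos[OF j] K_pos'[OF j] in \<open>auto elim!: eventually_mono\<close>)
  thus ?thesis by simp
qed

lemma low_bias_a:
  "j \<in> {1..l} \<Longrightarrow> (\<lambda>n. sqrt (real (K j n)) * a (ln (real (N j n) / real (K j n)))) \<longlonglongrightarrow> \<Lambda> j"
  by (rule tendsto_a_of_A[OF ratio_top[OF low_in] low_bias])

lemma bias_a:
  assumes j: "j \<in> {1..m}"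
  shows "(\<lambda>n. sqrt (real (K j n)) * a (ln (real (N j n) / real (K j n)))) \<in> O(\<lambda>_. 1)"
proof (cases "j \<le> l")
  case True
  hence "(\<lambda>n. sqrt (real (K j n)) * a (ln (real (N j n) / real (K j n)))) \<longlonglongrightarrow> \<Lambda> j"
    using j by (intro low_bias_a) auto
  thus ?thesis by (intro bigoI_tendsto[where c = "\<Lambda> j"]) auto
next
  case False
  hence "(\<lambda>n. sqrt (real (K j n)) * A (real (N j n) / real (K j n))) \<in> O(\<lambda>_. 1)"
    using j by (intro high_bias) auto
  then obtain B where B: "\<forall>\<^sub>F n in sequentially. norm (sqrt (real (K j n)) * A (real (N j n) / real (K j n))) \<le> B * norm (1::real)"
    by (rule landau_o.bigE)
  show ?thesis
  proof (rule bigoI[of _ "2 * B"])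
    show "\<forall>\<^sub>F n in sequentially. norm (sqrt (real (K j n)) * a (ln (real (N j n) / real (K j n)))) \<le> 2 * B * norm (1::real)"
      using B a_le_A[OF ratio_top[OF j]]
    proof eventually_elim
      case (elim n)
      have "sqrt (real (K j n)) * \<bar>a (ln (real (N j n) / real (K j n)))\<bar> \<le> sqrt (real (K j n)) * (2 * \<bar>A (real (N j n) / real (K j n))\<bar>)"
        using elim(2) by (rule mult_left_mono) simp
      with elim(1) show ?case by (simp add: abs_mult)
    qed
  qed
qed

lemma sample: "j \<in> {1..m} \<Longrightarrow> exponential_sample P \<psi> a \<rho> (\<lambda>i. Y i j) (N j) (K j)"
  by (intro exponential_sample.intro exponential_sample_axioms.intro prob_space_axioms
      erv.extended_regular_variation_axioms indep_vars_column[OF indep_Y] law_Y N_top K_pos frac bias_a)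

abbreviation Sj :: "nat \<Rightarrow> nat \<Rightarrow> real" where
  "Sj j \<equiv> exponential_sample.S (N j) (K j)"

abbreviation Zj :: "nat \<Rightarrow> nat \<times> 'a \<Rightarrow> real" where
  "Zj j \<equiv> exponential_sample.Z (\<lambda>i. Y i j) (N j) (K j)"

abbreviation Ej :: "nat \<Rightarrow> nat \<times> 'a \<Rightarrow> real" where
  "Ej j \<equiv> exponential_sample.avg (\<lambda>i. Y i j) (N j) (K j) (\<lambda>e. e)"

abbreviation devj :: "nat \<Rightarrow> nat \<times> 'a \<Rightarrow> real" where
  "devj j \<equiv> exponential_sample.dev \<psi> (\<lambda>i. Y i j) (N j) (K j)"

definition hillj :: "nat \<Rightarrow> nat \<times> 'a \<Rightarrow> real" where
  "hillj j z = hill (K j (fst z)) (N j (fst z)) (\<lambda>i. X i j (snd z))"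

definition k :: "nat \<Rightarrow> nat" where "k n = (\<Sum>j=1..m. K j n)"

definition share :: "nat \<Rightarrow> nat \<Rightarrow> real" where "share j n = real (K j n) / real (k n)"

lemma S_eq: "j \<in> {1..m} \<Longrightarrow> Sj j n = ln (real (N j n) / real (K j n))"
  by (rule exponential_sample.S_def[OF sample])

lemma K_less_N: "\<forall>\<^sub>F n in sequentially. \<forall>j\<in>{1..m}. K j n < N j n"
  by (intro eventually_ball_finite) (auto intro: exponential_sample.K_less_N[OF sample])

text \<open>Collects on one event of high probability all that holds pathwise: positivity of
  \<open>Q\<close> at the thresholds, the almost sure representation of the data by exponential
  scores, and \<open>K j n < N j n\<close>.\<close>

lemma hill_representation:
  "\<forall>\<^sub>F z in whp. \<forall>j\<in>{1..m}. hillj j z = \<gamma> * Ej j z + devj j z \<and>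
     order_stat (N j (fst z) - K j (fst z)) (N j (fst z)) (\<lambda>i. X i j (snd z)) = D.Q (Zj j z) \<and> 0 < D.Q (Zj j z)"
proof -
  have Qev: "\<forall>\<^sub>F z in whp. \<forall>j\<in>{1..m}. 0 < D.Q (Zj j z)"
    by (intro eventually_ball_finite ballI eventually_compose_filterlim[OF Q_pos]
        exponential_sample.Z_top[OF sample]) auto
  have Yev: "\<forall>\<^sub>F z in whp. \<forall>i\<in>{1..}. \<forall>j\<in>{1..m}. 0 < Y i j (snd z) \<and> D.Q (Y i j (snd z)) = X i j (snd z)"
    by (rule eventually_whp_AE[OF AE_Y])
  show ?thesis using Qev Yev eventually_fst_whp[OF K_less_N]
  proof eventually_elim
    case (elim z)
    show ?case
    proof
      fix j assume j: "j \<in> {1..m}"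
      let ?n = "fst z"
      have Z: "Zj j z = order_stat (N j ?n - K j ?n) (N j ?n) (\<lambda>i. Y i j (snd z))"
        by (rule exponential_sample.Z_def[OF sample[OF j]])
      have pos: "0 < D.Q (order_stat (N j ?n - K j ?n) (N j ?n) (\<lambda>i. Y i j (snd z)))"
        using elim(1) j unfolding Z[symmetric] by blast
      have y: "0 < Y i j (snd z)" "X i j (snd z) = D.Q (Y i j (snd z))" if "i \<in> {1..N j ?n}" for i
        using elim(2) j that by auto
      have kn: "1 \<le> K j ?n" "K j ?n < N j ?n" using K_pos[OF j] elim(3) j by auto
      note rep = D.hill_of_exponentials(1)[OF y kn pos] D.hill_of_exponentials(2)[OF y kn pos, of \<gamma>]
      have "hillj j z = \<gamma> * Ej j z + devj j z"
        unfolding hillj_def exponential_sample.avg_def[OF sample[OF j]] exponential_sample.dev_def[OF sample[OF j]] Z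
        using rep(2) unfolding \<psi>_def by simp
      thus "hillj j z = \<gamma> * Ej j z + devj j z \<and>
        order_stat (N j ?n - K j ?n) (N j ?n) (\<lambda>i. X i j (snd z)) = D.Q (Zj j z) \<and> 0 < D.Q (Zj j z)"
        using rep(1) pos unfolding Z by simp
    qed
  qed
qed

lemma excess_mean_bounded:
  assumes j: "j \<in> {1..m}"
  shows "stoch_bounded (\<lambda>z. sqrt (real (K j (fst z))) * (Ej j z - 1))"
proof -
  interpret J: exponential_sample P \<psi> a \<rho> "\<lambda>i. Y i j" "N j" "K j" by (rule sample[OF j])
  have "stoch_bounded (\<lambda>z. sqrt (real (K j (fst z))) * (J.avg (\<lambda>e. e) z - (\<integral>y. y \<partial>std_exponential)))"
  proof (rule J.avg_bounded[where C = 3])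
    fix y :: real assume "0 \<le> y"
    moreover have "1 + y / 3 \<le> exp (y / 3)" by (rule exp_ge_add_one_self)
    ultimately show "\<bar>y\<bar> \<le> 3 * exp (y / 3)" by linarith
  qed simp
  thus ?thesis by (simp add: std_exponential_mean)
qed

lemma hill_bounded:
  assumes j: "j \<in> {1..m}"
  shows "stoch_bounded (\<lambda>z. sqrt (real (K j (fst z))) * (hillj j z - \<gamma>))"
proof -
  have "stoch_bounded (\<lambda>z. \<gamma> * (sqrt (real (K j (fst z))) * (Ej j z - 1)) + sqrt (real (K j (fst z))) * devj j z)"
    by (intro stoch_bounded_add stoch_bounded_mult stoch_bounded_const excess_mean_bounded j
        exponential_sample.dev_bounded[OF sample[OF j]])
  thus ?thesis
  proof (rule stoch_bounded_mono)
    show "\<forall>\<^sub>F z in whp. \<bar>sqrt (real (K j (fst z))) * (hillj j z - \<gamma>)\<bar> \<le>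
        \<bar>\<gamma> * (sqrt (real (K j (fst z))) * (Ej j z - 1)) + sqrt (real (K j (fst z))) * devj j z\<bar>"
      using hill_representation by eventually_elim (use j in \<open>simp add: algebra_simps\<close>)
  qed
qed

section \<open>Limits of size ratios, weights and bias\<close>

definition C :: real where "C = (\<Sum>i=1..l. 1 / c i)"

definition B :: real where "B = (\<Sum>i=1..l. 1 / b i)"

lemma C_pos: "0 < C" unfolding C_def using low_c l_le by (intro sum_pos) auto

lemma B_pos: "0 < B" unfolding B_def using low_b l_le by (intro sum_pos) auto

lemma K_ratio_low: "j \<in> {1..l} \<Longrightarrow> (\<lambda>n. real (K j n) / real (K 1 n)) \<longlonglongrightarrow> 1 / c j"
  using tendsto_inverse[of "\<lambda>n. real (K 1 n) / real (K j n)" "c j" sequentially] low_c[of j]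
  by (auto simp: inverse_eq_divide)

lemma N_ratio_low: "j \<in> {1..l} \<Longrightarrow> (\<lambda>n. real (N j n) / real (N 1 n)) \<longlonglongrightarrow> 1 / b j"
  using tendsto_inverse[of "\<lambda>n. real (N 1 n) / real (N j n)" "b j" sequentially] low_b[of j]
  by (auto simp: inverse_eq_divide)

lemma K_ratio: "j \<in> {1..m} \<Longrightarrow> (\<lambda>n. real (K j n) / real (K 1 n)) \<longlonglongrightarrow> (if j \<le> l then 1 / c j else 0)"
  using K_ratio_low[of j] tendsto_inverse_0_at_top[OF high_negl[of j]]
  by (auto simp: inverse_eq_divide)

lemma k_ratio: "(\<lambda>n. real (k n) / real (K 1 n)) \<longlonglongrightarrow> C"
proof -
  have "(\<lambda>n. \<Sum>j=1..m. real (K j n) / real (K 1 n)) \<longlonglongrightarrow> (\<Sum>j=1..m. if j \<le> l then 1 / c j else 0)"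
    by (intro tendsto_sum K_ratio)
  also have "(\<Sum>j=1..m. if j \<le> l then 1 / c j else 0) = C"
    unfolding C_def using l_le by (intro sum.mono_neutral_cong_right) auto
  finally show ?thesis by (simp add: k_def sum_divide_distrib)
qed

lemma K_le_k: "j \<in> {1..m} \<Longrightarrow> K j n \<le> k n"
  unfolding k_def by (rule member_le_sum) auto

lemma k_pos: "0 < k n" using K_le_k[of 1 n] K_pos'[of 1 n] l_le by simp

lemma k_nonzero [simp]: "k n \<noteq> 0"
  using k_pos[of n] by simp

lemma k_top: "filterlim k sequentially sequentially"
  by (rule filterlim_at_top_mono[OF low_top[OF l_le(5)]]) (use K_le_k l_le in auto)

lemma share_lim: "j \<in> {1..m} \<Longrightarrow> share j \<longlonglongrightarrow> (if j \<le> l then 1 / c j / C else 0)"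
proof -
  assume j: "j \<in> {1..m}"
  have "(\<lambda>n. (real (K j n) / real (K 1 n)) / (real (k n) / real (K 1 n))) \<longlonglongrightarrow> (if j \<le> l then 1 / c j else 0) / C"
    by (intro tendsto_divide K_ratio[OF j] k_ratio) (use C_pos in simp)
  moreover have "(\<lambda>n. (real (K j n) / real (K 1 n)) / (real (k n) / real (K 1 n))) = share j"
    by (intro ext) (simp add: share_def)
  ultimately show "share j \<longlonglongrightarrow> (if j \<le> l then 1 / c j / C else 0)" by (simp split: if_splits)
qed

lemma sqrt_share_lim: "j \<in> {1..m} \<Longrightarrow> (\<lambda>n. sqrt (share j n)) \<longlonglongrightarrow> (if j \<le> l then sqrt (1 / c j / C) else 0)"
  using tendsto_real_sqrt[OF share_lim[of j]] by (simp add: if_distrib cong: if_cong)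

lemma share_bounds: "j \<in> {1..m} \<Longrightarrow> 0 \<le> share j n" "j \<in> {1..m} \<Longrightarrow> share j n \<le> 1"
  using K_le_k[of j n] k_pos[of n] by (auto simp: share_def divide_simps)

lemma sum_share: "(\<Sum>j=1..m. share j n) = 1"
  unfolding share_def sum_divide_distrib[symmetric] of_nat_sum[symmetric] k_def[symmetric] by simp

text \<open>The common normalisation is split into the own rate \<open>sqrt (K j n)\<close> of each
  subsample and a deterministic factor \<open>sqrt (share j n)\<close>, which vanishes in the limit
  for \<open>j > l\<close>.\<close>

lemma sqrt_k_share: "sqrt (real (k n)) * share j n = sqrt (share j n) * sqrt (real (K j n))"
proof -
  have "sqrt (real (k n)) * sqrt (share j n) = sqrt (real (K j n))"
    using k_pos[of n] by (simp add: share_def real_sqrt_mult[symmetric])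
  moreover have "share j n = sqrt (share j n) * sqrt (share j n)" by (simp add: share_def)
  ultimately show ?thesis by (metis mult.assoc mult.commute)
qed

definition tbar :: "nat \<Rightarrow> real" where
  "tbar n = real (\<Sum>i=1..l. N i n) / real (\<Sum>i=1..l. K i n)"

lemma sum_N_ratio: "(\<lambda>n. real (\<Sum>i=1..l. N i n) / real (N 1 n)) \<longlonglongrightarrow> B"
proof -
  have "(\<lambda>n. \<Sum>i=1..l. real (N i n) / real (N 1 n)) \<longlonglongrightarrow> B" unfolding B_def
    by (intro tendsto_sum N_ratio_low)
  thus ?thesis by (simp add: sum_divide_distrib)
qed

lemma sum_K_ratio: "(\<lambda>n. real (\<Sum>i=1..l. K i n) / real (K 1 n)) \<longlonglongrightarrow> C"
proof -
  have "(\<lambda>n. \<Sum>i=1..l. real (K i n) / real (K 1 n)) \<longlonglongrightarrow> C" unfolding C_def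
    by (intro tendsto_sum K_ratio_low)
  thus ?thesis by (simp add: sum_divide_distrib)
qed

lemma sum_K_pos: "0 < (\<Sum>i=1..l. K i n)"
  using K_pos low_in l_le by (intro sum_pos) (auto simp: Suc_le_eq)

lemma tj_over_tbar:
  assumes j: "j \<in> {1..l}"
  shows "(\<lambda>n. (real (N j n) / real (K j n)) / tbar n) \<longlonglongrightarrow> (c j / b j) * (C / B)"
proof -
  have "(\<lambda>n. ((real (N j n) / real (N 1 n)) / (real (\<Sum>i=1..l. N i n) / real (N 1 n))) *
      ((real (\<Sum>i=1..l. K i n) / real (K 1 n)) / (real (K j n) / real (K 1 n)))) \<longlonglongrightarrow> ((1 / b j) / B) * (C / (1 / c j))"
    using B_pos low_c[OF j] by (intro tendsto_mult tendsto_divide N_ratio_low j sum_N_ratio sum_K_ratio K_ratio_low) auto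
  also have "((1 / b j) / B) * (C / (1 / c j)) = (c j / b j) * (C / B)" by simp
  finally show ?thesis
  proof (rule Lim_transform_eventually)
    show "\<forall>\<^sub>F n in sequentially. ((real (N j n) / real (N 1 n)) / (real (\<Sum>i=1..l. N i n) / real (N 1 n))) *
      ((real (\<Sum>i=1..l. K i n) / real (K 1 n)) / (real (K j n) / real (K 1 n))) = (real (N j n) / real (K j n)) / tbar n"
      using N_pos[OF l_le(4)]
    proof eventually_elim
      case (elim n)
      have "0 < real (K 1 n)" using K_pos'[OF l_le(4)] by simp
      with elim show ?case unfolding tbar_def by (simp del: of_nat_sum)
    qed
  qed
qed

text \<open>The limit of the ratio between the level \<open>N j n / K j n\<close> of one subsample
  and the pooled level \<open>tbar n\<close>.\<close>

definition dj :: "nat \<Rightarrow> real" where "dj j = (c j / b j) * (C / B)"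

lemma dj_pos: "j \<in> {1..l} \<Longrightarrow> 0 < dj j"
  unfolding dj_def using low_b[of j] low_c[of j] C_pos B_pos by simp

lemma tbar_pos: "\<forall>\<^sub>F n in sequentially. 0 < tbar n"
  using N_pos[OF l_le(4)]
proof eventually_elim
  case (elim n)
  have "N 1 n \<le> (\<Sum>i=1..l. N i n)" by (rule member_le_sum) (use l_le in auto)
  thus ?case using elim sum_K_pos[of n] unfolding tbar_def by (intro divide_pos_pos) (simp_all del: of_nat_sum)
qed

lemma tbar_top: "filterlim tbar at_top sequentially"
proof -
  have d1: "0 < dj 1" by (rule dj_pos[OF l_le(5)])
  have "(\<lambda>n. inverse ((real (N 1 n) / real (K 1 n)) / tbar n)) \<longlonglongrightarrow> inverse (dj 1)"
    by (rule tendsto_inverse[OF tj_over_tbar[OF l_le(5), folded dj_def]]) (use d1 in simp)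
  hence "filterlim (\<lambda>n. inverse ((real (N 1 n) / real (K 1 n)) / tbar n) * (real (N 1 n) / real (K 1 n))) at_top sequentially"
    by (rule filterlim_tendsto_pos_mult_at_top[OF _ _ ratio_top[OF l_le(4)]]) (use d1 in simp)
  moreover have "\<forall>\<^sub>F n in sequentially. inverse ((real (N 1 n) / real (K 1 n)) / tbar n) * (real (N 1 n) / real (K 1 n)) = tbar n"
    using N_pos[OF l_le(4)] by eventually_elim (use K_pos'[OF l_le(4)] in simp)
  ultimately show ?thesis by (simp add: filterlim_cong[OF refl refl])
qed

lemma ln_tbar_top: "filterlim (\<lambda>n. ln (tbar n)) at_top sequentially"
  by (rule filterlim_compose[OF ln_at_top tbar_top])

text \<open>On the logarithmic scale the two levels differ by a shift tending to
  \<open>ln (dj j)\<close>, and a shift multiplies \<open>a\<close> by the exponential of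
  \<open>\<rho>\<close> times it. This is the origin of the powers \<open>dj j powr \<rho>\<close>
  in the mean.\<close>

lemma a_ratio_tbar:
  assumes j: "j \<in> {1..l}"
  shows "(\<lambda>n. a (Sj j n) / a (ln (tbar n))) \<longlonglongrightarrow> dj j powr \<rho>"
proof -
  have d: "0 < dj j" by (rule dj_pos[OF j])
  have lim: "(\<lambda>n. ln ((real (N j n) / real (K j n)) / tbar n)) \<longlonglongrightarrow> ln (dj j)"
    using tendsto_ln[OF tj_over_tbar[OF j, folded dj_def]] d by simp
  have "(\<lambda>n. a (ln (tbar n) + ln ((real (N j n) / real (K j n)) / tbar n)) / a (ln (tbar n))) \<longlonglongrightarrow> exp (\<rho> * ln (dj j))"
    by (rule erv.a_ratio_tendsto[OF ln_tbar_top lim])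
  also have "exp (\<rho> * ln (dj j)) = dj j powr \<rho>" using d by (simp add: powr_def)
  finally show ?thesis
  proof (rule Lim_transform_eventually)
    show "\<forall>\<^sub>F n in sequentially. a (ln (tbar n) + ln ((real (N j n) / real (K j n)) / tbar n)) / a (ln (tbar n)) = a (Sj j n) / a (ln (tbar n))"
      using tbar_pos N_pos[OF low_in[OF j]]
    proof eventually_elim
      case (elim n)
      hence "ln ((real (N j n) / real (K j n)) / tbar n) = ln (real (N j n) / real (K j n)) - ln (tbar n)"
        using K_pos'[OF low_in[OF j], of n] by (intro ln_divide_pos divide_pos_pos) simp_all
      thus ?case by (simp only: S_eq[OF low_in[OF j]]) simp
    qed
  qed
qed

text \<open>Obtained from the first subsample: \<open>sqrt (k n)\<close> is about
  \<open>sqrt C * sqrt (K 1 n)\<close>, and passing from its level to the pooled one divides the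
  rate by \<open>dj 1 powr \<rho>\<close>.\<close>

definition lam :: real where "lam = sqrt C * \<Lambda> 1 / dj 1 powr \<rho>"

lemma lam_lim_a: "(\<lambda>n. sqrt (real (k n)) * a (ln (tbar n))) \<longlonglongrightarrow> lam"
proof -
  have bias1: "(\<lambda>n. sqrt (real (K 1 n)) * a (Sj 1 n)) \<longlonglongrightarrow> \<Lambda> 1"
    unfolding S_eq[OF l_le(4)] by (rule low_bias_a[OF l_le(5)])
  have S1: "filterlim (Sj 1) at_top sequentially" by (rule exponential_sample.S_top[OF sample[OF l_le(4)]])
  have "(\<lambda>n. sqrt (real (k n) / real (K 1 n)) * (sqrt (real (K 1 n)) * a (Sj 1 n)) / (a (Sj 1 n) / a (ln (tbar n)))) \<longlonglongrightarrow>
      sqrt C * \<Lambda> 1 / dj 1 powr \<rho>"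
    by (intro tendsto_divide tendsto_mult tendsto_real_sqrt k_ratio bias1 a_ratio_tbar l_le(5))
       (use dj_pos[OF l_le(5)] in simp)
  thus ?thesis unfolding lam_def
  proof (rule Lim_transform_eventually)
    show "\<forall>\<^sub>F n in sequentially. sqrt (real (k n) / real (K 1 n)) * (sqrt (real (K 1 n)) * a (Sj 1 n)) / (a (Sj 1 n) / a (ln (tbar n))) =
        sqrt (real (k n)) * a (ln (tbar n))"
      using erv.a_nonzero'[OF S1]
      by eventually_elim (use K_pos'[OF l_le(4)] in \<open>simp add: real_sqrt_divide\<close>)
  qed
qed

lemma lam_lim: "(\<lambda>n. sqrt (real (k n)) * A (tbar n)) \<longlonglongrightarrow> lam"
  by (rule tendsto_A_of_a[OF tbar_top lam_lim_a])

text \<open>The same conversion, read from the pooled level to subsample \<open>j\<close>, yields a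
  second limit for its bias; by uniqueness of limits the given constants are consistent with
  \<open>lam\<close>.\<close>

lemma \<Lambda>_eq:
  assumes j: "j \<in> {1..l}"
  shows "\<Lambda> j = sqrt (1 / c j / C) * lam * dj j powr \<rho>"
proof -
  have "(\<lambda>n. sqrt (share j n) * (sqrt (real (k n)) * a (ln (tbar n))) * (a (Sj j n) / a (ln (tbar n)))) \<longlonglongrightarrow>
      sqrt (1 / c j / C) * lam * dj j powr \<rho>"
    using sqrt_share_lim[OF low_in[OF j]] j by (intro tendsto_mult lam_lim_a a_ratio_tbar) auto
  hence "(\<lambda>n. sqrt (real (K j n)) * a (Sj j n)) \<longlonglongrightarrow> sqrt (1 / c j / C) * lam * dj j powr \<rho>"
  proof (rule Lim_transform_eventually)
    show "\<forall>\<^sub>F n in sequentially. sqrt (share j n) * (sqrt (real (k n)) * a (ln (tbar n))) * (a (Sj j n) / a (ln (tbar n))) =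
        sqrt (real (K j n)) * a (Sj j n)"
      using erv.a_nonzero'[OF ln_tbar_top]
      by eventually_elim (use k_pos in \<open>simp add: share_def real_sqrt_divide\<close>)
  qed
  moreover have "(\<lambda>n. sqrt (real (K j n)) * a (Sj j n)) \<longlonglongrightarrow> \<Lambda> j"
    using low_bias_a[OF j] by (simp add: S_eq[OF low_in[OF j]])
  ultimately show ?thesis by (rule LIMSEQ_unique[rotated])
qed

definition mean :: real where
  "mean = lam / (1 - \<rho>) * inverse C * (\<Sum>j=1..l. dj j powr \<rho> / c j)"

text \<open>The normalised total excess, the common Gaussian part of both estimators: each of the
  two limits is obtained by showing that the rest converges in probability to
  \<open>mean\<close>.\<close>

definition G :: "nat \<Rightarrow> 'a \<Rightarrow> real" where
  "G n x = ((\<Sum>j=1..m. excess_sum (\<lambda>e. e) (K j n) (N j n) (\<lambda>i. Y i j x)) - real (k n)) / sqrt (real (k n))"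

lemma G_clt: "weak_conv_m (\<lambda>n. distr P borel (G n)) std_normal_distribution"
  unfolding G_def k_def
  by (rule total_excess_clt[OF indep_Y law_Y K_less_N l_le(3) k_top[unfolded k_def[abs_def]]])

lemma rvY: "1 \<le> i \<Longrightarrow> j \<in> {1..m} \<Longrightarrow> Y i j \<in> borel_measurable P"
  using rvX[of i j] unfolding Y_def[abs_def] by measurable

lemma G_measurable: "\<forall>\<^sub>F n in sequentially. G n \<in> borel_measurable P"
  using K_less_N
proof eventually_elim
  case (elim n)
  have "(\<lambda>x. excess_sum (\<lambda>e. e) (K j n) (N j n) (\<lambda>i. Y i j x)) \<in> borel_measurable P" if "j \<in> {1..m}" for j
    by (rule excess_sum_measurable) (use elim that rvY in auto)
  thus ?case unfolding G_def[abs_def]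
    by (intro borel_measurable_divide borel_measurable_diff borel_measurable_sum) auto
qed

lemma G_eq: "G (fst z) (snd z) = (\<Sum>j=1..m. sqrt (share j (fst z)) * (sqrt (real (K j (fst z))) * (Ej j z - 1)))"
proof -
  have "(\<Sum>j=1..m. sqrt (share j (fst z)) * (sqrt (real (K j (fst z))) * (Ej j z - 1))) =
      (\<Sum>j=1..m. sqrt (real (k (fst z))) * (share j (fst z) * (Ej j z - 1)))"
    by (simp add: mult.assoc[symmetric] sqrt_k_share)
  also have "\<dots> = sqrt (real (k (fst z))) * ((\<Sum>j=1..m. share j (fst z) * Ej j z) - 1)"
    by (simp add: sum_distrib_left[symmetric] right_diff_distrib sum_subtractf sum_share del: One_nat_def)
  also have "(\<Sum>j=1..m. share j (fst z) * Ej j z) =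
      (\<Sum>j=1..m. excess_sum (\<lambda>e. e) (K j (fst z)) (N j (fst z)) (\<lambda>i. Y i j (snd z))) / real (k (fst z))"
    unfolding sum_divide_distrib
  proof (rule sum.cong)
    fix j assume j: "j \<in> {1..m}"
    show "share j (fst z) * Ej j z = excess_sum (\<lambda>e. e) (K j (fst z)) (N j (fst z)) (\<lambda>i. Y i j (snd z)) / real (k (fst z))"
      using K_pos'[OF j, of "fst z"] by (simp add: exponential_sample.avg_def[OF sample[OF j]] share_def)
  qed simp
  also have "sqrt (real (k (fst z))) * ((\<Sum>j=1..m. excess_sum (\<lambda>e. e) (K j (fst z)) (N j (fst z)) (\<lambda>i. Y i j (snd z))) / real (k (fst z)) - 1) =
      G (fst z) (snd z)"
    using k_pos[of "fst z"] real_div_sqrt[of "real (k (fst z))"]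
    by (simp add: G_def field_simps)
  finally show ?thesis by simp
qed

lemma hill_measurable:
  assumes "K j n < N j n" "j \<in> {1..m}"
  shows "(\<lambda>x. hill (K j n) (N j n) (\<lambda>i. X i j x)) \<in> borel_measurable P"
proof -
  have os [measurable]: "(\<lambda>x. order_stat (N j n - i + 1) (N j n) (\<lambda>i. X i j x)) \<in> borel_measurable P" if "i \<in> {1..K j n}" for i
    by (rule order_stat_measurable) (use assms that rvX in auto)
  have [measurable]: "(\<lambda>x. order_stat (N j n - K j n) (N j n) (\<lambda>i. X i j x)) \<in> borel_measurable P"
    by (rule order_stat_measurable) (use assms rvX in auto)
  show ?thesis unfolding hill_def by measurable
qed

definition W :: "nat \<Rightarrow> 'a \<Rightarrow> real" where
  "W n x = sqrt (real (k n)) * (pooled_hill m (\<lambda>j. share j n) (\<lambda>j. K j n) (\<lambda>j. N j n) (\<lambda>i j. X i j x) - \<gamma>)"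

lemma W_measurable: "\<forall>\<^sub>F n in sequentially. W n \<in> borel_measurable P"
  using K_less_N
proof eventually_elim
  case (elim n)
  have "(\<lambda>x. pooled_hill m (\<lambda>j. share j n) (\<lambda>j. K j n) (\<lambda>j. N j n) (\<lambda>i j. X i j x)) \<in> borel_measurable P"
    unfolding pooled_hill_def using elim
    by (intro borel_measurable_sum borel_measurable_times hill_measurable) auto
  thus ?case unfolding W_def[abs_def] by (intro borel_measurable_times borel_measurable_diff) auto
qed

lemma W_eq: "W (fst z) (snd z) = (\<Sum>j=1..m. sqrt (share j (fst z)) * (sqrt (real (K j (fst z))) * (hillj j z - \<gamma>)))"
proof -
  have "(\<Sum>j=1..m. sqrt (share j (fst z)) * (sqrt (real (K j (fst z))) * (hillj j z - \<gamma>))) =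
      (\<Sum>j=1..m. sqrt (real (k (fst z))) * (share j (fst z) * (hillj j z - \<gamma>)))"
    by (simp add: mult.assoc[symmetric] sqrt_k_share)
  also have "\<dots> = sqrt (real (k (fst z))) * ((\<Sum>j=1..m. share j (fst z) * hillj j z) - (\<Sum>j=1..m. share j (fst z)) * \<gamma>)"
    by (simp add: sum_distrib_left[symmetric] right_diff_distrib sum_subtractf sum_distrib_right)
  also have "\<dots> = W (fst z) (snd z)" unfolding sum_share by (simp add: W_def pooled_hill_def hillj_def)
  finally show ?thesis by simp
qed

text \<open>As each Hill statistic is \<open>\<gamma>\<close> times a mean excess plus
  \<open>devj\<close>, the difference is a weighted sum of the latter. Subsamples up to
  \<open>l\<close> contribute their bias limits; the others vanish, being bounded in probability
  with weights tending to 0.\<close>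

lemma W_minus_G: "((\<lambda>z. W (fst z) (snd z) - \<gamma> * G (fst z) (snd z)) \<longlongrightarrow> mean) whp"
proof -
  have "((\<lambda>z. \<Sum>j=1..m. sqrt (share j (fst z)) * (sqrt (real (K j (fst z))) * devj j z)) \<longlongrightarrow>
      (\<Sum>j=1..m. if j \<le> l then sqrt (1 / c j / C) * (\<Lambda> j / (1 - \<rho>)) else 0)) whp"
  proof (rule tendsto_sum)
    fix j assume j: "j \<in> {1..m}"
    interpret J: exponential_sample P \<psi> a \<rho> "\<lambda>i. Y i j" "N j" "K j" by (rule sample[OF j])
    show "((\<lambda>z. sqrt (share j (fst z)) * (sqrt (real (K j (fst z))) * J.dev z)) \<longlongrightarrow>
        (if j \<le> l then sqrt (1 / c j / C) * (\<Lambda> j / (1 - \<rho>)) else 0)) whp"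
    proof (cases "j \<le> l")
      case True
      hence jl: "j \<in> {1..l}" using j by simp
      have "(\<lambda>n. sqrt (real (K j n)) * a (J.S n)) \<longlonglongrightarrow> \<Lambda> j"
        using low_bias_a[OF jl] by (simp add: J.S_def)
      from J.dev_tendsto[OF low_top[OF jl] this]
      have dv: "((\<lambda>z. sqrt (real (K j (fst z))) * J.dev z) \<longlongrightarrow> \<Lambda> j / (1 - \<rho>)) whp" .
      have "(\<lambda>n. sqrt (share j n)) \<longlonglongrightarrow> sqrt (1 / c j / C)" using sqrt_share_lim[OF j] True by simp
      from tendsto_mult[OF tendsto_fst_whp[OF this] dv] True show ?thesis by simp
    next
      case False
      with sqrt_share_lim[OF j] have "(\<lambda>n. sqrt (share j n)) \<longlonglongrightarrow> 0" by simp
      from stoch_bounded_null[OF J.dev_bounded this] False show ?thesis by simp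
    qed
  qed
  also have "(\<Sum>j=1..m. if j \<le> l then sqrt (1 / c j / C) * (\<Lambda> j / (1 - \<rho>)) else 0) =
      (\<Sum>j=1..l. sqrt (1 / c j / C) * (\<Lambda> j / (1 - \<rho>)))"
    using l_le by (intro sum.mono_neutral_cong_right) auto
  \<comment> \<open>The root \<open>sqrt (1 / c j / C)\<close> occurs twice, as limit of
    \<open>sqrt (share j n)\<close> and inside \<open>\<Lambda> j\<close>, which combines to the
    weight \<open>1 / c j / C\<close>.\<close>
  also have "\<dots> = (\<Sum>j=1..l. lam / (1 - \<rho>) * inverse C * (dj j powr \<rho> / c j))"
  proof (rule sum.cong)
    fix j assume j: "j \<in> {1..l}"
    have "sqrt (1 / c j / C) * sqrt (1 / c j / C) = 1 / c j / C" using low_c[OF j] C_pos by simp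
    hence "sqrt (1 / c j / C) * (\<Lambda> j / (1 - \<rho>)) = (1 / c j / C) * lam * dj j powr \<rho> / (1 - \<rho>)"
      unfolding \<Lambda>_eq[OF j] by (metis (no_types, lifting) mult.assoc times_divide_eq_right)
    thus "sqrt (1 / c j / C) * (\<Lambda> j / (1 - \<rho>)) = lam / (1 - \<rho>) * inverse C * (dj j powr \<rho> / c j)"
      by (simp add: divide_inverse mult_ac)
  qed simp
  also have "\<dots> = mean" by (simp add: mean_def sum_distrib_left)
  finally show ?thesis
  proof (rule Lim_transform_eventually)
    show "\<forall>\<^sub>F z in whp. (\<Sum>j=1..m. sqrt (share j (fst z)) * (sqrt (real (K j (fst z))) * devj j z)) =
        W (fst z) (snd z) - \<gamma> * G (fst z) (snd z)"
      using hill_representation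
    proof eventually_elim
      case (elim z)
      have "W (fst z) (snd z) = (\<Sum>j=1..m. \<gamma> * (sqrt (share j (fst z)) * (sqrt (real (K j (fst z))) * (Ej j z - 1))) +
          sqrt (share j (fst z)) * (sqrt (real (K j (fst z))) * devj j z))"
        unfolding W_eq using elim by (intro sum.cong) (auto simp: algebra_simps)
      thus ?case unfolding G_eq by (simp add: sum.distrib sum_distrib_left)
    qed
  qed
qed

theorem W_normal: "weak_conv_m (\<lambda>n. distr P borel (W n)) (density lborel (normal_density mean \<gamma>))"
  by (rule slutsky_normal_eventually[OF G_clt \<gamma>_pos G_measurable W_measurable W_minus_G])

lemma sqrt_share_bounded: "j \<in> {1..m} \<Longrightarrow> (\<lambda>n. sqrt (share j n)) \<in> O(\<lambda>_. 1)"
  by (rule bigoI[of _ 1]) (simp add: share_bounds)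

lemma G_bounded: "stoch_bounded (\<lambda>z. G (fst z) (snd z))"
  unfolding G_eq
  by (rule stoch_bounded_sum, simp)
    (rule stoch_bounded_mult[OF stoch_bounded_fst[OF sqrt_share_bounded] excess_mean_bounded])

end

section \<open>The pooled Weissman estimator\<close>

lemma powr_mult_eq_exp: "0 < r \<Longrightarrow> 0 < q \<Longrightarrow> r powr h * q = exp (h * ln r + ln q)" for r q h :: real
  by (simp add: powr_def exp_add)

context pooled_sample
begin

context
  fixes p :: "nat \<Rightarrow> real"
begin

definition L :: "nat \<Rightarrow> real" where "L n = ln (real (k n) / (real n * p n))"

definition Lj :: "nat \<Rightarrow> nat \<Rightarrow> real" where "Lj j n = ln (real (K j n) / (real (N j n) * p n))"

definition scale :: "nat \<Rightarrow> real" where "scale n = sqrt (real (k n)) / L n"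

text \<open>The position of the target quantile on the exponential scale:
  \<open>quantile (cdf D) (1 - p n)\<close> is \<open>D.Q (sp n)\<close> when
  \<open>p n > 0\<close>.\<close>

definition sp :: "nat \<Rightarrow> real" where "sp n = ln (1 / p n)"

text \<open>The logarithm of \<open>weissman_ratio\<close> with high probability, namely when all
  factors are positive.\<close>

definition V :: "nat \<times> 'a \<Rightarrow> real" where
  "V z = (\<Sum>j=1..m. share j (fst z) * (hillj j z * Lj j (fst z) + ln (D.Q (Zj j z)))) - ln (D.Q (sp (fst z)))"

text \<open>What separates the scaled log ratio from the Hill statistic \<open>W\<close>: the
  mismatch between the individual and pooled log factors, the gap of \<open>\<psi>\<close> between
  threshold and target, and the fluctuation of the thresholds. The last two are bounded in
  probability before division by \<open>L\<close>.\<close>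

definition remainder :: "nat \<times> 'a \<Rightarrow> real" where
  "remainder z = (\<Sum>j=1..m. sqrt (share j (fst z)) * (Lj j (fst z) / L (fst z) - 1) * (sqrt (real (K j (fst z))) * (hillj j z - \<gamma>))) +
     1 / L (fst z) * (\<Sum>j=1..m. sqrt (share j (fst z)) * (sqrt (real (K j (fst z))) * (\<psi> (Zj j z) - \<psi> (sp (fst z)))) +
       \<gamma> * sqrt (share j (fst z)) * (sqrt (real (K j (fst z))) * (Zj j z - Sj j (fst z))))"

definition weissman_ratio :: "nat \<Rightarrow> 'a \<Rightarrow> real" where
  "weissman_ratio n x = pooled_weissman m (\<lambda>j. share j n) (\<lambda>j. K j n) (\<lambda>j. N j n) (p n) (\<lambda>i j. X i j x)
     / quantile (cdf D) (1 - p n)"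

context
  assumes \<rho>_neg: "\<rho> < 0" and p_lim: "p \<longlonglongrightarrow> 0"
    and kp_top: "filterlim (\<lambda>n. real (k n) / (real n * p n)) at_top sequentially"
    and scale_top: "filterlim (\<lambda>n. sqrt (real (k n)) / ln (real (k n) / (real n * p n))) at_top sequentially"
    and log_lim: "\<And>j. j \<in> {1..m} \<Longrightarrow> (\<lambda>n. sqrt (share j n) *
      (ln (real (K j n) / (real (N j n) * p n)) / ln (real (k n) / (real n * p n)) - 1)) \<longlonglongrightarrow> 0"
    and extrapolation_bias: "\<And>j. j \<in> {l+1..m} \<Longrightarrow> (\<lambda>n. sqrt (share j n) * (sqrt (real (K j n)) * A (1 / p n))) \<in> O(\<lambda>_. 1)"
begin

section \<open>Consequences of the conditions on \<open>p\<close> and linearisation of the quantile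
  estimator\<close>

lemma p_pos: "\<forall>\<^sub>F n in sequentially. 0 < p n"
proof -
  have "\<forall>\<^sub>F n in sequentially. 0 < real (k n) / (real n * p n)"
    using kp_top by (simp add: filterlim_at_top_dense)
  thus ?thesis by eventually_elim (auto simp: zero_less_divide_iff zero_less_mult_iff)
qed

lemma L_top: "filterlim L at_top sequentially"
  unfolding L_def[abs_def] by (rule filterlim_compose[OF ln_at_top kp_top])

lemma L_pos: "\<forall>\<^sub>F n in sequentially. 0 < L n"
  using L_top by (simp add: filterlim_at_top_dense)

lemma inverse_L_lim: "(\<lambda>n. 1 / L n) \<longlonglongrightarrow> 0"
  by (intro tendsto_divide_0[OF tendsto_const] filterlim_at_top_imp_at_infinity L_top)

lemma inverse_scale_lim: "(\<lambda>n. 1 / scale n) \<longlonglongrightarrow> 0"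
  unfolding scale_def L_def
  by (intro tendsto_divide_0[OF tendsto_const] filterlim_at_top_imp_at_infinity scale_top)

lemma scale_pos: "\<forall>\<^sub>F n in sequentially. 0 < scale n"
  using L_pos by eventually_elim (simp add: scale_def k_pos)

lemma inverse_p_top: "filterlim (\<lambda>n. 1 / p n) at_top sequentially"
  using filterlim_inverse_at_top[OF p_lim p_pos] by (simp add: inverse_eq_divide)

lemma sp_top: "filterlim sp at_top sequentially"
  unfolding sp_def by (rule filterlim_compose[OF ln_at_top inverse_p_top])

lemma Lj_eq:
  assumes j: "j \<in> {1..m}"
  shows "\<forall>\<^sub>F n in sequentially. Lj j n = sp n - Sj j n"
  using p_pos N_pos[OF j]
proof eventually_elim
  case (elim n)
  have "real (K j n) / (real (N j n) * p n) = (1 / p n) / (real (N j n) / real (K j n))" by simp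
  also have "ln \<dots> = ln (1 / p n) - ln (real (N j n) / real (K j n))"
    using elim K_pos'[OF j, of n] by (intro ln_divide_pos divide_pos_pos) simp_all
  finally show ?case by (simp add: Lj_def sp_def S_eq[OF j])
qed

text \<open>For \<open>j \<le> l\<close> the target eventually lies beyond the level
  \<open>S\<close> of the subsample, and with \<open>\<rho> < 0\<close> the rate there is at most a
  multiple of the rate at \<open>S\<close>. For \<open>j > l\<close> the bound is the assumed one on
  \<open>A (1 / p n)\<close>.\<close>

lemma extrapolated_rate_bounded:
  assumes j: "j \<in> {1..m}"
  shows "(\<lambda>n. sqrt (share j n) * (sqrt (real (K j n)) * a (sp n))) \<in> O(\<lambda>_. 1)"
proof (cases "j \<le> l")
  case True
  hence jl: "j \<in> {1..l}" using j by simp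
  have \<kappa>: "0 < sqrt (1 / c j / C)" using low_c[OF jl] C_pos by simp
  have sh: "(\<lambda>n. sqrt (share j n)) \<longlonglongrightarrow> sqrt (1 / c j / C)" using sqrt_share_lim[OF j] True by simp
  \<comment> \<open>The factor \<open>sqrt (share j n)\<close> has a positive limit here and can be
    divided out, so \<open>Lj j n / L n\<close> tends to 1 and \<open>Lj j n = sp n - Sj j n\<close>
    becomes positive.\<close>
  have "(\<lambda>n. sqrt (share j n) * (Lj j n / L n - 1) / sqrt (share j n)) \<longlonglongrightarrow> 0 / sqrt (1 / c j / C)"
    using log_lim[OF j, folded L_def Lj_def] sh \<kappa> by (intro tendsto_divide) auto
  moreover have "sqrt (share j n) \<noteq> 0" for n using K_pos'[OF j, of n] by (simp add: share_def)
  ultimately have "(\<lambda>n. Lj j n / L n - 1) \<longlonglongrightarrow> 0" by simp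
  hence "(\<lambda>n. Lj j n / L n) \<longlonglongrightarrow> 1" by (rule LIM_zero_cancel)
  hence "\<forall>\<^sub>F n in sequentially. 0 < Lj j n / L n" by (rule order_tendstoD) simp
  hence ge: "\<forall>\<^sub>F n in sequentially. Sj j n \<le> sp n"
    using L_pos Lj_eq[OF j] by eventually_elim (simp add: zero_less_divide_iff)
  obtain C0 where C0: "C0 \<ge> 0"
    "\<forall>\<^sub>F s in at_top. \<forall>y\<ge>0. \<bar>a (s + y)\<bar> \<le> C0 * \<bar>a s\<bar> \<and> \<bar>\<psi> (s + y) - \<psi> s\<bar> \<le> C0 * \<bar>a s\<bar>"
    using erv.bounded_if_\<rho>_neg[OF \<rho>_neg] by blast
  obtain B0 where B0: "\<forall>\<^sub>F n in sequentially. norm (sqrt (real (K j n)) * a (ln (real (N j n) / real (K j n)))) \<le> B0 * norm (1::real)"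
    using bias_a[OF j] by (rule landau_o.bigE)
  show ?thesis
  proof (rule bigoI[of _ "C0 * B0"])
    show "\<forall>\<^sub>F n in sequentially. norm (sqrt (share j n) * (sqrt (real (K j n)) * a (sp n))) \<le> C0 * B0 * norm (1::real)"
      using ge B0 eventually_compose_filterlim[OF C0(2) exponential_sample.S_top[OF sample[OF j]]]
    proof eventually_elim
      case (elim n)
      have "\<bar>a (sp n)\<bar> \<le> C0 * \<bar>a (Sj j n)\<bar>" using elim(3)[rule_format, of "sp n - Sj j n"] elim(1) by simp
      hence "sqrt (real (K j n)) * \<bar>a (sp n)\<bar> \<le> sqrt (real (K j n)) * (C0 * \<bar>a (Sj j n)\<bar>)" by (rule mult_left_mono) simp
      also have "\<dots> = C0 * norm (sqrt (real (K j n)) * a (ln (real (N j n) / real (K j n))))"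
        by (simp add: abs_mult S_eq[OF j])
      also have "\<dots> \<le> C0 * B0" using elim(2) C0(1) by (intro mult_left_mono) auto
      finally have 1: "sqrt (real (K j n)) * \<bar>a (sp n)\<bar> \<le> C0 * B0" .
      have "sqrt (share j n) * (sqrt (real (K j n)) * \<bar>a (sp n)\<bar>) \<le> 1 * (sqrt (real (K j n)) * \<bar>a (sp n)\<bar>)"
        using share_bounds[OF j] by (intro mult_right_mono) auto
      with 1 show ?case using share_bounds[OF j] by (simp add: abs_mult)
    qed
  qed
next
  case False
  hence "j \<in> {l+1..m}" using j by simp
  from extrapolation_bias[OF this] obtain B0 where B0: "\<forall>\<^sub>F n in sequentially.
      norm (sqrt (share j n) * (sqrt (real (K j n)) * A (1 / p n))) \<le> B0 * norm (1::real)"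
    by (rule landau_o.bigE)
  show ?thesis
  proof (rule bigoI[of _ "2 * B0"])
    show "\<forall>\<^sub>F n in sequentially. norm (sqrt (share j n) * (sqrt (real (K j n)) * a (sp n))) \<le> 2 * B0 * norm (1::real)"
      using B0 a_le_A[OF inverse_p_top]
    proof eventually_elim
      case (elim n)
      have "sqrt (share j n) * (sqrt (real (K j n)) * \<bar>a (sp n)\<bar>) \<le> sqrt (share j n) * (sqrt (real (K j n)) * (2 * \<bar>A (1 / p n)\<bar>))"
        using elim(2) share_bounds[OF j] unfolding sp_def by (intro mult_left_mono) auto
      with elim(1) show ?case using share_bounds[OF j] by (simp add: abs_mult)
    qed
  qed
qed

text \<open>The order of threshold and target is left open: the smaller of the two serves as base
  point of the bound for \<open>\<rho> < 0\<close>, which is why both rates enter the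
  majorant.\<close>

lemma quantile_gap_bounded:
  assumes j: "j \<in> {1..m}"
  shows "stoch_bounded (\<lambda>z. sqrt (share j (fst z)) * (sqrt (real (K j (fst z))) * (\<psi> (Zj j z) - \<psi> (sp (fst z)))))"
proof -
  interpret J: exponential_sample P \<psi> a \<rho> "\<lambda>i. Y i j" "N j" "K j" by (rule sample[OF j])
  obtain C0 where C0: "C0 \<ge> 0"
    "\<forall>\<^sub>F s in at_top. \<forall>y\<ge>0. \<bar>a (s + y)\<bar> \<le> C0 * \<bar>a s\<bar> \<and> \<bar>\<psi> (s + y) - \<psi> s\<bar> \<le> C0 * \<bar>a s\<bar>"
    using erv.bounded_if_\<rho>_neg[OF \<rho>_neg] by blast
  have abs_sb: "stoch_bounded (\<lambda>z. \<bar>f z\<bar>)" if "stoch_bounded f" for f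
    by (rule stoch_bounded_mono[OF that]) simp
  have "stoch_bounded (\<lambda>z. C0 * (\<bar>sqrt (real (K j (fst z))) * a (J.Z z)\<bar> +
      \<bar>sqrt (share j (fst z)) * (sqrt (real (K j (fst z))) * a (sp (fst z)))\<bar>))"
    by (rule stoch_bounded_mult[OF stoch_bounded_const stoch_bounded_add[OF abs_sb abs_sb]])
       (rule J.rate_at_threshold_bounded stoch_bounded_fst[OF extrapolated_rate_bounded[OF j]])+
  thus ?thesis
  proof (rule stoch_bounded_mono)
    show "\<forall>\<^sub>F z in whp. \<bar>sqrt (share j (fst z)) * (sqrt (real (K j (fst z))) * (\<psi> (J.Z z) - \<psi> (sp (fst z))))\<bar> \<le>
      \<bar>C0 * (\<bar>sqrt (real (K j (fst z))) * a (J.Z z)\<bar> + \<bar>sqrt (share j (fst z)) * (sqrt (real (K j (fst z))) * a (sp (fst z)))\<bar>)\<bar>"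
      using eventually_compose_filterlim[OF C0(2) J.Z_top] eventually_compose_filterlim[OF C0(2) at_top_fst_whp[OF sp_top]]
    proof eventually_elim
      case (elim z)
      let ?s = "sp (fst z)"
      let ?u = "sqrt (share j (fst z))"
      let ?v = "sqrt (real (K j (fst z)))"
      have u: "0 \<le> ?u" "?u \<le> 1" using share_bounds[OF j] by auto
      have v: "0 \<le> ?v" by simp
      have "\<bar>\<psi> (J.Z z) - \<psi> ?s\<bar> \<le> C0 * \<bar>a (J.Z z)\<bar> + C0 * \<bar>a ?s\<bar>"
      proof (cases "J.Z z \<le> ?s")
        case True
        have "\<bar>\<psi> ?s - \<psi> (J.Z z)\<bar> \<le> C0 * \<bar>a (J.Z z)\<bar>" using elim(1)[rule_format, of "?s - J.Z z"] True by simp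
        moreover have "0 \<le> C0 * \<bar>a ?s\<bar>" using C0(1) by simp
        ultimately show ?thesis by (simp add: abs_minus_commute)
      next
        case False
        have "\<bar>\<psi> (J.Z z) - \<psi> ?s\<bar> \<le> C0 * \<bar>a ?s\<bar>" using elim(2)[rule_format, of "J.Z z - ?s"] False by simp
        moreover have "0 \<le> C0 * \<bar>a (J.Z z)\<bar>" using C0(1) by simp
        ultimately show ?thesis by simp
      qed
      hence "(?u * ?v) * \<bar>\<psi> (J.Z z) - \<psi> ?s\<bar> \<le> (?u * ?v) * (C0 * \<bar>a (J.Z z)\<bar> + C0 * \<bar>a ?s\<bar>)"
        using u v by (intro mult_left_mono) auto
      also have "\<dots> = C0 * (?u * (?v * \<bar>a (J.Z z)\<bar>)) + C0 * (?u * (?v * \<bar>a ?s\<bar>))" by (simp add: algebra_simps)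
      also have "\<dots> \<le> C0 * (1 * (?v * \<bar>a (J.Z z)\<bar>)) + C0 * (?u * (?v * \<bar>a ?s\<bar>))"
        using u v C0(1) by (intro add_mono mult_left_mono mult_right_mono) auto
      finally have "(?u * ?v) * \<bar>\<psi> (J.Z z) - \<psi> ?s\<bar> \<le> C0 * (?v * \<bar>a (J.Z z)\<bar>) + C0 * (?u * (?v * \<bar>a ?s\<bar>))" by simp
      thus ?case using u v C0(1) by (simp add: abs_mult distrib_left mult.assoc)
    qed
  qed
qed

lemma ratio_eq_exp: "\<forall>\<^sub>F z in whp. weissman_ratio (fst z) (snd z) = exp (V z)"
proof -
  have Npos: "\<forall>\<^sub>F n in sequentially. \<forall>j\<in>{1..m}. 0 < N j n"
    by (intro eventually_ball_finite) (auto intro: N_pos)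
  show ?thesis
    using hill_representation eventually_fst_whp[OF p_pos] eventually_fst_whp[OF Npos]
      eventually_compose_filterlim[OF Q_pos at_top_fst_whp[OF sp_top]]
  proof eventually_elim
    case (elim z)
    let ?n = "fst z"
    have "pooled_weissman m (\<lambda>j. share j ?n) (\<lambda>j. K j ?n) (\<lambda>j. N j ?n) (p ?n) (\<lambda>i j. X i j (snd z)) =
        (\<Prod>j=1..m. exp (share j ?n * (hillj j z * Lj j ?n + ln (D.Q (Zj j z)))))"
      unfolding pooled_weissman_def
    proof (rule prod.cong)
      fix j assume j: "j \<in> {1..m}"
      have r: "0 < real (K j ?n) / (real (N j ?n) * p ?n)" using elim(2,3) K_pos'[OF j] j by simp
      have Q: "order_stat (N j ?n - K j ?n) (N j ?n) (\<lambda>i. X i j (snd z)) = D.Q (Zj j z)" "0 < D.Q (Zj j z)"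
        using elim(1) j by auto
      have "((real (K j ?n) / (real (N j ?n) * p ?n)) powr hillj j z * D.Q (Zj j z)) = exp (hillj j z * Lj j ?n + ln (D.Q (Zj j z)))"
        unfolding Lj_def by (rule powr_mult_eq_exp[OF r Q(2)])
      thus "((real (K j ?n) / (real (N j ?n) * p ?n)) powr hill (K j ?n) (N j ?n) (\<lambda>i. X i j (snd z)) *
          order_stat (N j ?n - K j ?n) (N j ?n) (\<lambda>i. X i j (snd z))) powr share j ?n =
          exp (share j ?n * (hillj j z * Lj j ?n + ln (D.Q (Zj j z))))"
        unfolding Q(1) hillj_def[symmetric] by (simp add: powr_def)
    qed simp
    also have "\<dots> = exp (\<Sum>j=1..m. share j ?n * (hillj j z * Lj j ?n + ln (D.Q (Zj j z))))"
      by (simp add: exp_sum)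
    finally have 1: "pooled_weissman m (\<lambda>j. share j ?n) (\<lambda>j. K j ?n) (\<lambda>j. N j ?n) (p ?n) (\<lambda>i j. X i j (snd z)) =
      exp (\<Sum>j=1..m. share j ?n * (hillj j z * Lj j ?n + ln (D.Q (Zj j z))))" .
    have "exp (- sp ?n) = p ?n" using elim(2) by (simp add: sp_def ln_div)
    hence 2: "quantile (cdf D) (1 - p ?n) = exp (ln (D.Q (sp ?n)))" using elim(4) by simp
    show ?case unfolding weissman_ratio_def 1 2 V_def exp_diff ..
  qed
qed

lemma scaled_V_eq:
  "\<forall>\<^sub>F z in whp. scale (fst z) * V z = W (fst z) (snd z) +
    remainder z"
proof -
  have Ljev: "\<forall>\<^sub>F n in sequentially. \<forall>j\<in>{1..m}. Lj j n = sp n - Sj j n"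
    by (intro eventually_ball_finite) (auto intro: Lj_eq)
  show ?thesis
    using eventually_fst_whp[OF Ljev] eventually_fst_whp[OF L_pos]
  proof eventually_elim
    case (elim z)
    let ?n = "fst z"
    define T where "T j = sqrt (real (K j ?n)) * (hillj j z - \<gamma>)" for j
    \<comment> \<open>From \<open>ln (Q s) = \<gamma> * s + \<psi> s\<close> and
      \<open>Lj = sp - Sj\<close>: the part \<open>\<gamma> * Lj\<close> of the extrapolation
      cancels the linear difference between target and level, leaving this residue.\<close>
    define R where "R j = (\<psi> (Zj j z) - \<psi> (sp ?n)) + \<gamma> * (Zj j z - Sj j ?n)" for j
    have "V z = (\<Sum>j=1..m. share j ?n * (hillj j z * Lj j ?n + ln (D.Q (Zj j z)))) - (\<Sum>j=1..m. share j ?n) * ln (D.Q (sp ?n))"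
      unfolding sum_share V_def by simp
    also have "\<dots> = (\<Sum>j=1..m. share j ?n * (hillj j z * Lj j ?n + ln (D.Q (Zj j z)) - ln (D.Q (sp ?n))))"
      by (simp add: sum_distrib_right sum_subtractf right_diff_distrib)
    also have "\<dots> = (\<Sum>j=1..m. share j ?n * ((hillj j z - \<gamma>) * Lj j ?n + R j))"
    proof (rule sum.cong)
      fix j assume "j \<in> {1..m}"
      hence lj: "Lj j ?n = sp ?n - Sj j ?n" using elim(1) by blast
      show "share j ?n * (hillj j z * Lj j ?n + ln (D.Q (Zj j z)) - ln (D.Q (sp ?n))) =
          share j ?n * ((hillj j z - \<gamma>) * Lj j ?n + R j)"
        unfolding lj by (simp add: R_def \<psi>_def algebra_simps)
    qed simp
    finally have Veq: "V z = (\<Sum>j=1..m. share j ?n * ((hillj j z - \<gamma>) * Lj j ?n + R j))" .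
    have "scale ?n * V z = (\<Sum>j=1..m. 1 / L ?n * ((sqrt (real (k ?n)) * share j ?n) * ((hillj j z - \<gamma>) * Lj j ?n + R j)))"
      unfolding Veq scale_def by (simp add: sum_distrib_left mult.assoc)
    also have "\<dots> = (\<Sum>j=1..m. sqrt (share j ?n) * T j + sqrt (share j ?n) * (Lj j ?n / L ?n - 1) * T j +
        1 / L ?n * (sqrt (share j ?n) * sqrt (real (K j ?n)) * R j))"
      unfolding sqrt_k_share T_def using elim(2) by (intro sum.cong) (simp_all add: field_simps)
    also have "\<dots> = W ?n (snd z) + ((\<Sum>j=1..m. sqrt (share j ?n) * (Lj j ?n / L ?n - 1) * T j) +
        1 / L ?n * (\<Sum>j=1..m. sqrt (share j ?n) * sqrt (real (K j ?n)) * R j))"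
      unfolding W_eq T_def[symmetric] by (simp only: sum.distrib sum_distrib_left add.assoc)
    also have "(\<Sum>j=1..m. sqrt (share j ?n) * sqrt (real (K j ?n)) * R j) =
        (\<Sum>j=1..m. sqrt (share j ?n) * (sqrt (real (K j ?n)) * (\<psi> (Zj j z) - \<psi> (sp ?n))) +
          \<gamma> * sqrt (share j ?n) * (sqrt (real (K j ?n)) * (Zj j z - Sj j ?n)))"
      by (intro sum.cong refl) (simp add: R_def algebra_simps)
    finally show ?case unfolding T_def remainder_def .
  qed
qed

lemma scaled_V_lim: "((\<lambda>z. scale (fst z) * V z - \<gamma> * G (fst z) (snd z)) \<longlongrightarrow> mean) whp"
proof -
  have 1: "((\<lambda>z. \<Sum>j=1..m. sqrt (share j (fst z)) * (Lj j (fst z) / L (fst z) - 1) *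
      (sqrt (real (K j (fst z))) * (hillj j z - \<gamma>))) \<longlongrightarrow> (\<Sum>j=1..m. 0)) whp"
    by (rule tendsto_sum) (rule stoch_bounded_null[OF hill_bounded log_lim[folded L_def Lj_def]])
  have sb: "stoch_bounded (\<lambda>z. \<Sum>j=1..m. sqrt (share j (fst z)) * (sqrt (real (K j (fst z))) * (\<psi> (Zj j z) - \<psi> (sp (fst z)))) +
       \<gamma> * sqrt (share j (fst z)) * (sqrt (real (K j (fst z))) * (Zj j z - Sj j (fst z))))"
    by (rule stoch_bounded_sum, simp)
       (rule stoch_bounded_add[OF quantile_gap_bounded stoch_bounded_mult[OF stoch_bounded_mult[OF stoch_bounded_const
          stoch_bounded_fst[OF sqrt_share_bounded]] exponential_sample.threshold_bounded[OF sample]]])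
  have "(remainder \<longlongrightarrow> (\<Sum>j=1..m. 0) + 0) whp"
    unfolding remainder_def[abs_def] by (intro tendsto_add 1 stoch_bounded_null[OF sb inverse_L_lim])
  from tendsto_add[OF W_minus_G this]
  have "((\<lambda>z. (W (fst z) (snd z) - \<gamma> * G (fst z) (snd z)) + remainder z) \<longlongrightarrow> mean) whp" by simp
  thus ?thesis
    by (rule Lim_transform_eventually) (use scaled_V_eq in \<open>eventually_elim, simp\<close>)
qed

lemma weissman_measurable: "\<forall>\<^sub>F n in sequentially. (\<lambda>x. scale n * (weissman_ratio n x - 1)) \<in> borel_measurable P"
  using K_less_N
proof eventually_elim
  case (elim n)
  have [measurable]: "(\<lambda>x. hill (K j n) (N j n) (\<lambda>i. X i j x)) \<in> borel_measurable P"
    "(\<lambda>x. order_stat (N j n - K j n) (N j n) (\<lambda>i. X i j x)) \<in> borel_measurable P" if "j \<in> {1..m}" for j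
  proof -
    have "K j n < N j n" using elim that by blast
    with that show "(\<lambda>x. hill (K j n) (N j n) (\<lambda>i. X i j x)) \<in> borel_measurable P"
      "(\<lambda>x. order_stat (N j n - K j n) (N j n) (\<lambda>i. X i j x)) \<in> borel_measurable P"
      by (auto intro!: hill_measurable order_stat_measurable rvX)
  qed
  show ?case unfolding weissman_ratio_def pooled_weissman_def by measurable
qed

theorem weissman_normal:
  "weak_conv_m (\<lambda>n. distr P borel (\<lambda>x. scale n * (weissman_ratio n x - 1))) (density lborel (normal_density mean \<gamma>))"
proof (rule slutsky_normal_eventually[OF G_clt \<gamma>_pos G_measurable weissman_measurable])
  \<comment> \<open>With \<open>V = U / scale\<close>, the linearisation error of the exponential is
    at most \<open>scale * V\<^sup>2 = U\<^sup>2 / scale\<close>, which vanishes because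
    \<open>U\<close> is bounded in probability and \<open>scale\<close> diverges.\<close>
  define U where "U z = scale (fst z) * V z" for z
  have "stoch_bounded (\<lambda>z. (scale (fst z) * V z - \<gamma> * G (fst z) (snd z)) + \<gamma> * G (fst z) (snd z))"
    by (intro stoch_bounded_add stoch_bounded_tendsto[OF scaled_V_lim] stoch_bounded_mult stoch_bounded_const G_bounded)
  hence U: "stoch_bounded U" by (simp add: U_def[abs_def])
  have "((\<lambda>z. 1 / scale (fst z) * U z) \<longlongrightarrow> 0) whp" by (rule stoch_bounded_null[OF U inverse_scale_lim])
  from tendstoD[OF this zero_less_one]
  have small: "\<forall>\<^sub>F z in whp. \<bar>1 / scale (fst z) * U z\<bar> < 1" by (simp only: dist_norm diff_0_right real_norm_def)
  have sq: "((\<lambda>z. 1 / scale (fst z) * (U z * U z)) \<longlongrightarrow> 0) whp"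
    by (rule stoch_bounded_null[OF stoch_bounded_mult[OF U U] inverse_scale_lim])
  have "((\<lambda>z. scale (fst z) * (weissman_ratio (fst z) (snd z) - 1) - U z) \<longlongrightarrow> 0) whp"
  proof (rule Lim_null_comparison[OF _ sq])
    show "\<forall>\<^sub>F z in whp. norm (scale (fst z) * (weissman_ratio (fst z) (snd z) - 1) - U z) \<le> 1 / scale (fst z) * (U z * U z)"
      using ratio_eq_exp small eventually_fst_whp[OF scale_pos]
    proof eventually_elim
      case (elim z)
      have v: "V z = 1 / scale (fst z) * U z" using elim(3) by (simp add: U_def)
      have "norm (scale (fst z) * (weissman_ratio (fst z) (snd z) - 1) - U z) = scale (fst z) * \<bar>exp (V z) - 1 - V z\<bar>"
        using elim(3) unfolding elim(1) U_def by (simp add: right_diff_distrib[symmetric] abs_mult)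
      also have "\<dots> \<le> scale (fst z) * (V z)\<^sup>2"
        using elim(2,3) v by (intro mult_left_mono abs_exp_minus_one_minus_le) auto
      also have "\<dots> = 1 / scale (fst z) * (U z * U z)"
        using elim(3) unfolding U_def by (simp add: power2_eq_square)
      finally show ?case .
    qed
  qed
  from tendsto_add[OF this scaled_V_lim]
  show "((\<lambda>z. scale (fst z) * (weissman_ratio (fst z) (snd z) - 1) - \<gamma> * G (fst z) (snd z)) \<longlongrightarrow> mean) whp"
    by (simp add: U_def)
qed

end

end

end

theorem theorem5:
  fixes P :: "'a measure" and X :: "nat \<Rightarrow> nat \<Rightarrow> 'a \<Rightarrow> real" and D :: "real measure"
    and \<gamma> \<rho> :: real and A :: "real \<Rightarrow> real"
    and m l :: nat and N K :: "nat \<Rightarrow> nat \<Rightarrow> nat"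
    and b c \<Lambda> :: "nat \<Rightarrow> real"
    and k :: "nat \<Rightarrow> nat" and \<omega> :: "nat \<Rightarrow> nat \<Rightarrow> real" and d :: "nat \<Rightarrow> real"
    and \<mu> :: "real \<Rightarrow> real"
  assumes "prob_space P"
    and indep: "prob_space.indep_vars P (\<lambda>_. borel) (\<lambda>(i, j). X i j) ({1..} \<times> {1..m})"
    and ident: "\<And>i j. 1 \<le> i \<Longrightarrow> j \<in> {1..m} \<Longrightarrow> distr P borel (X i j) = D"
    and cont: "continuous_on UNIV (cdf D)"
    and C2: "second_order_condition (cdf D) \<gamma> \<rho> A"
    and N_total: "\<And>n. (\<Sum>j=1..m. N j n) = n"
    and N_top: "\<And>j. j \<in> {1..m} \<Longrightarrow> filterlim (N j) at_top sequentially"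
    and K_pos: "\<And>j n. j \<in> {1..m} \<Longrightarrow> 1 \<le> K j n"
    and l: "l \<in> {1..m - 1}"
    and low_top: "\<And>j. j \<in> {1..l} \<Longrightarrow> filterlim (K j) at_top sequentially"
    and low_frac: "\<And>j. j \<in> {1..l} \<Longrightarrow> (\<lambda>n. real (K j n) / real (N j n)) \<longlonglongrightarrow> 0"
    and low_b: "\<And>j. j \<in> {1..l} \<Longrightarrow> 0 < b j \<and> (\<lambda>n. real (N 1 n) / real (N j n)) \<longlonglongrightarrow> b j"
    and low_c: "\<And>j. j \<in> {1..l} \<Longrightarrow> 0 < c j \<and> (\<lambda>n. real (K 1 n) / real (K j n)) \<longlonglongrightarrow> c j"
    and low_bias: "\<And>j. j \<in> {1..l} \<Longrightarrow>
          (\<lambda>n. sqrt (real (K j n)) * A (real (N j n) / real (K j n))) \<longlonglongrightarrow> \<Lambda> j"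
    and high_mono: "\<And>j. j \<in> {l+1..m} \<Longrightarrow> mono (K j)"
    and high_frac: "\<And>j. j \<in> {l+1..m} \<Longrightarrow> (\<lambda>n. real (K j n) / real (N j n)) \<longlonglongrightarrow> 0"
    and high_negl: "\<And>j. j \<in> {l+1..m} \<Longrightarrow>
          filterlim (\<lambda>n. real (K 1 n) / real (K j n)) at_top sequentially"
    and high_bias: "\<And>j. j \<in> {l+1..m} \<Longrightarrow>
          (\<lambda>n. sqrt (real (K j n)) * A (real (N j n) / real (K j n))) \<in> O(\<lambda>_. 1)"
  defines "k \<equiv> \<lambda>n. \<Sum>j=1..m. K j n"
    and "\<omega> \<equiv> \<lambda>n j. real (K j n) / real (k n)"
    and "d \<equiv> \<lambda>j. (c j / b j) * ((\<Sum>i=1..l. 1 / c i) / (\<Sum>i=1..l. 1 / b i))"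
    and "\<mu> \<equiv> \<lambda>lam. lam / (1 - \<rho>) * inverse (\<Sum>j=1..l. 1 / c j) * (\<Sum>j=1..l. d j powr \<rho> / c j)"
  shows "\<exists>lam.
    (\<lambda>n. sqrt (real (k n)) * A (real (\<Sum>i=1..l. N i n) / real (\<Sum>i=1..l. K i n))) \<longlonglongrightarrow> lam \<and>
    weak_conv_m
      (\<lambda>n. distr P borel (\<lambda>x. sqrt (real (k n)) *
         (pooled_hill m (\<omega> n) (\<lambda>j. K j n) (\<lambda>j. N j n) (\<lambda>i j. X i j x) - \<gamma>)))
      (density lborel (normal_density (\<mu> lam) \<gamma>)) \<and>
    (\<forall>p :: nat \<Rightarrow> real.
       \<rho> < 0 \<longrightarrow>
       p \<longlonglongrightarrow> 0 \<longrightarrow>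
       filterlim (\<lambda>n. real (k n) / (real n * p n)) at_top sequentially \<longrightarrow>
       filterlim (\<lambda>n. sqrt (real (k n)) / ln (real (k n) / (real n * p n))) at_top sequentially \<longrightarrow>
       (\<lambda>n. MAX j\<in>{1..m}. sqrt (real (K j n)) / sqrt (real (k n)) *
          \<bar>ln (real (K j n) / (real (N j n) * p n)) / ln (real (k n) / (real n * p n)) - 1\<bar>)
         \<longlonglongrightarrow> 0 \<longrightarrow>
       (\<lambda>n. MAX j\<in>{l+1..m}. sqrt (real (K j n)) / sqrt (real (k n)) *
          (sqrt (real (K j n)) * \<bar>A (1 / p n)\<bar>)) \<in> O(\<lambda>_. 1) \<longrightarrow>
       weak_conv_m
         (\<lambda>n. distr P borel (\<lambda>x. sqrt (real (k n)) / ln (real (k n) / (real n * p n)) *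
            (pooled_weissman m (\<omega> n) (\<lambda>j. K j n) (\<lambda>j. N j n) (p n) (\<lambda>i j. X i j x)
               / quantile (cdf D) (1 - p n) - 1)))
         (density lborel (normal_density (\<mu> lam) \<gamma>)))"
proof -
  have frac: "(\<lambda>n. real (K j n) / real (N j n)) \<longlonglongrightarrow> 0" if "j \<in> {1..m}" for j
    using that low_frac[of j] high_frac[of j] by (cases "j \<le> l") auto
  interpret S: pooled_sample P X D \<gamma> \<rho> A m l N K b c \<Lambda>
    by (intro pooled_sample.intro pooled_sample_axioms.intro)
       (fact | rule assms(1) indep ident cont C2 N_top K_pos l low_top frac low_b low_c low_bias high_negl high_bias; assumption?)+
  have k: "k = S.k" by (simp add: k_def S.k_def[abs_def])
  have \<omega>: "\<omega> n = (\<lambda>j. S.share j n)" for n by (simp add: \<omega>_def k S.share_def[abs_def])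
  have \<mu>: "\<mu> S.lam = S.mean"
    by (simp add: \<mu>_def d_def S.mean_def S.dj_def S.C_def S.B_def)
  show ?thesis
  proof (intro exI[of _ S.lam] conjI allI impI)
    show "(\<lambda>n. sqrt (real (k n)) * A (real (\<Sum>i=1..l. N i n) / real (\<Sum>i=1..l. K i n))) \<longlonglongrightarrow> S.lam"
      using S.lam_lim unfolding k S.tbar_def .
    show "weak_conv_m
      (\<lambda>n. distr P borel (\<lambda>x. sqrt (real (k n)) *
         (pooled_hill m (\<omega> n) (\<lambda>j. K j n) (\<lambda>j. N j n) (\<lambda>i j. X i j x) - \<gamma>)))
      (density lborel (normal_density (\<mu> S.lam) \<gamma>))"
      using S.W_normal unfolding S.W_def[abs_def] k \<omega> \<mu> .
  next
    fix p :: "nat \<Rightarrow> real"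
    assume neg: "\<rho> < 0" and p: "p \<longlonglongrightarrow> 0"
      and kp: "filterlim (\<lambda>n. real (k n) / (real n * p n)) at_top sequentially"
      and sc: "filterlim (\<lambda>n. sqrt (real (k n)) / ln (real (k n) / (real n * p n))) at_top sequentially"
      and mx: "(\<lambda>n. MAX j\<in>{1..m}. sqrt (real (K j n)) / sqrt (real (k n)) *
          \<bar>ln (real (K j n) / (real (N j n) * p n)) / ln (real (k n) / (real n * p n)) - 1\<bar>) \<longlonglongrightarrow> 0" (is "?max \<longlonglongrightarrow> 0")
      and mb: "(\<lambda>n. MAX j\<in>{l+1..m}. sqrt (real (K j n)) / sqrt (real (k n)) *
          (sqrt (real (K j n)) * \<bar>A (1 / p n)\<bar>)) \<in> O(\<lambda>_. 1)"
    have sq: "sqrt (real (K j n)) / sqrt (real (k n)) = sqrt (S.share j n)" for j n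
      by (simp add: S.share_def k real_sqrt_divide)
    have log_lim: "(\<lambda>n. sqrt (S.share j n) *
        (ln (real (K j n) / (real (N j n) * p n)) / ln (real (S.k n) / (real n * p n)) - 1)) \<longlonglongrightarrow> 0"
      if j: "j \<in> {1..m}" for j
    proof (rule Lim_null_comparison[OF always_eventually mx], rule allI)
      fix n
      have "norm (sqrt (S.share j n) * (ln (real (K j n) / (real (N j n) * p n)) / ln (real (S.k n) / (real n * p n)) - 1)) =
          sqrt (real (K j n)) / sqrt (real (k n)) * \<bar>ln (real (K j n) / (real (N j n) * p n)) / ln (real (k n) / (real n * p n)) - 1\<bar>"
        unfolding sq unfolding k using S.share_bounds(1)[OF j] by (simp add: abs_mult)
      also have "\<dots> \<le> ?max n"
        using j by (intro Max_ge) auto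
      finally show "norm (sqrt (S.share j n) * (ln (real (K j n) / (real (N j n) * p n)) / ln (real (S.k n) / (real n * p n)) - 1)) \<le>
          ?max n" .
    qed
    obtain M0 where M0: "\<forall>\<^sub>F n in sequentially. norm (MAX j\<in>{l+1..m}. sqrt (real (K j n)) / sqrt (real (k n)) *
          (sqrt (real (K j n)) * \<bar>A (1 / p n)\<bar>)) \<le> M0 * norm (1::real)"
      using mb by (rule landau_o.bigE)
    have extra: "(\<lambda>n. sqrt (S.share j n) * (sqrt (real (K j n)) * A (1 / p n))) \<in> O(\<lambda>_. 1)"
      if j: "j \<in> {l+1..m}" for j
    proof (rule bigoI[of _ M0])
      show "\<forall>\<^sub>F n in sequentially. norm (sqrt (S.share j n) * (sqrt (real (K j n)) * A (1 / p n))) \<le> M0 * norm (1::real)"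
        using M0
      proof eventually_elim
        case (elim n)
        have jm: "j \<in> {1..m}" using j by auto
        have "norm (sqrt (S.share j n) * (sqrt (real (K j n)) * A (1 / p n))) =
            sqrt (real (K j n)) / sqrt (real (k n)) * (sqrt (real (K j n)) * \<bar>A (1 / p n)\<bar>)"
          unfolding sq using S.share_bounds(1)[OF jm] by (simp add: abs_mult)
        also have "\<dots> \<le> (MAX j\<in>{l+1..m}. sqrt (real (K j n)) / sqrt (real (k n)) * (sqrt (real (K j n)) * \<bar>A (1 / p n)\<bar>))"
          using j by (intro Max_ge) auto
        finally show ?case using elim by simp
      qed
    qed
    have "weak_conv_m (\<lambda>n. distr P borel (\<lambda>x. S.scale p n * (S.weissman_ratio p n x - 1)))
        (density lborel (normal_density S.mean \<gamma>))"
      by (rule S.weissman_normal[OF neg p kp[unfolded k] sc[unfolded k] log_lim extra])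
    thus "weak_conv_m
         (\<lambda>n. distr P borel (\<lambda>x. sqrt (real (k n)) / ln (real (k n) / (real n * p n)) *
            (pooled_weissman m (\<omega> n) (\<lambda>j. K j n) (\<lambda>j. N j n) (p n) (\<lambda>i j. X i j x)
               / quantile (cdf D) (1 - p n) - 1)))
         (density lborel (normal_density (\<mu> S.lam) \<gamma>))"
      unfolding S.scale_def S.L_def S.weissman_ratio_def k \<omega> \<mu> .
  qed
qed

end
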